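(* For each fixed $p\in(0,1)$, the sequence $\widetilde{\mathbb{P}}_{n,p}$ obeys a large deviation principle in the space $\widetilde{\mathcal{W}}$ (equipped with the cut metric $\delta_\Box$) with rate function $I_p$. Explicitly, for any closed set $\widetilde F\subseteq\widetilde{\mathcal{W}}$, $$\limsup_{n\to\infty}\frac{1}{n^2}\log\widetilde{\mathbb{P}}_{n,p}(\widetilde F)\le-\inf_{\widetilde h\in\widetilde F}I_p(\widetilde h),$$ and for any open set $\widetilde U\subseteq\widetilde{\mathcal{W}}$, $$\liminf_{n\to\infty}\frac{1}{n^2}\log\widetilde{\mathbb{P}}_{n,p}(\widetilde U)\ge-\inf_{\widetilde h\in\widetilde U}I_p(\widetilde h).$$
   Context: $\mathcal{W}$ is the set of measurable functions $f:[0,1]^2\to[0,1]$ with $f(x,y)=f(y,x)$. On $\mathcal{W}$ the cut distance is $d_\Box(f,g)=\sup_{S,T\subseteq[0,1]}\left|\int_{S\times T}[f(x,y)-g(x,y)]\,dx\,dy\right|$ (sup over measurable $S,T$). $\Sigma$ is the set of measure preserving bijections $\sigma:[0,1]\to[0,1]$, and $g_\sigma(x,y):=g(\sigma x,\sigma y)$. For $g\in\mathcal{W}$, $\widetilde g$ denotes the closure in $(\mathcal{W},d_\Box)$ of the orbit $\{g_\sigma:\sigma\in\Sigma\}$; the quotient space of all $\widetilde g$ is $\widetilde{\mathcal{W}}$, with quotient map $\tau:g\mapsto\widetilde g$, and metric $\delta_\Box(\widetilde f,\widetilde g)=\inf_{\sigma\in\Sigma}d_\Box(f,g_\sigma)$.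 For a finite simple graph $G$ on $\{1,\dots,n\}$, $f^G\in\mathcal{W}$ is defined by $f^G(x,y)=1$ if $(\lceil nx\rceil,\lceil ny\rceil)$ is an edge of $G$ and $0$ otherwise. $G(n,p)$ is the random graph on $n$ vertices in which each edge is present independently with probability $p$. $\widetilde{\mathbb{P}}_{n,p}$ is the law on $\widetilde{\mathcal{W}}$ of $\tau f^{G(n,p)}$. For $u\in[0,1]$, $I_p(u)=\frac12u\log\frac up+\frac12(1-u)\log\frac{1-u}{1-p}$ (with $0\log0=0$); for $h\in\mathcal{W}$, $I_p(h)=\int_0^1\int_0^1I_p(h(x,y))\,dx\,dy$; and $I_p(\widetilde h):=I_p(h)$ on $\widetilde{\mathcal{W}}$ (this does not depend on the choice of representative). The infimum over the empty set is $+\infty$ and $\log 0=-\infty$. *)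

theory Defs
  imports "HOL-Probability.Probability"
begin

abbreviation unit_square :: "(real \<times> real) set" where
  "unit_square \<equiv> {0..1} \<times> {0..1}"

abbreviation unit_interval_measure :: "real measure" where
  "unit_interval_measure \<equiv> restrict_space lborel {0..1}"

text \<open>
  Measurable means Borel measurable throughout. A function on the unit square is represented by
  its extensional total extension, so that equality of members of \<open>graphons\<close> is
  equality of functions on the square.
\<close>

definition graphons :: "(real \<times> real \<Rightarrow> real) set" where
  "graphons = {f \<in> unit_square \<rightarrow>\<^sub>E {0..1}.
     f \<in> borel_measurable (restrict_space borel unit_square) \<and>
     (\<forall>x\<in>{0..1}. \<forall>y\<in>{0..1}. f (x, y) = f (y, x))}"

definition cut_dist :: "(real \<times> real \<Rightarrow> real) \<Rightarrow> (real \<times> real \<Rightarrow> real) \<Rightarrow> real" where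
  "cut_dist f g =
     (SUP (S, T) \<in> sets unit_interval_measure \<times> sets unit_interval_measure.
        \<bar>LINT z:S \<times> T|lborel. f z - g z\<bar>)"

text \<open>
  A measure preserving bijection is an automorphism of the Borel measure space. (For bijections of
  a standard Borel space, measurability of the inverse is automatic by the Lusin-Souslin theorem.)
\<close>

definition mp_bijections :: "(real \<Rightarrow> real) set" where
  "mp_bijections = {\<sigma>. bij_betw \<sigma> {0..1} {0..1} \<and>
     \<sigma> \<in> measurable unit_interval_measure unit_interval_measure \<and>
     the_inv_into {0..1} \<sigma> \<in> measurable unit_interval_measure unit_interval_measure \<and>
     distr unit_interval_measure unit_interval_measure \<sigma> = unit_interval_measure}"

definition rearrange :: "(real \<times> real \<Rightarrow> real) \<Rightarrow> (real \<Rightarrow> real) \<Rightarrow> real \<times> real \<Rightarrow> real" where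
  "rearrange g \<sigma> = restrict (\<lambda>(x, y). g (\<sigma> x, \<sigma> y)) unit_square"

definition cut_closure :: "(real \<times> real \<Rightarrow> real) set \<Rightarrow> (real \<times> real \<Rightarrow> real) set" where
  "cut_closure A = {h \<in> graphons. \<forall>\<epsilon>>0. \<exists>f\<in>A. cut_dist h f < \<epsilon>}"

definition \<tau> :: "(real \<times> real \<Rightarrow> real) \<Rightarrow> (real \<times> real \<Rightarrow> real) set" where
  "\<tau> g = cut_closure (rearrange g ` mp_bijections)"

definition graphon_classes :: "(real \<times> real \<Rightarrow> real) set set" where
  "graphon_classes = \<tau> ` graphons"

definition representative :: "(real \<times> real \<Rightarrow> real) set \<Rightarrow> real \<times> real \<Rightarrow> real" where
  "representative A = (SOME g. g \<in> graphons \<and> \<tau> g = A)"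

text \<open>
  The value off \<open>graphon_classes\<close> is irrelevant; it is fixed because \<open>Metric_space\<close>
  asks for nonnegativity and symmetry on the whole type. Independence of the representatives is
  \<open>delta_cut_tau\<close> below.
\<close>

definition delta_cut ::
  "(real \<times> real \<Rightarrow> real) set \<Rightarrow> (real \<times> real \<Rightarrow> real) set \<Rightarrow> real" where
  "delta_cut A B =
     (if A \<in> graphon_classes \<and> B \<in> graphon_classes
      then INF \<sigma>\<in>mp_bijections. cut_dist (representative A) (rearrange (representative B) \<sigma>)
      else 0)"

abbreviation graphon_topology :: "(real \<times> real \<Rightarrow> real) set topology" where
  "graphon_topology \<equiv> Metric_space.mtopology graphon_classes delta_cut"

text \<open>Graphs on \<open>{1..n}\<close> are given by their sets of edges, an edge being a two-element set.\<close>

definition potential_edges :: "nat \<Rightarrow> nat set set" where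
  "potential_edges n = {e. e \<subseteq> {1..n} \<and> card e = 2}"

definition random_graph :: "nat \<Rightarrow> real \<Rightarrow> nat set set pmf" where
  "random_graph n p =
     map_pmf (\<lambda>\<omega>. {e \<in> potential_edges n. \<omega> e})
       (Pi_pmf (potential_edges n) False (\<lambda>_. bernoulli_pmf p))"

definition graph_graphon :: "nat \<Rightarrow> nat set set \<Rightarrow> real \<times> real \<Rightarrow> real" where
  "graph_graphon n E = restrict (\<lambda>(x, y).
     if {nat \<lceil>real n * x\<rceil>, nat \<lceil>real n * y\<rceil>} \<in> E then 1 else 0) unit_square"

definition graphon_law :: "nat \<Rightarrow> real \<Rightarrow> (real \<times> real \<Rightarrow> real) set pmf" where
  "graphon_law n p = map_pmf (\<lambda>E. \<tau> (graph_graphon n E)) (random_graph n p)"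

text \<open>The convention \<open>0 log 0 = 0\<close> is built in, since \<open>0 * x = 0\<close>.\<close>

definition rate_density :: "real \<Rightarrow> real \<Rightarrow> real" where
  "rate_density p u = 1/2 * u * ln (u / p) + 1/2 * (1 - u) * ln ((1 - u) / (1 - p))"

definition rate :: "real \<Rightarrow> (real \<times> real \<Rightarrow> real) \<Rightarrow> real" where
  "rate p h = (LINT x:{0..1}|lborel. LINT y:{0..1}|lborel. rate_density p (h (x, y)))"

text \<open>
  By lower semicontinuity of \<open>rate p\<close> in the cut distance, the choice of representative is
  immaterial.
\<close>

definition class_rate :: "real \<Rightarrow> (real \<times> real \<Rightarrow> real) set \<Rightarrow> real" where
  "class_rate p A = rate p (representative A)"

definition log_ereal :: "real \<Rightarrow> ereal" where
  "log_ereal x = (if x = 0 then -\<infinity> else ereal (ln x))"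

section \<open>The quotient is a metric space\<close>

lemma sets_unit_interval_measure:
  "S \<in> sets unit_interval_measure \<longleftrightarrow> S \<in> sets borel \<and> S \<subseteq> {0..1}"
  by (subst sets_restrict_space_iff) auto

lemma graphon_integrable:
  assumes f: "f \<in> graphons" and S: "S \<in> sets unit_interval_measure" and T: "T \<in> sets unit_interval_measure"
  shows "set_integrable lborel (S \<times> T) f"
proof -
  have m: "(\<lambda>z. indicator unit_square z *\<^sub>R f z) \<in> borel_measurable lborel"
    using f by (subst (asm) graphons_def) (auto simp: borel_measurable_restrict_space_iff borel_Times)
  have ST: "S \<times> T \<in> sets lborel" "S \<times> T \<subseteq> unit_square"
    using S T by (auto simp: sets_unit_interval_measure borel_Times)
  have b: "norm (f z) \<le> 1" if "z \<in> unit_square" for z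
    using f that by (auto simp: graphons_def PiE_def Pi_def)
  have "emeasure lborel unit_square = 1"
    by (simp add: lborel_prod[symmetric] lborel.emeasure_pair_measure_Times)
  then have "emeasure lborel (S \<times> T) \<le> 1"
    using emeasure_mono[OF ST(2), of lborel] by (simp add: borel_Times)
  then have "integrable lborel (\<lambda>z. indicator (S \<times> T) z *\<^sub>R (indicator unit_square z *\<^sub>R f z))"
    using ST m b
    by (intro integrableI_bounded_set_indicator[where B = 1]) (auto simp: le_less_trans indicator_def)
  also have "(\<lambda>z. indicator (S \<times> T) z *\<^sub>R (indicator unit_square z *\<^sub>R f z)) = (\<lambda>z. indicator (S \<times> T) z *\<^sub>R f z)"
    using ST(2) by (intro ext) (auto split: split_indicator)
  finally show ?thesis by (simp add: set_integrable_def)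
qed

lemma cut_integral_le_1:
  assumes f: "f \<in> graphons" "g \<in> graphons"
    and S: "S \<in> sets unit_interval_measure" and T: "T \<in> sets unit_interval_measure"
  shows "\<bar>LINT z:S \<times> T|lborel. f z - g z\<bar> \<le> 1"
proof -
  have ST: "S \<times> T \<in> sets lborel" "S \<times> T \<subseteq> unit_square"
    using S T by (auto simp: sets_unit_interval_measure borel_Times)
  have b: "\<bar>f z - g z\<bar> \<le> 1" if "z \<in> unit_square" for z
  proof -
    have "f z \<in> {0..1}" "g z \<in> {0..1}" using f that by (auto simp: graphons_def PiE_def Pi_def)
    then show ?thesis by auto
  qed
  have I: "set_integrable lborel (S \<times> T) (\<lambda>z. f z - g z)"
    using graphon_integrable[OF f(1) S T] graphon_integrable[OF f(2) S T] by auto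
  have e: "emeasure lborel unit_square = 1"
    by (simp add: lborel_prod[symmetric] lborel.emeasure_pair_measure_Times)
  have "\<bar>LINT z:S \<times> T|lborel. f z - g z\<bar> \<le> (LINT z|lborel. \<bar>indicator (S \<times> T) z *\<^sub>R (f z - g z)\<bar>)"
    unfolding set_lebesgue_integral_def by (rule integral_abs_bound)
  also have "\<dots> \<le> (LINT z|lborel. indicator unit_square z)"
  proof (rule integral_mono)
    show "integrable lborel (\<lambda>z. \<bar>indicator (S \<times> T) z *\<^sub>R (f z - g z)\<bar>)"
      using I unfolding set_integrable_def by (rule integrable_abs)
    show "integrable lborel (indicator unit_square :: _ \<Rightarrow> real)"
      using e by (auto simp: borel_Times)
  qed (use ST b in \<open>auto simp: indicator_def\<close>)
  also have "\<dots> = 1" using e by (simp add: measure_def)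
  finally show ?thesis .
qed

lemma cut_dist_upper:
  assumes "f \<in> graphons" "g \<in> graphons" "S \<in> sets unit_interval_measure" "T \<in> sets unit_interval_measure"
  shows "\<bar>LINT z:S \<times> T|lborel. f z - g z\<bar> \<le> cut_dist f g"
proof -
  have "bdd_above ((\<lambda>(S, T). \<bar>LINT z:S \<times> T|lborel. f z - g z\<bar>) `
      (sets unit_interval_measure \<times> sets unit_interval_measure))"
    using cut_integral_le_1[OF assms(1,2)] by (intro bdd_aboveI[where M = 1]) auto
  from cSUP_upper[OF _ this, of "(S, T)"] show ?thesis using assms by (auto simp: cut_dist_def)
qed

lemma cut_dist_least:
  assumes "\<And>S T. S \<in> sets unit_interval_measure \<Longrightarrow> T \<in> sets unit_interval_measure \<Longrightarrow>
    \<bar>LINT z:S \<times> T|lborel. f z - g z\<bar> \<le> c"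
  shows "cut_dist f g \<le> c"
proof -
  have "sets unit_interval_measure \<times> sets unit_interval_measure \<noteq> {}" by auto
  then show ?thesis unfolding cut_dist_def using assms by (intro cSUP_least) auto
qed

lemma cut_dist_nonneg: "f \<in> graphons \<Longrightarrow> g \<in> graphons \<Longrightarrow> 0 \<le> cut_dist f g"
  using cut_dist_upper[of f g "{}" "{}"] by auto

lemma cut_dist_self: "f \<in> graphons \<Longrightarrow> cut_dist f f = 0"
  by (intro antisym cut_dist_nonneg cut_dist_least) auto

lemma cut_dist_commute: "cut_dist f g = cut_dist g f"
proof -
  have "\<bar>LINT z:S|lborel. f z - g z\<bar> = \<bar>LINT z:S|lborel. g z - f z\<bar>" for S
  proof -
    have "(LINT z:S|lborel. f z - g z) = (LINT z:S|lborel. - (g z - f z))" by simp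
    also have "\<dots> = - (LINT z:S|lborel. g z - f z)"
      unfolding set_lebesgue_integral_def by (subst integral_minus[symmetric]) (simp only: scaleR_minus_right)
    finally show ?thesis by simp
  qed
  then show ?thesis by (simp add: cut_dist_def)
qed

lemma cut_dist_triangle:
  assumes "f \<in> graphons" "g \<in> graphons" "h \<in> graphons"
  shows "cut_dist f h \<le> cut_dist f g + cut_dist g h"
proof (rule cut_dist_least)
  fix S T assume ST: "S \<in> sets unit_interval_measure" "T \<in> sets unit_interval_measure"
  have "(LINT z:S \<times> T|lborel. f z - h z) = (LINT z:S \<times> T|lborel. f z - g z) + (LINT z:S \<times> T|lborel. g z - h z)"
    using graphon_integrable[OF _ ST] assms by simp
  then show "\<bar>LINT z:S \<times> T|lborel. f z - h z\<bar> \<le> cut_dist f g + cut_dist g h"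
    using cut_dist_upper[OF assms(1,2) ST] cut_dist_upper[OF assms(2,3) ST] by linarith
qed

lemma mp_bijectionsD:
  assumes "\<sigma> \<in> mp_bijections"
  shows "bij_betw \<sigma> {0..1} {0..1}" "\<sigma> \<in> measurable unit_interval_measure unit_interval_measure"
    "the_inv_into {0..1} \<sigma> \<in> measurable unit_interval_measure unit_interval_measure"
    "distr unit_interval_measure unit_interval_measure \<sigma> = unit_interval_measure"
    "x \<in> {0..1} \<Longrightarrow> \<sigma> x \<in> {0..1}"
    "x \<in> {0..1} \<Longrightarrow> the_inv_into {0..1} \<sigma> (\<sigma> x) = x"
    "x \<in> {0..1} \<Longrightarrow> \<sigma> (the_inv_into {0..1} \<sigma> x) = x"
    "x \<in> {0..1} \<Longrightarrow> the_inv_into {0..1} \<sigma> x \<in> {0..1}"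
  using assms
  by (auto simp: mp_bijections_def bij_betw_def the_inv_into_f_f f_the_inv_into_f
      intro: the_inv_into_into simp del: atLeastAtMost_iff)

lemma space_uim [simp]: "space unit_interval_measure = {0..1}"
  by (simp add: space_restrict_space)

lemma mp_bijections_id: "id \<in> mp_bijections"
proof -
  have "the_inv_into {0..1} id \<in> measurable unit_interval_measure unit_interval_measure \<longleftrightarrow>
      id \<in> measurable unit_interval_measure unit_interval_measure"
    by (rule measurable_cong) (auto simp: the_inv_into_f_eq)
  then show ?thesis by (auto simp: mp_bijections_def id_def distr_id2 bij_betw_def)
qed

lemma mp_bijections_comp:
  assumes s: "\<sigma> \<in> mp_bijections" and r: "\<rho> \<in> mp_bijections"
  shows "\<sigma> \<circ> \<rho> \<in> mp_bijections"
proof -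
  note S = mp_bijectionsD[OF s] and R = mp_bijectionsD[OF r]
  have b: "bij_betw (\<sigma> \<circ> \<rho>) {0..1} {0..1}" using S(1) R(1) by (rule bij_betw_trans[rotated])
  have "the_inv_into {0..1} (\<sigma> \<circ> \<rho>) \<in> measurable unit_interval_measure unit_interval_measure \<longleftrightarrow>
      the_inv_into {0..1} \<rho> \<circ> the_inv_into {0..1} \<sigma> \<in> measurable unit_interval_measure unit_interval_measure"
  proof (rule measurable_cong)
    fix w assume "w \<in> space unit_interval_measure"
    then have w: "w \<in> {0..1}" by simp
    show "the_inv_into {0..1} (\<sigma> \<circ> \<rho>) w = (the_inv_into {0..1} \<rho> \<circ> the_inv_into {0..1} \<sigma>) w"
      using w S(7,8) R(7,8) b by (intro the_inv_into_f_eq) (auto simp: bij_betw_def simp del: atLeastAtMost_iff)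
  qed
  moreover have "the_inv_into {0..1} \<rho> \<circ> the_inv_into {0..1} \<sigma> \<in> measurable unit_interval_measure unit_interval_measure"
    using S(3) R(3) by (rule measurable_comp)
  moreover have "\<sigma> \<circ> \<rho> \<in> measurable unit_interval_measure unit_interval_measure"
    using R(2) S(2) by (rule measurable_comp)
  moreover have "distr unit_interval_measure unit_interval_measure (\<sigma> \<circ> \<rho>) = unit_interval_measure"
    using distr_distr[OF S(2) R(2)] S(4) R(4) by simp
  ultimately show ?thesis using b by (simp add: mp_bijections_def)
qed

lemma mp_bijections_inv:
  assumes s: "\<sigma> \<in> mp_bijections"
  shows "the_inv_into {0..1} \<sigma> \<in> mp_bijections"
proof -
  note S = mp_bijectionsD[OF s]
  let ?i = "the_inv_into {0..1} \<sigma>"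
  have b: "bij_betw ?i {0..1} {0..1}" using S(1) by (rule bij_betw_the_inv_into)
  have "the_inv_into {0..1} ?i \<in> measurable unit_interval_measure unit_interval_measure \<longleftrightarrow>
      \<sigma> \<in> measurable unit_interval_measure unit_interval_measure"
  proof (rule measurable_cong)
    fix w assume "w \<in> space unit_interval_measure"
    then have w: "w \<in> {0..1}" by simp
    show "the_inv_into {0..1} ?i w = \<sigma> w"
      using w S(5,6) b by (rule_tac the_inv_into_f_eq) (auto simp: bij_betw_def simp del: atLeastAtMost_iff)
  qed
  moreover have "distr unit_interval_measure unit_interval_measure ?i = unit_interval_measure"
  proof -
    have "distr unit_interval_measure unit_interval_measure ?i
        = distr (distr unit_interval_measure unit_interval_measure \<sigma>) unit_interval_measure ?i"
      using S(4) by simp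
    also have "\<dots> = distr unit_interval_measure unit_interval_measure (?i \<circ> \<sigma>)"
      using S(3,2) by (rule distr_distr)
    also have "\<dots> = distr unit_interval_measure unit_interval_measure (\<lambda>x. x)"
      using S(6) by (intro distr_cong) auto
    finally show ?thesis by (simp add: distr_id2)
  qed
  ultimately show ?thesis using b S(2,3) by (simp add: mp_bijections_def)
qed


definition mp_ext :: "(real \<Rightarrow> real) \<Rightarrow> real \<Rightarrow> real" where
  "mp_ext \<sigma> x = (if x \<in> {0..1} then \<sigma> x else x)"

definition mp_ext2 :: "(real \<Rightarrow> real) \<Rightarrow> real \<times> real \<Rightarrow> real \<times> real" where
  "mp_ext2 \<sigma> = (\<lambda>(x, y). (mp_ext \<sigma> x, mp_ext \<sigma> y))"

lemma mp_ext_measurable: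
  assumes s: "\<sigma> \<in> mp_bijections"
  shows "mp_ext \<sigma> \<in> borel_measurable borel"
proof -
  have "\<sigma> \<in> borel_measurable unit_interval_measure"
    using mp_bijectionsD(2)[OF s] measurable_restrict_space2_iff[of \<sigma> _ lborel] by simp
  then have "(\<lambda>x. indicator {0..1} x *\<^sub>R \<sigma> x) \<in> borel_measurable lborel"
    by (subst (asm) borel_measurable_restrict_space_iff) auto
  then have "(\<lambda>x. indicator {0..1} x *\<^sub>R \<sigma> x + indicator (- {0..1}) x * x) \<in> borel_measurable borel"
    by (intro borel_measurable_add) (auto intro!: borel_measurable_times borel_measurable_indicator)
  moreover have "mp_ext \<sigma> = (\<lambda>x. indicator {0..1} x *\<^sub>R \<sigma> x + indicator (- {0..1}) x * x)"
    by (auto simp: mp_ext_def indicator_def fun_eq_iff)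
  ultimately show ?thesis by simp
qed

lemma mp_ext_distr:
  assumes s: "\<sigma> \<in> mp_bijections"
  shows "distr lborel lborel (mp_ext \<sigma>) = lborel"
proof (rule measure_eqI)
  note S = mp_bijectionsD[OF s]
  have m: "mp_ext \<sigma> \<in> measurable lborel lborel" using mp_ext_measurable[OF s] by simp
  fix A assume "A \<in> sets (distr lborel lborel (mp_ext \<sigma>))"
  then have A: "A \<in> sets borel" by simp
  let ?I = "{0..1::real}"
  have IA: "A \<inter> ?I \<in> sets unit_interval_measure" using A by (auto simp: sets_unit_interval_measure)
  have P: "\<sigma> -` (A \<inter> ?I) \<inter> ?I \<in> sets unit_interval_measure"
    using measurable_sets[OF S(2) IA] by simp
  then have Pb: "\<sigma> -` (A \<inter> ?I) \<inter> ?I \<in> sets borel" by (simp add: sets_unit_interval_measure)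
  have "emeasure unit_interval_measure (A \<inter> ?I)
      = emeasure (distr unit_interval_measure unit_interval_measure \<sigma>) (A \<inter> ?I)" using S(4) by simp
  also have "\<dots> = emeasure unit_interval_measure (\<sigma> -` (A \<inter> ?I) \<inter> ?I)"
    using emeasure_distr[OF S(2) IA] by simp
  finally have e: "emeasure lborel (A \<inter> ?I) = emeasure lborel (\<sigma> -` (A \<inter> ?I) \<inter> ?I)"
    by (simp add: emeasure_restrict_space)
  have "mp_ext \<sigma> -` A \<inter> space lborel = (\<sigma> -` (A \<inter> ?I) \<inter> ?I) \<union> (A - ?I)"
    using S(5) by (auto simp: mp_ext_def split: if_splits)
  then have "emeasure (distr lborel lborel (mp_ext \<sigma>)) A
      = emeasure lborel ((\<sigma> -` (A \<inter> ?I) \<inter> ?I) \<union> (A - ?I))"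
    using A by (simp add: emeasure_distr[OF m])
  also have "\<dots> = emeasure lborel (A \<inter> ?I) + emeasure lborel (A - ?I)"
    unfolding e by (rule plus_emeasure[symmetric]) (use A Pb in auto)
  also have "\<dots> = emeasure lborel ((A \<inter> ?I) \<union> (A - ?I))"
    by (rule plus_emeasure) (use A in auto)
  also have "(A \<inter> ?I) \<union> (A - ?I) = A" by auto
  finally show "emeasure (distr lborel lborel (mp_ext \<sigma>)) A = emeasure lborel A" .
qed simp

lemma mp_ext2_measurable:
  assumes s: "\<sigma> \<in> mp_bijections"
  shows "mp_ext2 \<sigma> \<in> measurable borel borel"
proof -
  have [measurable]: "mp_ext \<sigma> \<in> borel_measurable borel" by (rule mp_ext_measurable[OF s])
  have "(\<lambda>z. (mp_ext \<sigma> (fst z), mp_ext \<sigma> (snd z))) \<in> measurable (borel \<Otimes>\<^sub>M borel) (borel \<Otimes>\<^sub>M borel)"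
    by measurable
  then show ?thesis by (simp add: mp_ext2_def borel_prod case_prod_unfold)
qed

lemma mp_ext2_distr:
  assumes s: "\<sigma> \<in> mp_bijections"
  shows "distr lborel lborel (mp_ext2 \<sigma>) = lborel"
proof -
  have m: "mp_ext \<sigma> \<in> measurable lborel lborel" using mp_ext_measurable[OF s] by simp
  have "distr lborel lborel (mp_ext \<sigma>) \<Otimes>\<^sub>M distr lborel lborel (mp_ext \<sigma>)
      = distr (lborel \<Otimes>\<^sub>M lborel) (lborel \<Otimes>\<^sub>M lborel) (\<lambda>(x, y). (mp_ext \<sigma> x, mp_ext \<sigma> y))"
    using m m by (rule pair_measure_distr) (simp add: mp_ext_distr[OF s] lborel.sigma_finite_measure_axioms)
  then show ?thesis by (simp add: mp_ext_distr[OF s] lborel_prod mp_ext2_def)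
qed

lemma graphon_measurable:
  assumes g: "g \<in> graphons"
  shows "(\<lambda>z. indicator unit_square z *\<^sub>R g z) \<in> borel_measurable borel"
  using g by (subst (asm) graphons_def) (auto simp: borel_measurable_restrict_space_iff borel_Times)

lemma rearrange_graphon:
  assumes g: "g \<in> graphons" and s: "\<sigma> \<in> mp_bijections"
  shows "rearrange g \<sigma> \<in> graphons"
proof -
  note S = mp_bijectionsD[OF s]
  have "(\<lambda>z. indicator unit_square z *\<^sub>R rearrange g \<sigma> z)
      = (\<lambda>z. (\<lambda>z. indicator unit_square z *\<^sub>R g z) (mp_ext2 \<sigma> z))"
    using S(5) by (auto simp: rearrange_def indicator_def mp_ext2_def mp_ext_def fun_eq_iff)
  also have "\<dots> \<in> borel_measurable borel"
    using mp_ext2_measurable[OF s] graphon_measurable[OF g] by (rule measurable_compose)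
  finally have "rearrange g \<sigma> \<in> borel_measurable (restrict_space borel unit_square)"
    by (subst borel_measurable_restrict_space_iff) (auto simp: borel_Times)
  moreover have "rearrange g \<sigma> (x, y) = rearrange g \<sigma> (y, x)" if "x \<in> {0..1}" "y \<in> {0..1}" for x y
    using g that S(5)[of x] S(5)[of y] by (auto simp: rearrange_def graphons_def)
  moreover have "rearrange g \<sigma> \<in> unit_square \<rightarrow>\<^sub>E {0..1}"
    unfolding rearrange_def
  proof (rule PiE_I)
    fix z assume z: "z \<in> unit_square"
    obtain x y where xy: "z = (x, y)" by force
    have "g \<in> unit_square \<rightarrow> {0..1}" using g by (auto simp: graphons_def PiE_def)
    moreover have "(\<sigma> x, \<sigma> y) \<in> unit_square" using z xy S(5)[of x] S(5)[of y] by auto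
    ultimately have "g (\<sigma> x, \<sigma> y) \<in> {0..1}" by (rule Pi_mem)
    then show "restrict (\<lambda>(x, y). g (\<sigma> x, \<sigma> y)) unit_square z \<in> {0..1}" using z xy by simp
  qed auto
  ultimately show ?thesis by (auto simp: graphons_def)
qed

lemma rearrange_rearrange:
  assumes "\<sigma> \<in> mp_bijections" "\<rho> \<in> mp_bijections"
  shows "rearrange (rearrange g \<sigma>) \<rho> = rearrange g (\<sigma> \<circ> \<rho>)"
  using mp_bijectionsD(5)[OF assms(1)] mp_bijectionsD(5)[OF assms(2)]
  by (auto simp: rearrange_def fun_eq_iff restrict_def)

lemma rearrange_inv:
  assumes "g \<in> graphons" "\<sigma> \<in> mp_bijections"
  shows "rearrange (rearrange g \<sigma>) (the_inv_into {0..1} \<sigma>) = g"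
proof -
  have "rearrange g (\<sigma> \<circ> the_inv_into {0..1} \<sigma>) = restrict g unit_square"
    unfolding rearrange_def using mp_bijectionsD(7)[OF assms(2)] by (intro restrict_ext) auto
  also have "\<dots> = g" using assms(1) by (intro extensional_restrict) (auto simp: graphons_def PiE_def)
  finally show ?thesis by (simp add: rearrange_rearrange assms mp_bijections_inv)
qed

lemma cut_dist_rearrange_le:
  assumes f: "f \<in> graphons" and g: "g \<in> graphons" and s: "\<sigma> \<in> mp_bijections"
  shows "cut_dist (rearrange f \<sigma>) (rearrange g \<sigma>) \<le> cut_dist f g"
proof (rule cut_dist_least)
  note D = mp_bijectionsD[OF s]
  let ?i = "the_inv_into {0..1} \<sigma>"
  fix S T assume S: "S \<in> sets unit_interval_measure" and T: "T \<in> sets unit_interval_measure"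
  let ?S = "?i -` S \<inter> {0..1}" and ?T = "?i -` T \<inter> {0..1}"
  let ?H = "\<lambda>w. indicator (?S \<times> ?T) w *\<^sub>R (f w - g w)"
  have S': "?S \<in> sets unit_interval_measure" using measurable_sets[OF D(3) S] by simp
  have T': "?T \<in> sets unit_interval_measure" using measurable_sets[OF D(3) T] by simp
  have sub: "S \<subseteq> {0..1}" "T \<subseteq> {0..1}" using S T by (auto simp: sets_unit_interval_measure)
  have "set_integrable lborel (?S \<times> ?T) (\<lambda>z. f z - g z)"
    using graphon_integrable[OF f S' T'] graphon_integrable[OF g S' T'] by auto
  then have H: "?H \<in> borel_measurable lborel" unfolding set_integrable_def by (rule borel_measurable_integrable)
  have eq: "indicator (S \<times> T) z *\<^sub>R (rearrange f \<sigma> z - rearrange g \<sigma> z) = ?H (mp_ext2 \<sigma> z)" for z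
  proof (cases "z \<in> unit_square")
    case True
    then obtain x y where z: "z = (x, y)" "x \<in> {0..1}" "y \<in> {0..1}" by auto
    with D(5,6)[of x] D(5,6)[of y] show ?thesis
      by (auto simp: rearrange_def mp_ext2_def mp_ext_def indicator_def)
  next
    case False
    then have "z \<notin> S \<times> T" using sub by auto
    moreover have "mp_ext \<sigma> x \<in> {0..1} \<longleftrightarrow> x \<in> {0..1}" for x
      using D(5)[of x] by (simp add: mp_ext_def)
    then have "mp_ext2 \<sigma> z \<notin> ?S \<times> ?T"
      using False by (auto simp: mp_ext2_def split: prod.splits simp del: atLeastAtMost_iff)
    ultimately have "z \<notin> S \<times> T" "mp_ext2 \<sigma> z \<notin> ?S \<times> ?T" by auto
    then show ?thesis by simp
  qed
  have "(LINT z:S \<times> T|lborel. rearrange f \<sigma> z - rearrange g \<sigma> z) = (LINT z|lborel. ?H (mp_ext2 \<sigma> z))"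
    unfolding set_lebesgue_integral_def eq ..
  also have "\<dots> = (LINT z|distr lborel lborel (mp_ext2 \<sigma>). ?H z)"
    using mp_ext2_measurable[OF s] H by (intro integral_distr[symmetric]) auto
  also have "\<dots> = (LINT z:?S \<times> ?T|lborel. f z - g z)"
    unfolding mp_ext2_distr[OF s] set_lebesgue_integral_def ..
  finally show "\<bar>LINT z:S \<times> T|lborel. rearrange f \<sigma> z - rearrange g \<sigma> z\<bar> \<le> cut_dist f g"
    using cut_dist_upper[OF f g S' T'] by simp
qed

lemma cut_dist_rearrange:
  assumes f: "f \<in> graphons" and g: "g \<in> graphons" and s: "\<sigma> \<in> mp_bijections"
  shows "cut_dist (rearrange f \<sigma>) (rearrange g \<sigma>) = cut_dist f g"
  using cut_dist_rearrange_le[OF assms]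
    cut_dist_rearrange_le[OF rearrange_graphon[OF f s] rearrange_graphon[OF g s] mp_bijections_inv[OF s]]
    rearrange_inv[OF f s] rearrange_inv[OF g s] by simp

definition orbit_dist :: "(real \<times> real \<Rightarrow> real) \<Rightarrow> (real \<times> real \<Rightarrow> real) \<Rightarrow> real" where
  "orbit_dist f g = (INF \<sigma>\<in>mp_bijections. cut_dist f (rearrange g \<sigma>))"

lemma orbit_dist_lower:
  assumes "f \<in> graphons" "g \<in> graphons" "\<sigma> \<in> mp_bijections"
  shows "orbit_dist f g \<le> cut_dist f (rearrange g \<sigma>)"
  unfolding orbit_dist_def
  by (rule cINF_lower[OF _ assms(3)], rule bdd_belowI[where m = 0])
    (auto intro!: cut_dist_nonneg rearrange_graphon assms)

lemma orbit_dist_greatest: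
  assumes "\<And>\<sigma>. \<sigma> \<in> mp_bijections \<Longrightarrow> c \<le> cut_dist f (rearrange g \<sigma>)"
  shows "c \<le> orbit_dist f g"
  unfolding orbit_dist_def using mp_bijections_id assms by (intro cINF_greatest) auto

lemma orbit_dist_nonneg: "f \<in> graphons \<Longrightarrow> g \<in> graphons \<Longrightarrow> 0 \<le> orbit_dist f g"
  by (intro orbit_dist_greatest cut_dist_nonneg rearrange_graphon)

lemma orbit_dist_lessE:
  assumes "orbit_dist f g < c"
  obtains \<sigma> where "\<sigma> \<in> mp_bijections" "cut_dist f (rearrange g \<sigma>) < c"
  using orbit_dist_greatest[of c f g] assms by force

lemma rearrange_id: "g \<in> graphons \<Longrightarrow> rearrange g id = g"
  unfolding rearrange_def
  by (auto simp: graphons_def PiE_def extensional_def fun_eq_iff restrict_def)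

lemma orbit_dist_commute_le:
  assumes f: "f \<in> graphons" and g: "g \<in> graphons"
  shows "orbit_dist f g \<le> orbit_dist g f"
proof (rule orbit_dist_greatest)
  fix \<sigma> assume s: "\<sigma> \<in> mp_bijections"
  have "cut_dist g (rearrange f \<sigma>)
      = cut_dist (rearrange g (the_inv_into {0..1} \<sigma>)) (rearrange (rearrange f \<sigma>) (the_inv_into {0..1} \<sigma>))"
    by (rule cut_dist_rearrange[symmetric]) (intro g rearrange_graphon f s mp_bijections_inv)+
  also have "\<dots> = cut_dist f (rearrange g (the_inv_into {0..1} \<sigma>))"
    by (simp add: rearrange_inv[OF f s] cut_dist_commute)
  finally show "orbit_dist f g \<le> cut_dist g (rearrange f \<sigma>)"
    using orbit_dist_lower[OF f g mp_bijections_inv[OF s]] by simp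
qed

lemma orbit_dist_commute: "f \<in> graphons \<Longrightarrow> g \<in> graphons \<Longrightarrow> orbit_dist f g = orbit_dist g f"
  by (intro antisym orbit_dist_commute_le)

lemma orbit_dist_triangle:
  assumes f: "f \<in> graphons" and g: "g \<in> graphons" and h: "h \<in> graphons"
  shows "orbit_dist f h \<le> orbit_dist f g + orbit_dist g h"
proof (rule field_le_epsilon)
  fix e :: real assume e: "0 < e"
  obtain \<sigma> where s: "\<sigma> \<in> mp_bijections" "cut_dist f (rearrange g \<sigma>) < orbit_dist f g + e / 2"
    using e by (elim orbit_dist_lessE[rotated]) auto
  obtain \<rho> where r: "\<rho> \<in> mp_bijections" "cut_dist g (rearrange h \<rho>) < orbit_dist g h + e / 2"
    using e by (elim orbit_dist_lessE[rotated]) auto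
  have "orbit_dist f h \<le> cut_dist f (rearrange h (\<rho> \<circ> \<sigma>))"
    by (intro orbit_dist_lower f h mp_bijections_comp r s)
  also have "\<dots> \<le> cut_dist f (rearrange g \<sigma>) + cut_dist (rearrange g \<sigma>) (rearrange h (\<rho> \<circ> \<sigma>))"
    by (intro cut_dist_triangle rearrange_graphon f g h mp_bijections_comp r s)
  also have "cut_dist (rearrange g \<sigma>) (rearrange h (\<rho> \<circ> \<sigma>)) = cut_dist g (rearrange h \<rho>)"
    using cut_dist_rearrange[OF g rearrange_graphon[OF h r(1)] s(1)]
    by (simp add: rearrange_rearrange r s)
  finally show "orbit_dist f h \<le> orbit_dist f g + orbit_dist g h + e" using s r by simp
qed

lemma orbit_dist_self: "f \<in> graphons \<Longrightarrow> orbit_dist f f = 0"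
  using orbit_dist_lower[of f f id] mp_bijections_id orbit_dist_nonneg[of f f]
  by (auto simp: rearrange_id cut_dist_self)

lemma tau_iff:
  assumes g: "g \<in> graphons"
  shows "h \<in> \<tau> g \<longleftrightarrow> h \<in> graphons \<and> orbit_dist h g = 0"
proof (cases "h \<in> graphons")
  case True
  have "(\<forall>\<epsilon>>0. \<exists>\<sigma>\<in>mp_bijections. cut_dist h (rearrange g \<sigma>) < \<epsilon>) \<longleftrightarrow> orbit_dist h g = 0"
  proof
    assume *: "\<forall>\<epsilon>>0. \<exists>\<sigma>\<in>mp_bijections. cut_dist h (rearrange g \<sigma>) < \<epsilon>"
    have "orbit_dist h g \<le> 0 + e" if "0 < e" for e
      using * that orbit_dist_lower[OF True g] by (force intro: order.trans less_imp_le)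
    then have "orbit_dist h g \<le> 0" by (rule field_le_epsilon)
    then show "orbit_dist h g = 0" using orbit_dist_nonneg[OF True g] by simp
  qed (use orbit_dist_lessE in metis)
  then show ?thesis using True by (simp add: \<tau>_def cut_closure_def)
qed (simp add: \<tau>_def cut_closure_def)

lemma tau_eq_iff:
  assumes f: "f \<in> graphons" and g: "g \<in> graphons"
  shows "\<tau> f = \<tau> g \<longleftrightarrow> orbit_dist f g = 0"
proof
  assume "\<tau> f = \<tau> g"
  moreover have "f \<in> \<tau> f" using f by (simp add: tau_iff orbit_dist_self)
  ultimately show "orbit_dist f g = 0" using g by (simp add: tau_iff)
next
  assume z: "orbit_dist f g = 0"
  have "orbit_dist h f = 0 \<longleftrightarrow> orbit_dist h g = 0" if h: "h \<in> graphons" for h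
    using orbit_dist_triangle[OF h f g] orbit_dist_triangle[OF h g f] orbit_dist_commute[OF f g] z
      orbit_dist_nonneg[OF h f] orbit_dist_nonneg[OF h g] by auto
  then show "\<tau> f = \<tau> g" by (auto simp: tau_iff f g)
qed

lemma representative:
  assumes "A \<in> graphon_classes"
  shows "representative A \<in> graphons" "\<tau> (representative A) = A"
proof -
  have "\<exists>g. g \<in> graphons \<and> \<tau> g = A" using assms by (auto simp: graphon_classes_def)
  from someI_ex[OF this] show "representative A \<in> graphons" "\<tau> (representative A) = A"
    by (auto simp: representative_def)
qed

lemma delta_cut_eq:
  "A \<in> graphon_classes \<Longrightarrow> B \<in> graphon_classes \<Longrightarrow>
    delta_cut A B = orbit_dist (representative A) (representative B)"
  by (simp add: delta_cut_def orbit_dist_def)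

lemma delta_cut_tau:
  assumes f: "f \<in> graphons" and g: "g \<in> graphons"
  shows "delta_cut (\<tau> f) (\<tau> g) = (INF \<sigma>\<in>mp_bijections. cut_dist f (rearrange g \<sigma>))"
proof -
  have F: "\<tau> f \<in> graphon_classes" and G: "\<tau> g \<in> graphon_classes"
    using f g by (auto simp: graphon_classes_def)
  let ?f = "representative (\<tau> f)" and ?g = "representative (\<tau> g)"
  note rf = representative[OF F] and rg = representative[OF G]
  have "orbit_dist ?f f = 0" "orbit_dist ?g g = 0"
    using tau_eq_iff[OF rf(1) f] rf(2) tau_eq_iff[OF rg(1) g] rg(2) by auto
  then have "orbit_dist ?f ?g = orbit_dist f g"
    using orbit_dist_triangle[OF rf(1) f rg(1)] orbit_dist_triangle[OF f g rg(1)]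
      orbit_dist_triangle[OF f rf(1) g] orbit_dist_triangle[OF rf(1) rg(1) g]
      orbit_dist_commute[OF rf(1) f] orbit_dist_commute[OF rg(1) g] by simp
  then show ?thesis using F G by (simp add: delta_cut_eq orbit_dist_def)
qed

lemma Metric_space_delta_cut: "Metric_space graphon_classes delta_cut"
proof
  fix A B C
  show "0 \<le> delta_cut A B"
    by (cases "A \<in> graphon_classes \<and> B \<in> graphon_classes")
      (auto simp: delta_cut_eq orbit_dist_nonneg representative, auto simp: delta_cut_def)
  show "delta_cut A B = delta_cut B A"
    by (cases "A \<in> graphon_classes \<and> B \<in> graphon_classes")
      (auto simp: delta_cut_eq intro: orbit_dist_commute representative, auto simp: delta_cut_def)
  assume A: "A \<in> graphon_classes" and B: "B \<in> graphon_classes"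
  show "delta_cut A B = 0 \<longleftrightarrow> A = B"
    using tau_eq_iff[OF representative(1)[OF A] representative(1)[OF B]]
      representative(2)[OF A] representative(2)[OF B] by (simp add: delta_cut_eq A B)
  assume C: "C \<in> graphon_classes"
  show "delta_cut A C \<le> delta_cut A B + delta_cut B C"
    by (simp add: delta_cut_eq A B C orbit_dist_triangle representative)
qed

lemma graph_graphon_in_graphons: "graph_graphon n E \<in> graphons"
proof -
  let ?v = "\<lambda>x::real. nat \<lceil>real n * x\<rceil>"
  let ?F = "\<lambda>z. if {?v (fst z), ?v (snd z)} \<in> E then 1 else 0 :: real"
  have v: "?v \<in> measurable borel (count_space UNIV)" by measurable
  have "(\<lambda>z::real \<times> real. (?v (fst z), ?v (snd z)))
      \<in> measurable (borel \<Otimes>\<^sub>M borel) (count_space UNIV \<Otimes>\<^sub>M count_space UNIV)"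
    by (intro measurable_Pair measurable_compose[OF measurable_fst v] measurable_compose[OF measurable_snd v])
  then have "(\<lambda>z::real \<times> real. (?v (fst z), ?v (snd z))) \<in> measurable borel (count_space UNIV)"
    by (simp add: borel_prod pair_measure_countable)
  then have "(\<lambda>z. (\<lambda>(a, b). if {a, b} \<in> E then 1 else 0 :: real) (?v (fst z), ?v (snd z)))
      \<in> borel_measurable borel"
    by (rule measurable_compose) simp
  then have "?F \<in> borel_measurable borel" by simp
  then have "?F \<in> borel_measurable (restrict_space borel unit_square)"
    by (rule measurable_restrict_space1)
  moreover have "graph_graphon n E \<in> borel_measurable (restrict_space borel unit_square) \<longleftrightarrow>
      ?F \<in> borel_measurable (restrict_space borel unit_square)"
    by (rule measurable_cong) (auto simp: graph_graphon_def space_restrict_space)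
  ultimately show ?thesis
    by (auto simp: graphons_def graph_graphon_def insert_commute)
qed

lemma set_graphon_law: "set_pmf (graphon_law n p) \<subseteq> graphon_classes"
  by (auto simp: graphon_law_def graphon_classes_def graph_graphon_in_graphons)

end

theory Submission
  imports Defs "HOL-Real_Asymp.Real_Asymp"
begin

text \<open>
  Write \<open>L(u, x) = x ln (u/p) + (1 - x) ln ((1 - u)/(1 - p))\<close>, so that \<open>2 I\<^sub>p(u) = L(u, u)\<close> and
  \<open>exp L(u, X)\<close> has mean 1 for a Bernoulli variable \<open>X\<close> with mean \<open>p\<close>.

  Upper bound: for a graphon \<open>h\<close> choose a step graphon \<open>g\<close>, bounded away from 0 and 1, with
  \<open>\<integral> L(g, h)\<close> close to \<open>2 I\<^sub>p(h)\<close>. If \<open>f\<^sup>G\<close> rearranged by some \<open>\<sigma>\<close> is close to \<open>h\<close> in the cut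
  distance, then \<open>\<integral> L(g, f\<^sup>G \<circ> \<sigma>)\<close> is nearly as large. Up to the diagonal, this integral is affine
  in the way each vertex is spread over the steps of \<open>g\<close>, so it is at most its value for some assignment of
  vertices to steps. There are only \<open>exp (O(n))\<close> assignments, and Markov's inequality bounds the
  probability for each of them. This gives the bound for small balls, and compactness of the space of graphon classes
  transfers it to closed sets. Compactness follows from completeness of the cut distance, by a Radon-Nikodym
  argument, and total boundedness, by weak regularity for step graphons.

  Lower bound: tilt the edge probabilities to a step graphon near \<open>h\<close>. Under the tilted law the
  graph is close to \<open>h\<close> by Hoeffding's inequality and a union bound over rectangles, and the
  log-likelihood ratio concentrates around at most \<open>n\<^sup>2 I\<^sub>p(h)\<close> up to a small error.
\<close>

section \<open>Step graphons\<close>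

text \<open>The rate function is not continuous in the cut distance: graph graphons, with values 0
  and 1, can approach a constant one, whose rate differs. What the cut distance controls is an
  integral of f against a fixed step function. Since L(u, x) is affine in x, the integral of L(g, f)
  is of this kind when g is a step graphon. Its slope ln (u/p) - ln ((1 - u)/(1 - p)) blows up at u
  = 0 and u = 1, which is why g has to stay in [\<theta>, 1 - \<theta>]. The second obstacle is that
  a ball of classes allows a continuum of rearrangements. A vertex is an interval of length 1/n that
  \<sigma> can spread over many steps of g, so \<sigma> need not come from a relabelling of
  vertices. Only the table of shares of each vertex in each step matters, and rounding this table
  leaves finitely many cases. All side costs, namely assignments, pairs of vertex sets and the
  diagonal, have exponents of order n and vanish on the scale n^2. The factor 1/2 in
  \<open>rate_density\<close> reflects that each edge occupies two cells of the square.\<close>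

abbreviation usq :: "(real \<times> real) measure" where
  "usq \<equiv> restrict_space lborel unit_square"

lemma unit_square_sets: "unit_square \<in> sets (borel :: (real \<times> real) measure)"
  by (intro borel_closed closed_Times) auto

lemma space_usq: "space usq = unit_square"
  by (simp add: space_restrict_space)

lemma emeasure_Times_lborel:
  assumes "A \<in> sets borel" "B \<in> sets borel"
  shows "emeasure lborel (A \<times> B :: (real \<times> real) set) = emeasure lborel A * emeasure lborel B"
  using assms by (simp add: lborel_prod[symmetric] lborel.emeasure_pair_measure_Times)

lemma prob_space_usq: "prob_space usq"
proof
  show "emeasure usq (space usq) = 1"
    by (simp add: emeasure_restrict_space unit_square_sets space_usq emeasure_Times_lborel)
qed

interpretation usq: prob_space usq by (rule prob_space_usq)

lemma graphon_measurable_usq: "f \<in> graphons \<Longrightarrow> f \<in> borel_measurable usq"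
  using measurable_cong_sets[OF sets_restrict_space_cong[OF sets_lborel] refl]
  by (auto simp: graphons_def)

lemma graphon_bounds:
  assumes "f \<in> graphons" "z \<in> unit_square"
  shows "0 \<le> f z" "f z \<le> 1"
proof -
  have "f \<in> unit_square \<rightarrow> {0..1}" using assms(1) by (auto simp: graphons_def PiE_def)
  then have "f z \<in> {0..1}" using assms(2) by (rule Pi_mem)
  then show "0 \<le> f z" "f z \<le> 1" by auto
qed

lemma usq_integrableI:
  fixes f :: "real \<times> real \<Rightarrow> real"
  assumes "f \<in> borel_measurable usq" "\<And>z. z \<in> unit_square \<Longrightarrow> \<bar>f z\<bar> \<le> B"
  shows "integrable usq f"
  by (rule usq.integrable_const_bound[where B = B]) (use assms in \<open>auto simp: AE_I2 space_usq\<close>)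

lemma Times_sets_uim:
  assumes "S \<in> sets unit_interval_measure" "T \<in> sets unit_interval_measure"
  shows "S \<times> T \<in> sets borel" "S \<times> T \<subseteq> unit_square"
  using assms by (auto simp: sets_unit_interval_measure borel_Times)

lemma set_integral_usq:
  fixes f :: "real \<times> real \<Rightarrow> real"
  assumes "A \<in> sets borel" "A \<subseteq> unit_square"
  shows "(LINT z:A|lborel. f z) = (LINT z|usq. indicator A z * f z)"
  unfolding set_lebesgue_integral_def
  by (subst integral_restrict_space)
    (use assms in \<open>auto simp: unit_square_sets indicator_def intro!: Bochner_Integration.integral_cong\<close>)

section \<open>The L1 distance, which dominates the cut distance\<close>

definition l1_dist :: "(real \<times> real \<Rightarrow> real) \<Rightarrow> (real \<times> real \<Rightarrow> real) \<Rightarrow> real" where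
  "l1_dist f g = (LINT z|usq. \<bar>f z - g z\<bar>)"

lemma l1_dist_commute: "l1_dist f g = l1_dist g f"
  by (simp add: l1_dist_def abs_minus_commute)

lemma integrable_graphon: "f \<in> graphons \<Longrightarrow> integrable usq f"
proof (rule usq_integrableI[where B = 1])
  fix z :: "real \<times> real" assume "f \<in> graphons" "z \<in> unit_square"
  from graphon_bounds[OF this] show "\<bar>f z\<bar> \<le> 1" by simp
qed (rule graphon_measurable_usq)

lemma cut_dist_le_l1_dist:
  assumes f: "f \<in> graphons" and g: "g \<in> graphons"
  shows "cut_dist f g \<le> l1_dist f g"
proof (rule cut_dist_least)
  fix S T assume ST: "S \<in> sets unit_interval_measure" "T \<in> sets unit_interval_measure"
  note B = Times_sets_uim[OF ST]
  have [measurable]: "S \<times> T \<in> sets borel" by (rule B)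
  have [measurable]: "f \<in> borel_measurable usq" "g \<in> borel_measurable usq"
    using f g by (auto intro: graphon_measurable_usq)
  have ind: "(indicator (S \<times> T) :: _ \<Rightarrow> real) \<in> borel_measurable usq"
    by (intro measurable_restrict_space1) auto
  have "\<bar>LINT z:S \<times> T|lborel. f z - g z\<bar> = \<bar>LINT z|usq. indicator (S \<times> T) z * (f z - g z)\<bar>"
    by (simp add: set_integral_usq B)
  also have "\<dots> \<le> (LINT z|usq. \<bar>indicator (S \<times> T) z * (f z - g z)\<bar>)" by (rule integral_abs_bound)
  also have "\<dots> \<le> (LINT z|usq. \<bar>f z - g z\<bar>)"
  proof (rule integral_mono)
    show "integrable usq (\<lambda>z. \<bar>f z - g z\<bar>)"
      using integrable_graphon[OF f] integrable_graphon[OF g] by auto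
    then show "integrable usq (\<lambda>z. \<bar>indicator (S \<times> T) z * (f z - g z)\<bar>)"
      by (rule Bochner_Integration.integrable_bound)
        (auto simp: indicator_def intro!: borel_measurable_abs borel_measurable_times ind[unfolded indicator_def])
  qed (auto simp: indicator_def)
  finally show "\<bar>LINT z:S \<times> T|lborel. f z - g z\<bar> \<le> l1_dist f g" by (simp add: l1_dist_def)
qed

text \<open>Cells are numbered from 1. Only the point 0 lies in cell 0.\<close>

definition cell :: "nat \<Rightarrow> real \<Rightarrow> nat" where
  "cell n x = nat \<lceil>real n * x\<rceil>"

definition step_graphon :: "nat \<Rightarrow> (nat \<Rightarrow> nat \<Rightarrow> real) \<Rightarrow> real \<times> real \<Rightarrow> real" where
  "step_graphon n v = restrict (\<lambda>(x, y). v (cell n x) (cell n y)) unit_square"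

text \<open>Index 0 is included because points with a coordinate 0 lie in cell 0. They form a null
  set, but a graphon must be symmetric with values in [0, 1] there as well.\<close>

definition sym01 :: "nat \<Rightarrow> (nat \<Rightarrow> nat \<Rightarrow> real) \<Rightarrow> bool" where
  "sym01 n v \<longleftrightarrow> (\<forall>i\<le>n. \<forall>j\<le>n. 0 \<le> v i j \<and> v i j \<le> 1 \<and> v i j = v j i)"

lemma sym01D:
  assumes "sym01 n v" "i \<le> n" "j \<le> n"
  shows "0 \<le> v i j" "v i j \<le> 1" "v i j = v j i"
  using assms by (auto simp: sym01_def)

lemma cell_measurable: "cell n \<in> measurable borel (count_space UNIV)"
  unfolding cell_def by measurable

lemma cell_le: "x \<in> {0..1} \<Longrightarrow> cell n x \<le> n"
  by (auto simp: cell_def nat_le_iff ceiling_le_iff mult_left_le)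

lemma cell_eq_iff:
  assumes "0 < n" "i \<noteq> 0"
  shows "cell n x = i \<longleftrightarrow> x \<in> {(real i - 1) / real n <.. real i / real n}"
proof -
  have "cell n x = i \<longleftrightarrow> \<lceil>real n * x\<rceil> = int i"
    using assms by (auto simp: cell_def)
  also have "\<dots> \<longleftrightarrow> real i - 1 < real n * x \<and> real n * x \<le> real i"
    by (simp add: ceiling_eq_iff)
  also have "\<dots> \<longleftrightarrow> x \<in> {(real i - 1) / real n <.. real i / real n}"
    using assms by (simp add: field_simps)
  finally show ?thesis .
qed

lemma cell_0_iff: "0 < n \<Longrightarrow> x \<in> {0..1} \<Longrightarrow> cell n x = 0 \<longleftrightarrow> x = 0"
  by (auto simp: cell_def mult_le_0_iff)

definition cell_set :: "nat \<Rightarrow> nat \<Rightarrow> real set" where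
  "cell_set n i = {x \<in> {0..1}. cell n x = i}"

lemma cell_set_sets: "cell_set n i \<in> sets unit_interval_measure"
proof -
  have "cell n -` {i} \<inter> space borel \<in> sets borel"
    using cell_measurable by (rule measurable_sets) simp
  then have "{0..1} \<inter> (cell n -` {i}) \<in> sets borel" by auto
  moreover have "{0..1} \<inter> (cell n -` {i}) = cell_set n i" by (auto simp: cell_set_def)
  ultimately show ?thesis by (auto simp: sets_unit_interval_measure)
qed

lemma cell_set_eq:
  assumes "i \<in> {1..n}"
  shows "cell_set n i = {(real i - 1) / real n <.. real i / real n}"
proof -
  have "real i / real n \<le> 1" "0 \<le> (real i - 1) / real n" using assms by auto
  then have "{(real i - 1) / real n <.. real i / real n} \<subseteq> {0..1}"
    by (intro subsetI) (simp only: greaterThanAtMost_iff atLeastAtMost_iff, linarith)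
  moreover have "cell n x = i \<longleftrightarrow> x \<in> {(real i - 1) / real n <.. real i / real n}" for x
    using assms by (intro cell_eq_iff) auto
  ultimately show ?thesis unfolding cell_set_def by blast
qed

lemma measure_cell_set: "i \<in> {1..n} \<Longrightarrow> measure lborel (cell_set n i) = 1 / real n"
  by (subst cell_set_eq) (auto simp: field_simps)

lemma measure_cell_set_0: "0 < n \<Longrightarrow> measure lborel (cell_set n 0) = 0"
proof -
  assume n: "0 < n"
  have "cell_set n 0 = {0}" using cell_0_iff[OF n] by (auto simp: cell_set_def)
  then show ?thesis by simp
qed

text \<open>Label maps are kept abstract because the lemma serves twice: with the cell of a point as
  label, and with the pair of the cell of x and the cell of its image under a bijection.\<close>

lemma integral_cells:
  fixes w :: "'a \<Rightarrow> 'b \<Rightarrow> real" and f :: "real \<times> real \<Rightarrow> real"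
  assumes A: "finite A" and B: "finite B"
    and \<alpha>: "\<And>x. x \<in> S \<Longrightarrow> \<alpha> x \<in> A" "\<And>a. a \<in> A \<Longrightarrow> {x \<in> S. \<alpha> x = a} \<in> sets borel"
    and \<beta>: "\<And>x. x \<in> T \<Longrightarrow> \<beta> x \<in> B" "\<And>b. b \<in> B \<Longrightarrow> {x \<in> T. \<beta> x = b} \<in> sets borel"
    and sub: "S \<subseteq> {0..1}" "T \<subseteq> {0..1}"
    and f: "\<And>x y. x \<in> S \<Longrightarrow> y \<in> T \<Longrightarrow> f (x, y) = w (\<alpha> x) (\<beta> y)"
  shows "set_integrable lborel (S \<times> T) f"
    and "(LINT z:S \<times> T|lborel. f z)
      = (\<Sum>a\<in>A. \<Sum>b\<in>B. w a b * (measure lborel {x \<in> S. \<alpha> x = a} * measure lborel {y \<in> T. \<beta> y = b}))"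
proof -
  let ?S = "\<lambda>a. {x \<in> S. \<alpha> x = a}" and ?T = "\<lambda>b. {x \<in> T. \<beta> x = b}"
  have finS: "emeasure lborel C \<noteq> \<infinity>" if "C \<subseteq> {0..1::real}" for C
    using emeasure_mono[OF that, of lborel] by (auto simp: top_unique)
  have emS: "emeasure lborel (?S a) = ennreal (measure lborel (?S a))"
     "emeasure lborel (?T b) = ennreal (measure lborel (?T b))" for a b
    by (rule emeasure_eq_ennreal_measure[OF finS[unfolded infinity_ennreal_def]]; use sub in auto)+
  have em: "emeasure lborel (?S a \<times> ?T b) = ennreal (measure lborel (?S a) * measure lborel (?T b))"
    if "a \<in> A" "b \<in> B" for a b
    using \<alpha>(2)[OF that(1)] \<beta>(2)[OF that(2)]
    by (subst emeasure_Times_lborel) (auto simp: emS ennreal_mult)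
  have eq: "indicator (S \<times> T) z *\<^sub>R f z = (\<Sum>a\<in>A. \<Sum>b\<in>B. w a b * indicator (?S a \<times> ?T b) z)" for z
  proof (cases "z \<in> S \<times> T")
    case True
    then obtain x y where z: "z = (x, y)" "x \<in> S" "y \<in> T" by auto
    have "(\<Sum>a\<in>A. \<Sum>b\<in>B. w a b * indicator (?S a \<times> ?T b) z)
        = (\<Sum>a\<in>A. \<Sum>b\<in>B. if \<alpha> x = a then if \<beta> y = b then w a b else 0 else 0)"
      using z by (intro sum.cong) (auto simp: indicator_def)
    also have "\<dots> = (\<Sum>a\<in>A. if \<alpha> x = a then (\<Sum>b\<in>B. if \<beta> y = b then w a b else 0) else 0)"
      by (rule sum.cong) auto
    also have "\<dots> = w (\<alpha> x) (\<beta> y)"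
      using \<alpha>(1)[OF z(2)] \<beta>(1)[OF z(3)] A B by simp
    finally show ?thesis using z f by simp
  next
    case False
    then have "z \<notin> ?S a \<times> ?T b" for a b by auto
    then show ?thesis using False by simp
  qed
  have hi: "has_bochner_integral lborel (\<lambda>z. w a b * indicator (?S a \<times> ?T b) z)
      (w a b * (measure lborel (?S a) * measure lborel (?T b)))" if "a \<in> A" "b \<in> B" for a b
  proof (rule has_bochner_integral_mult_right)
    show "has_bochner_integral lborel (indicator (?S a \<times> ?T b)) (measure lborel (?S a) * measure lborel (?T b))"
      if "w a b \<noteq> 0"
    proof -
      have "has_bochner_integral lborel (indicator (?S a \<times> ?T b)) (measure lborel (?S a \<times> ?T b))"
        by (rule has_bochner_integral_real_indicator)
          (use \<alpha>(2)[OF \<open>a \<in> A\<close>] \<beta>(2)[OF \<open>b \<in> B\<close>] em[OF \<open>a \<in> A\<close> \<open>b \<in> B\<close>] in \<open>auto simp: borel_Times\<close>)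
      moreover have "measure lborel (?S a \<times> ?T b) = measure lborel (?S a) * measure lborel (?T b)"
        using em[OF \<open>a \<in> A\<close> \<open>b \<in> B\<close>] by (simp add: measure_def)
      ultimately show ?thesis by simp
    qed
  qed
  have "has_bochner_integral lborel (\<lambda>z. indicator (S \<times> T) z *\<^sub>R f z)
     (\<Sum>a\<in>A. \<Sum>b\<in>B. w a b * (measure lborel (?S a) * measure lborel (?T b)))"
    unfolding eq by (intro has_bochner_integral_sum hi)
  then show "set_integrable lborel (S \<times> T) f"
    "(LINT z:S \<times> T|lborel. f z) = (\<Sum>a\<in>A. \<Sum>b\<in>B. w a b * (measure lborel (?S a) * measure lborel (?T b)))"
    by (auto simp: set_integrable_def set_lebesgue_integral_def has_bochner_integral_iff)
qed

lemma step_graphon_apply: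
  "x \<in> {0..1} \<Longrightarrow> y \<in> {0..1} \<Longrightarrow> step_graphon n v (x, y) = v (cell n x) (cell n y)"
  by (simp add: step_graphon_def)

lemma step_measurable_borel:
  fixes v :: "nat \<Rightarrow> nat \<Rightarrow> real"
  shows "(\<lambda>z. v (cell n (fst z)) (cell n (snd z))) \<in> borel_measurable (borel :: (real \<times> real) measure)"
proof -
  have "(\<lambda>z::real \<times> real. (cell n (fst z), cell n (snd z)))
      \<in> measurable (borel \<Otimes>\<^sub>M borel) (count_space UNIV \<Otimes>\<^sub>M count_space UNIV)"
    by (intro measurable_Pair measurable_compose[OF measurable_fst cell_measurable]
        measurable_compose[OF measurable_snd cell_measurable])
  then have "(\<lambda>z::real \<times> real. (cell n (fst z), cell n (snd z))) \<in> measurable borel (count_space UNIV)"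
    by (simp add: borel_prod pair_measure_countable)
  then have "(\<lambda>z. (\<lambda>(a, b). v a b) (cell n (fst z), cell n (snd z))) \<in> borel_measurable borel"
    by (rule measurable_compose) simp
  then show ?thesis by simp
qed

lemma step_graphon_in_graphons:
  assumes "sym01 n v"
  shows "step_graphon n v \<in> graphons"
proof -
  have "(\<lambda>z. v (cell n (fst z)) (cell n (snd z))) \<in> borel_measurable (restrict_space borel unit_square)"
    by (rule measurable_restrict_space1[OF step_measurable_borel])
  moreover have "step_graphon n v \<in> borel_measurable (restrict_space borel unit_square) \<longleftrightarrow>
      (\<lambda>z. v (cell n (fst z)) (cell n (snd z))) \<in> borel_measurable (restrict_space borel unit_square)"
    by (rule measurable_cong) (auto simp: step_graphon_def space_restrict_space)
  moreover have "step_graphon n v \<in> unit_square \<rightarrow>\<^sub>E {0..1}"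
    unfolding step_graphon_def
    by (rule PiE_I) (use sym01D[OF assms] cell_le in \<open>auto simp: restrict_def\<close>)
  moreover have "step_graphon n v (x, y) = step_graphon n v (y, x)" if "x \<in> {0..1}" "y \<in> {0..1}" for x y
    using sym01D(3)[OF assms cell_le cell_le] that by (simp add: step_graphon_apply)
  ultimately show ?thesis by (auto simp: graphons_def)
qed

lemma graph_graphon_eq_step: "graph_graphon n E = step_graphon n (\<lambda>i j. of_bool ({i, j} \<in> E))"
  by (auto simp: graph_graphon_def step_graphon_def cell_def fun_eq_iff restrict_def)

lemma sum_drop_0: "(g (0 :: nat) :: real) = 0 \<Longrightarrow> (\<Sum>a\<in>{..n}. g a) = (\<Sum>a\<in>{1..n}. g a)"
  by (simp add: sum.atLeast_Suc_atMost[of 0 n g] flip: atLeast0AtMost)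

lemma measure_uim_le:
  assumes "S \<in> sets unit_interval_measure" "A \<in> sets borel" "S \<subseteq> A" "emeasure lborel A < \<infinity>"
  shows "measure lborel S \<le> measure lborel A"
  using assms by (intro measure_mono_fmeasurable) (auto simp: sets_unit_interval_measure fmeasurable_def)

lemma Collect_cell_sets:
  "S \<in> sets unit_interval_measure \<Longrightarrow> {x \<in> S. cell n x = i} \<in> sets unit_interval_measure"
proof -
  assume S: "S \<in> sets unit_interval_measure"
  have "{x \<in> S. cell n x = i} = S \<inter> cell_set n i"
    using S by (auto simp: cell_set_def sets_unit_interval_measure)
  then show ?thesis using S cell_set_sets by auto
qed

lemma measure_Collect_cell:
  assumes S: "S \<in> sets unit_interval_measure" and n: "0 < n"
  shows "measure lborel {x \<in> S. cell n x = 0} = 0"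
    and "i \<in> {1..n} \<Longrightarrow> real n * measure lborel {x \<in> S. cell n x = i} \<le> 1"
proof -
  have sub: "{x \<in> S. cell n x = i} \<subseteq> cell_set n i" for i
    using S by (auto simp: cell_set_def sets_unit_interval_measure)
  have fin: "emeasure lborel (cell_set n i) < \<infinity>" for i
    by (rule order.strict_trans1[OF emeasure_mono[of "cell_set n i" "{0..1}" lborel]]) (auto simp: cell_set_def)
  have le: "measure lborel {x \<in> S. cell n x = i} \<le> measure lborel (cell_set n i)" for i
    using cell_set_sets[of n i] by (intro measure_uim_le sub fin Collect_cell_sets S) (auto simp: sets_unit_interval_measure)
  show "measure lborel {x \<in> S. cell n x = 0} = 0"
    using le[of 0] measure_cell_set_0[OF n] measure_nonneg[of lborel "{x \<in> S. cell n x = 0}"] by linarith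
  show "real n * measure lborel {x \<in> S. cell n x = i} \<le> 1" if "i \<in> {1..n}"
    using le[of i] measure_cell_set[OF that] n by (simp add: field_simps)
qed

lemma step_integral_Times:
  assumes S: "S \<in> sets unit_interval_measure" and T: "T \<in> sets unit_interval_measure" and n: "0 < n"
    and f: "\<And>x y. x \<in> {0..1} \<Longrightarrow> y \<in> {0..1} \<Longrightarrow> f (x, y) = w (cell n x) (cell n y)"
  shows "(LINT z:S \<times> T|lborel. f z) = (\<Sum>i=1..n. \<Sum>j=1..n. w i j *
    (measure lborel {x \<in> S. cell n x = i} * measure lborel {y \<in> T. cell n y = j}))"
proof -
  have sub: "S \<subseteq> {0..1}" "T \<subseteq> {0..1}" using S T by (auto simp: sets_unit_interval_measure)
  have "(LINT z:S \<times> T|lborel. f z) = (\<Sum>i\<in>{..n}. \<Sum>j\<in>{..n}. w i j *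
    (measure lborel {x \<in> S. cell n x = i} * measure lborel {y \<in> T. cell n y = j}))"
    using Collect_cell_sets[OF S] Collect_cell_sets[OF T] sub cell_le
    by (intro integral_cells(2)) (auto simp: sets_unit_interval_measure intro!: f)
  then show ?thesis
    using measure_Collect_cell(1)[OF S n] measure_Collect_cell(1)[OF T n] by (simp add: sum_drop_0)
qed

lemma step_integral:
  assumes n: "0 < n"
    and f: "\<And>x y. x \<in> {0..1} \<Longrightarrow> y \<in> {0..1} \<Longrightarrow> f (x, y) = w (cell n x) (cell n y)"
  shows "(LINT z|usq. f z) = (\<Sum>i=1..n. \<Sum>j=1..n. w i j) / (real n)\<^sup>2"
proof -
  have "(LINT z|usq. f z) = (LINT z:{0..1} \<times> {0..1}|lborel. f z)"
    by (simp add: set_lebesgue_integral_def integral_restrict_space unit_square_sets)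
  also have "\<dots> = (\<Sum>i=1..n. \<Sum>j=1..n. w i j *
    (measure lborel {x \<in> {0..1}. cell n x = i} * measure lborel {y \<in> {0..1}. cell n y = j}))"
    by (rule step_integral_Times[OF _ _ n, where w = w]) (auto simp: sets_unit_interval_measure intro!: f)
  also have "\<dots> = (\<Sum>i=1..n. \<Sum>j=1..n. w i j * (1 / real n * (1 / real n)))"
    using measure_cell_set by (intro sum.cong refl) (simp add: cell_set_def)
  also have "\<dots> = (\<Sum>i=1..n. \<Sum>j=1..n. w i j) / (real n)\<^sup>2"
    by (simp add: sum_divide_distrib power2_eq_square)
  finally show ?thesis .
qed

section \<open>Rounding of bilinear forms and the cut distance between step graphons\<close>

lemma linear_le_subset_sum:
  fixes s c :: "nat \<Rightarrow> real"
  assumes "finite I" "\<And>i. i \<in> I \<Longrightarrow> 0 \<le> s i \<and> s i \<le> 1"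
  obtains A where "A \<subseteq> I" "(\<Sum>i\<in>I. s i * c i) \<le> (\<Sum>i\<in>A. c i)"
proof
  \<comment> \<open>A linear form on a cube is largest at the vertex that keeps exactly the positive
    coefficients.\<close>
  show "{i \<in> I. 0 < c i} \<subseteq> I" by auto
  have "(\<Sum>i\<in>I. s i * c i) \<le> (\<Sum>i\<in>I. if 0 < c i then c i else 0)"
  proof (rule sum_mono)
    fix i assume "i \<in> I"
    with assms(2) show "s i * c i \<le> (if 0 < c i then c i else 0)"
      by (auto simp: mult_left_le_one_le mult_nonneg_nonpos)
  qed
  also have "\<dots> = (\<Sum>i\<in>{i \<in> I. 0 < c i}. c i)" using assms(1) by (simp add: sum.If_cases Int_def)
  finally show "(\<Sum>i\<in>I. s i * c i) \<le> (\<Sum>i\<in>{i \<in> I. 0 < c i}. c i)" .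
qed

text \<open>With t fixed the form is linear in s, so s may be replaced by the indicator of a set;
  the same then applies to t.\<close>

lemma bilinear_le_subset_sum:
  fixes w :: "nat \<Rightarrow> nat \<Rightarrow> real" and s t :: "nat \<Rightarrow> real"
  assumes I: "finite I" and s: "\<And>i. i \<in> I \<Longrightarrow> 0 \<le> s i \<and> s i \<le> 1" and t: "\<And>i. i \<in> I \<Longrightarrow> 0 \<le> t i \<and> t i \<le> 1"
    and C: "\<And>A B. A \<subseteq> I \<Longrightarrow> B \<subseteq> I \<Longrightarrow> (\<Sum>i\<in>A. \<Sum>j\<in>B. w i j) \<le> C"
  shows "(\<Sum>i\<in>I. \<Sum>j\<in>I. w i j * (s i * t j)) \<le> C"
proof -
  obtain A where A: "A \<subseteq> I" "(\<Sum>i\<in>I. s i * (\<Sum>j\<in>I. t j * w i j)) \<le> (\<Sum>i\<in>A. \<Sum>j\<in>I. t j * w i j)"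
    by (rule linear_le_subset_sum[OF I s, where c = "\<lambda>i. \<Sum>j\<in>I. t j * w i j"])
  obtain B where B: "B \<subseteq> I" "(\<Sum>j\<in>I. t j * (\<Sum>i\<in>A. w i j)) \<le> (\<Sum>j\<in>B. \<Sum>i\<in>A. w i j)"
    by (rule linear_le_subset_sum[OF I t, where c = "\<lambda>j. \<Sum>i\<in>A. w i j"])
  have "(\<Sum>i\<in>I. \<Sum>j\<in>I. w i j * (s i * t j)) = (\<Sum>i\<in>I. s i * (\<Sum>j\<in>I. t j * w i j))"
    by (simp add: sum_distrib_left mult_ac)
  also note A(2)
  also have "(\<Sum>i\<in>A. \<Sum>j\<in>I. t j * w i j) = (\<Sum>j\<in>I. t j * (\<Sum>i\<in>A. w i j))"
    by (subst sum.swap) (simp add: sum_distrib_left)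
  also note B(2)
  also have "(\<Sum>j\<in>B. \<Sum>i\<in>A. w i j) = (\<Sum>i\<in>A. \<Sum>j\<in>B. w i j)" by (rule sum.swap)
  also have "\<dots> \<le> C" using A B by (intro C) auto
  finally show ?thesis .
qed

text \<open>Sets S and T enter only through their shares of each cell, which lie in [0, 1]. Rounding
  these shares reduces all measurable rectangles to unions of cells, that is to 4^n pairs of index
  sets, few enough for a union bound. Both signs are treated to obtain the absolute value.\<close>

lemma cut_dist_step_le:
  assumes n: "0 < n"
    and C: "\<And>A B. A \<subseteq> {1..n} \<Longrightarrow> B \<subseteq> {1..n} \<Longrightarrow> \<bar>\<Sum>i\<in>A. \<Sum>j\<in>B. u i j - v i j\<bar> \<le> C * (real n)\<^sup>2"
  shows "cut_dist (step_graphon n u) (step_graphon n v) \<le> C"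
proof (rule cut_dist_least)
  fix S T assume ST: "S \<in> sets unit_interval_measure" "T \<in> sets unit_interval_measure"
  let ?s = "\<lambda>i. real n * measure lborel {x \<in> S. cell n x = i}"
  let ?t = "\<lambda>i. real n * measure lborel {x \<in> T. cell n x = i}"
  have "(LINT z:S \<times> T|lborel. step_graphon n u z - step_graphon n v z)
    = (\<Sum>i=1..n. \<Sum>j=1..n. (u i j - v i j) *
        (measure lborel {x \<in> S. cell n x = i} * measure lborel {y \<in> T. cell n y = j}))"
    by (rule step_integral_Times[OF ST n]) (simp add: step_graphon_apply)
  then have eq: "(real n)\<^sup>2 * (LINT z:S \<times> T|lborel. step_graphon n u z - step_graphon n v z)
    = (\<Sum>i=1..n. \<Sum>j=1..n. (u i j - v i j) * (?s i * ?t j))"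
    by (simp add: sum_distrib_left power2_eq_square mult_ac)
  have "(\<Sum>i=1..n. \<Sum>j=1..n. (u i j - v i j) * (?s i * ?t j)) \<le> C * (real n)\<^sup>2"
    by (rule bilinear_le_subset_sum)
      (use C measure_Collect_cell(2)[OF ST(1) n] measure_Collect_cell(2)[OF ST(2) n] in \<open>auto simp: abs_le_iff\<close>)
  moreover have "(\<Sum>i=1..n. \<Sum>j=1..n. (- (u i j - v i j)) * (?s i * ?t j)) \<le> C * (real n)\<^sup>2"
  proof (rule bilinear_le_subset_sum)
    fix A B assume "A \<subseteq> {1..n}" "B \<subseteq> {1..n}"
    from C[OF this] show "(\<Sum>i\<in>A. \<Sum>j\<in>B. - (u i j - v i j)) \<le> C * (real n)\<^sup>2"
      unfolding sum_negf by linarith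
  qed (use measure_Collect_cell(2)[OF ST(1) n] measure_Collect_cell(2)[OF ST(2) n] in auto)
  ultimately have "\<bar>(real n)\<^sup>2 * (LINT z:S \<times> T|lborel. step_graphon n u z - step_graphon n v z)\<bar> \<le> C * (real n)\<^sup>2"
    unfolding eq mult_minus_left sum_negf by linarith
  then have "(real n)\<^sup>2 * \<bar>LINT z:S \<times> T|lborel. step_graphon n u z - step_graphon n v z\<bar> \<le> (real n)\<^sup>2 * C"
    by (simp add: abs_mult mult.commute)
  then show "\<bar>LINT z:S \<times> T|lborel. step_graphon n u z - step_graphon n v z\<bar> \<le> C"
    using n by simp
qed

section \<open>Approximation in \<open>L\<^sup>1\<close>\<close>

lemma integral_usq_swap:
  fixes f :: "real \<times> real \<Rightarrow> real"
  assumes f: "f \<in> borel_measurable usq"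
  shows "(LINT z|usq. f (snd z, fst z)) = (LINT z|usq. f z)"
proof -
  let ?F = "\<lambda>z. indicator unit_square z *\<^sub>R f z"
  have F: "?F \<in> borel_measurable (lborel \<Otimes>\<^sub>M lborel)"
    using f by (subst (asm) borel_measurable_restrict_space_iff) (auto simp: unit_square_sets lborel_prod)
  have "(LINT z|usq. f (snd z, fst z)) = (LINT z|lborel. (case z of (x, y) \<Rightarrow> ?F (y, x)))"
    by (subst integral_restrict_space)
      (auto simp: unit_square_sets indicator_def intro!: Bochner_Integration.integral_cong)
  also have "\<dots> = (LINT z|lborel. ?F z)"
    using lborel_pair.integral_product_swap[OF F] by (simp add: lborel_prod)
  also have "\<dots> = (LINT z|usq. f z)"
    by (subst integral_restrict_space) (auto simp: unit_square_sets)
  finally show ?thesis .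
qed

text \<open>A measurable function is an almost everywhere limit of continuous ones. Truncating these
  to [0, 1] keeps the limit, since f has values there, and provides the constant bound for dominated
  convergence.\<close>

lemma continuous_approx_usq:
  fixes f :: "real \<times> real \<Rightarrow> real"
  assumes f: "f \<in> borel_measurable usq" and b: "\<And>z. z \<in> unit_square \<Longrightarrow> 0 \<le> f z \<and> f z \<le> 1" and \<delta>: "0 < \<delta>"
  obtains c where "continuous_on UNIV c" "\<And>z. 0 \<le> c z" "\<And>z. c z \<le> (1::real)" "(LINT z|usq. \<bar>f z - c z\<bar>) < \<delta>"
proof -
  let ?F = "\<lambda>z. indicator unit_square z *\<^sub>R f z"
  have F: "?F \<in> borel_measurable lborel"
    using f by (subst (asm) borel_measurable_restrict_space_iff) (auto simp: unit_square_sets)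
  then have "?F \<in> borel_measurable lebesgue" by (rule measurable_completion)
  then have "?F measurable_on UNIV" by (rule lebesgue_measurable_imp_measurable_on) auto
  then obtain N g where N: "negligible N" and g: "\<And>n. continuous_on UNIV (g n)"
     and lim: "\<And>z. z \<notin> N \<Longrightarrow> (\<lambda>n. g n z) \<longlonglongrightarrow> ?F z"
    unfolding measurable_on_def by auto
  define c where "c n z = max 0 (min 1 (g n z))" for n z
  have cont: "continuous_on UNIV (c n)" for n
    unfolding c_def by (intro continuous_intros g)
  have cb: "0 \<le> c n z" "c n z \<le> 1" for n z by (auto simp: c_def)
  have limc: "(\<lambda>n. c n z) \<longlonglongrightarrow> f z" if "z \<in> unit_square" "z \<notin> N" for z
  proof -
    have "(\<lambda>n. g n z) \<longlonglongrightarrow> f z" using lim[OF that(2)] that(1) by simp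
    then have "(\<lambda>n. c n z) \<longlonglongrightarrow> max 0 (min 1 (f z))" unfolding c_def by (intro tendsto_intros)
    then show ?thesis using b[OF that(1)] by simp
  qed
  have "AE z in lebesgue. z \<notin> N" using N by (simp add: negligible_iff_null_sets AE_not_in)
  then have "AE z in lborel. z \<notin> N" by (simp add: AE_completion_iff)
  then have ae: "AE z in usq. z \<notin> N"
    by (subst AE_restrict_space_iff) (auto simp: unit_square_sets)
  have cm[measurable]: "c n \<in> borel_measurable usq" for n
    using borel_measurable_continuous_onI[OF cont, of n] by (intro measurable_restrict_space1) simp
  have "(\<lambda>n. LINT z|usq. \<bar>f z - c n z\<bar>) \<longlonglongrightarrow> (LINT z|usq. (0 :: real))"
  proof (rule integral_dominated_convergence[where w = "\<lambda>_. 1"])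
    show "AE z in usq. (\<lambda>n. \<bar>f z - c n z\<bar>) \<longlonglongrightarrow> 0"
      using ae AE_space
    proof eventually_elim
      case (elim z)
      then have "(\<lambda>n. f z - c n z) \<longlonglongrightarrow> f z - f z" by (intro tendsto_intros limc) (auto simp: space_usq)
      then show ?case by (simp add: tendsto_rabs_zero)
    qed
    show "AE z in usq. norm \<bar>f z - c n z\<bar> \<le> 1" for n
    proof (rule AE_I2)
      fix z assume "z \<in> space usq"
      then show "norm \<bar>f z - c n z\<bar> \<le> 1" using b[of z] cb[of n z] by (simp add: space_usq abs_le_iff)
    qed
  qed (use f in auto)
  then have "(\<lambda>n. LINT z|usq. \<bar>f z - c n z\<bar>) \<longlonglongrightarrow> 0" by simp
  then have "eventually (\<lambda>n. (LINT z|usq. \<bar>f z - c n z\<bar>) < \<delta>) sequentially"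
    using \<delta> by (rule order_tendstoD)
  then obtain n where "(LINT z|usq. \<bar>f z - c n z\<bar>) < \<delta>" by (auto dest: eventually_happens)
  then show ?thesis using that[of "c n"] cont cb by blast
qed

lemma cell_approx: "0 < n \<Longrightarrow> x \<in> {0..1} \<Longrightarrow> \<bar>real (cell n x) / real n - x\<bar> \<le> 1 / real n"
proof -
  assume n: "0 < n" and x: "x \<in> {0..1}"
  have "real (cell n x) = of_int \<lceil>real n * x\<rceil>" using x by (simp add: cell_def)
  then have "\<bar>real (cell n x) - real n * x\<bar> \<le> 1" by linarith
  moreover have "real (cell n x) - real n * x = real n * (real (cell n x) / real n - x)"
    using n by (simp add: field_simps)
  ultimately show ?thesis using n by (simp add: abs_mult field_simps)
qed

text \<open>The conclusion holds for all large grids, not just for one, because the grid is later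
  prescribed: by the number of vertices, or jointly by finitely many graphons.\<close>

lemma step_approx:
  fixes f :: "real \<times> real \<Rightarrow> real"
  assumes f: "f \<in> borel_measurable usq" and b: "\<And>z. z \<in> unit_square \<Longrightarrow> 0 \<le> f z \<and> f z \<le> 1" and \<delta>: "0 < \<delta>"
  shows "\<forall>\<^sub>F n in sequentially. \<exists>v. (\<forall>i j. 0 \<le> v i j \<and> v i j \<le> (1::real)) \<and>
     (LINT z|usq. \<bar>f z - v (cell n (fst z)) (cell n (snd z))\<bar>) < \<delta>"
proof -
  obtain c where c: "continuous_on UNIV c" "\<And>z. 0 \<le> c z" "\<And>z. c z \<le> (1::real)" "(LINT z|usq. \<bar>f z - c z\<bar>) < \<delta> / 2"
    using continuous_approx_usq[OF f b, of "\<delta> / 2"] \<delta> by auto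
  have comp: "compact unit_square" by (intro compact_Times) auto
  have "uniformly_continuous_on unit_square c"
    by (rule compact_uniformly_continuous[OF continuous_on_subset[OF c(1)] comp]) auto
  then obtain d where d: "0 < d" "\<And>z w. z \<in> unit_square \<Longrightarrow> w \<in> unit_square \<Longrightarrow> dist w z < d \<Longrightarrow> dist (c w) (c z) < \<delta> / 2"
    using \<delta> unfolding uniformly_continuous_on_def by (metis half_gt_zero)
  have "\<forall>\<^sub>F n in sequentially. 2 / d < real n" by real_asymp
  then show ?thesis
  proof (rule eventually_mono)
    fix n assume "2 / d < real n"
    moreover from this have "0 < real n" using d(1) by (elim order.strict_trans[rotated]) simp
    ultimately have n: "2 / real n < d" "0 < n" using d(1) by (auto simp: field_simps)
    \<comment> \<open>The sample point is the upper right corner of the cell, at most 1/n away in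
      each coordinate; this also holds for cell 0, which consists of 0 alone.\<close>
    define v where "v i j = c (real i / real n, real j / real n)" for i j
    have vm: "(\<lambda>z. v (cell n (fst z)) (cell n (snd z))) \<in> borel_measurable usq"
      using step_measurable_borel[of v n] by (intro measurable_restrict_space1) simp
    have cm: "c \<in> borel_measurable usq"
      using borel_measurable_continuous_onI[OF c(1)] by (intro measurable_restrict_space1) simp
    have ifc: "integrable usq (\<lambda>z. \<bar>f z - c z\<bar>)"
    proof (rule usq_integrableI[where B = 1])
      fix z assume "z \<in> unit_square"
      then show "\<bar>\<bar>f z - c z\<bar>\<bar> \<le> 1"
        using b[of z] c(2)[of z] c(3)[of z] by (simp add: abs_le_iff)
    qed (use f cm in auto)
    have "(LINT z|usq. \<bar>f z - v (cell n (fst z)) (cell n (snd z))\<bar>) \<le> (LINT z|usq. \<bar>f z - c z\<bar> + \<delta> / 2)"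
    proof (rule integral_mono)
      show "integrable usq (\<lambda>z. \<bar>f z - v (cell n (fst z)) (cell n (snd z))\<bar>)"
      proof (rule usq_integrableI[where B = 1])
        fix z assume "z \<in> unit_square"
        then show "\<bar>\<bar>f z - v (cell n (fst z)) (cell n (snd z))\<bar>\<bar> \<le> 1"
          using b[of z] c(2)[of "(real (cell n (fst z)) / real n, real (cell n (snd z)) / real n)"]
            c(3)[of "(real (cell n (fst z)) / real n, real (cell n (snd z)) / real n)"]
          by (simp add: v_def abs_le_iff)
      qed (use f vm in auto)
      show "integrable usq (\<lambda>z. \<bar>f z - c z\<bar> + \<delta> / 2)" using ifc by auto
      fix z assume "z \<in> space usq"
      then obtain x y where z: "z = (x, y)" "x \<in> {0..1}" "y \<in> {0..1}" by (auto simp: space_usq)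
      let ?w = "(real (cell n x) / real n, real (cell n y) / real n)"
      have w: "?w \<in> unit_square" using cell_le[OF z(2)] cell_le[OF z(3)] n by auto
      have "dist ?w z \<le> \<bar>real (cell n x) / real n - x\<bar> + \<bar>real (cell n y) / real n - y\<bar>"
        unfolding z dist_Pair_Pair dist_real_def by (rule order.trans[OF sqrt_sum_squares_le_sum_abs]) simp
      also have "\<dots> \<le> 2 / real n"
        using cell_approx[OF n(2) z(2)] cell_approx[OF n(2) z(3)] by simp
      finally have "dist (c ?w) (c z) < \<delta> / 2" using w z n by (intro d(2)) auto
      then show "\<bar>f z - v (cell n (fst z)) (cell n (snd z))\<bar> \<le> \<bar>f z - c z\<bar> + \<delta> / 2"
        unfolding v_def z(1) dist_real_def fst_conv snd_conv by linarith
    qed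
    also have "\<dots> = (LINT z|usq. \<bar>f z - c z\<bar>) + \<delta> / 2"
    proof (subst Bochner_Integration.integral_add)
      show "integrable usq (\<lambda>z. \<bar>f z - c z\<bar>)" by (rule ifc)
    qed (auto simp: usq.prob_space[unfolded space_usq] space_usq)
    also have "\<dots> < \<delta>" using c(4) by simp
    finally show "\<exists>v. (\<forall>i j. 0 \<le> v i j \<and> v i j \<le> (1::real)) \<and>
        (LINT z|usq. \<bar>f z - v (cell n (fst z)) (cell n (snd z))\<bar>) < \<delta>"
      using c(2,3) by (intro exI[of _ v]) (auto simp: v_def)
  qed
qed

lemma l1_dist_triangle:
  assumes "f \<in> graphons" "g \<in> graphons" "h \<in> graphons"
  shows "l1_dist f h \<le> l1_dist f g + l1_dist g h"
proof -
  have i: "integrable usq f" "integrable usq g" "integrable usq h"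
    using assms by (auto intro: integrable_graphon)
  have "l1_dist f h \<le> (LINT z|usq. \<bar>f z - g z\<bar> + \<bar>g z - h z\<bar>)"
    unfolding l1_dist_def by (rule integral_mono) (use i in auto)
  also have "\<dots> = l1_dist f g + l1_dist g h"
    unfolding l1_dist_def by (rule Bochner_Integration.integral_add) (use i in auto)
  finally show ?thesis .
qed

text \<open>Averaging the step function with its transpose makes it symmetric. Since f is symmetric,
  the transpose is equally close to f, so the average is no farther away.\<close>

lemma graphon_step_approx:
  assumes f: "f \<in> graphons" and \<delta>: "0 < \<delta>"
  shows "\<forall>\<^sub>F n in sequentially. \<exists>v. sym01 n v \<and> l1_dist f (step_graphon n v) < \<delta>"
proof -
  have "\<forall>\<^sub>F n in sequentially. \<exists>v. (\<forall>i j. 0 \<le> v i j \<and> v i j \<le> (1::real)) \<and>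
     (LINT z|usq. \<bar>f z - v (cell n (fst z)) (cell n (snd z))\<bar>) < \<delta>"
    by (rule step_approx) (use graphon_measurable_usq[OF f] graphon_bounds[OF f] \<delta> in auto)
  then show ?thesis
  proof (rule eventually_mono)
    fix n assume "\<exists>v. (\<forall>i j. 0 \<le> v i j \<and> v i j \<le> (1::real)) \<and>
     (LINT z|usq. \<bar>f z - v (cell n (fst z)) (cell n (snd z))\<bar>) < \<delta>"
    then obtain v where v: "\<And>i j. 0 \<le> v i j \<and> v i j \<le> (1::real)"
      "(LINT z|usq. \<bar>f z - v (cell n (fst z)) (cell n (snd z))\<bar>) < \<delta>" by blast
    let ?v = "\<lambda>z. v (cell n (fst z)) (cell n (snd z))"
    let ?u = "\<lambda>i j. (v i j + v j i) / 2"
    have s: "sym01 n ?u" using v(1) by (auto simp: sym01_def add.commute add_nonneg_nonneg)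
       (metis add_mono one_add_one)
    have vm: "?v \<in> borel_measurable usq"
      using step_measurable_borel[of v n] by (intro measurable_restrict_space1) simp
    have vm': "(\<lambda>z. ?v (snd z, fst z)) \<in> borel_measurable usq"
      using step_measurable_borel[of "\<lambda>i j. v j i" n] by (intro measurable_restrict_space1) simp
    note fm = graphon_measurable_usq[OF f]
    have sw: "(LINT z|usq. \<bar>f z - ?v (snd z, fst z)\<bar>) = (LINT z|usq. \<bar>f z - ?v z\<bar>)"
    proof -
      have "(LINT z|usq. \<bar>f z - ?v (snd z, fst z)\<bar>) = (LINT z|usq. \<bar>f (snd z, fst z) - ?v (snd z, fst z)\<bar>)"
        using f by (intro Bochner_Integration.integral_cong refl) (auto simp: graphons_def space_usq)
      also have "\<dots> = (LINT z|usq. \<bar>f z - ?v z\<bar>)"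
        using integral_usq_swap[of "\<lambda>z. \<bar>f z - ?v z\<bar>"] vm fm by simp
      finally show ?thesis .
    qed
    have int: "integrable usq (\<lambda>z. \<bar>f z - ?v z\<bar>)" "integrable usq (\<lambda>z. \<bar>f z - ?v (snd z, fst z)\<bar>)"
    proof -
      have "\<bar>\<bar>f z - v i j\<bar>\<bar> \<le> 1" if "z \<in> unit_square" for z i j
        using graphon_bounds[OF f that] v(1)[of i j] by (simp add: abs_le_iff)
      then show "integrable usq (\<lambda>z. \<bar>f z - ?v z\<bar>)" "integrable usq (\<lambda>z. \<bar>f z - ?v (snd z, fst z)\<bar>)"
        by (intro usq_integrableI[where B = 1]; use fm vm vm' in auto)+
    qed
    have "l1_dist f (step_graphon n ?u) \<le> (LINT z|usq. (\<bar>f z - ?v z\<bar> + \<bar>f z - ?v (snd z, fst z)\<bar>) / 2)"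
      unfolding l1_dist_def
    proof (rule integral_mono)
      show "integrable usq (\<lambda>z. \<bar>f z - step_graphon n ?u z\<bar>)"
        using integrable_graphon[OF f] integrable_graphon[OF step_graphon_in_graphons[OF s]] by auto
      show "integrable usq (\<lambda>z. (\<bar>f z - ?v z\<bar> + \<bar>f z - ?v (snd z, fst z)\<bar>) / 2)"
        using int by auto
      fix z assume "z \<in> space usq"
      then obtain x y where z: "z = (x, y)" "x \<in> {0..1}" "y \<in> {0..1}" by (auto simp: space_usq)
      have "\<bar>a - (b + c) / 2\<bar> \<le> (\<bar>a - b\<bar> + \<bar>a - c\<bar>) / 2" for a b c :: real
        using abs_triangle_ineq[of "a - b" "a - c"] by (simp add: abs_if field_simps split: if_splits)
      then show "\<bar>f z - step_graphon n ?u z\<bar> \<le> (\<bar>f z - ?v z\<bar> + \<bar>f z - ?v (snd z, fst z)\<bar>) / 2"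
        unfolding z(1) step_graphon_apply[OF z(2,3)] fst_conv snd_conv .
    qed
    also have "\<dots> = ((LINT z|usq. \<bar>f z - ?v z\<bar>) + (LINT z|usq. \<bar>f z - ?v (snd z, fst z)\<bar>)) / 2"
      using int by simp
    also have "\<dots> < \<delta>" using v(2) sw by simp
    finally show "\<exists>v. sym01 n v \<and> l1_dist f (step_graphon n v) < \<delta>" using s by blast
  qed
qed

section \<open>Continuity of the rate function in the L1 distance\<close>

lemma continuous_on_x_ln_x: "continuous_on {0..} (\<lambda>x::real. x * ln x)"
  unfolding continuous_on_def
proof
  fix x :: real assume x: "x \<in> {0..}"
  show "((\<lambda>x. x * ln x) \<longlongrightarrow> x * ln x) (at x within {0..})"
  proof (cases "x = 0")
    case True
    have "((\<lambda>x::real. x * ln x) \<longlongrightarrow> 0) (at_right 0)" by real_asymp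
    moreover have "at (0::real) within {0..} = at_right 0"
    proof -
      have "{0..} - {0} = {0<..} - {0::real}" by auto
      then show ?thesis by (simp only: at_within_def)
    qed
    ultimately show ?thesis using True by simp
  next
    case False
    then show ?thesis using x by (intro tendsto_intros) auto
  qed
qed

lemma rate_density_alt:
  assumes p: "0 < p" "p < 1" and u: "u \<in> {0..1}"
  shows "rate_density p u = 1/2 * (u * ln u - u * ln p) + 1/2 * ((1 - u) * ln (1 - u) - (1 - u) * ln (1 - p))"
proof -
  have "u * ln (u / p) = u * ln u - u * ln p"
    using p u by (cases "u = 0") (auto simp: ln_div algebra_simps)
  moreover have "(1 - u) * ln ((1 - u) / (1 - p)) = (1 - u) * ln (1 - u) - (1 - u) * ln (1 - p)"
    using p u by (cases "u = 1") (auto simp: ln_div algebra_simps)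
  ultimately show ?thesis unfolding rate_density_def mult.assoc by simp
qed

lemma continuous_on_rate_density:
  assumes p: "0 < p" "p < 1"
  shows "continuous_on {0..1} (rate_density p)"
proof -
  have "continuous_on {0..1} (\<lambda>u. 1/2 * (u * ln u - u * ln p) + 1/2 * ((1 - u) * ln (1 - u) - (1 - u) * ln (1 - p)))"
    by (intro continuous_intros continuous_on_subset[OF continuous_on_x_ln_x]
        continuous_on_compose2[OF continuous_on_x_ln_x, where f = "\<lambda>u. 1 - u"]) auto
  then show ?thesis by (rule continuous_on_eq) (simp add: rate_density_alt[OF p])
qed

lemma rate_density_bound:
  assumes p: "0 < p" "p < 1"
  obtains B where "0 < B" "\<And>u. u \<in> {0..1} \<Longrightarrow> \<bar>rate_density p u\<bar> \<le> B"
proof -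
  have "compact (rate_density p ` {0..1})"
    by (rule compact_continuous_image[OF continuous_on_rate_density[OF p]]) auto
  then show ?thesis using that compact_imp_bounded bounded_pos[of "rate_density p ` {0..1}"] by auto
qed

text \<open>The derivative is infinite at 0 and 1, so there is no Lipschitz bound. Uniform
  continuity handles close arguments; for arguments at distance at least d the bound 2 * B on the
  difference is at most (2 * B / d) times the distance. The resulting affine bound can be
  integrated.\<close>

lemma rate_density_modulus:
  assumes p: "0 < p" "p < 1" and \<eta>: "0 < \<eta>"
  obtains C where "0 < C" "\<And>u v. u \<in> {0..1} \<Longrightarrow> v \<in> {0..1} \<Longrightarrow>
     \<bar>rate_density p u - rate_density p v\<bar> \<le> \<eta> + C * \<bar>u - v\<bar>"
proof -
  obtain B where B: "0 < B" "\<And>u. u \<in> {0..1} \<Longrightarrow> \<bar>rate_density p u\<bar> \<le> B" using rate_density_bound[OF p] by metis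
  have "uniformly_continuous_on {0..1} (rate_density p)"
    by (rule compact_uniformly_continuous[OF continuous_on_rate_density[OF p]]) auto
  then obtain d where d: "0 < d" "\<And>u v. u \<in> {0..1} \<Longrightarrow> v \<in> {0..1} \<Longrightarrow> dist v u < d \<Longrightarrow>
      dist (rate_density p v) (rate_density p u) < \<eta>"
    using \<eta> unfolding uniformly_continuous_on_def by metis
  show ?thesis
  proof (rule that[of "2 * B / d"])
    show "0 < 2 * B / d" using B d by simp
    fix u v :: real assume uv: "u \<in> {0..1}" "v \<in> {0..1}"
    show "\<bar>rate_density p u - rate_density p v\<bar> \<le> \<eta> + 2 * B / d * \<bar>u - v\<bar>"
    proof (cases "dist u v < d")
      case True
      then have "\<bar>rate_density p u - rate_density p v\<bar> \<le> \<eta>" using d(2)[OF uv(2,1)] by (simp add: dist_real_def)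
      moreover have "0 \<le> 2 * B / d * \<bar>u - v\<bar>" using B d by simp
      ultimately show ?thesis by linarith
    next
      case False
      then have "1 \<le> \<bar>u - v\<bar> / d" using d by (simp add: dist_real_def)
      then have "2 * B * 1 \<le> 2 * B * (\<bar>u - v\<bar> / d)" using B by (intro mult_left_mono) auto
      moreover have "\<bar>rate_density p u - rate_density p v\<bar> \<le> 2 * B" using B(2)[OF uv(1)] B(2)[OF uv(2)] by linarith
      ultimately show ?thesis using \<eta> by simp
    qed
  qed
qed

lemma graphon_in_01: "f \<in> graphons \<Longrightarrow> z \<in> unit_square \<Longrightarrow> f z \<in> {0..1}"
  using graphon_bounds by (simp only: atLeastAtMost_iff)

lemma rate_density_measurable:
  assumes p: "0 < p" "p < 1" and f: "f \<in> graphons"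
  shows "(\<lambda>z. rate_density p (f z)) \<in> borel_measurable usq"
  unfolding rate_density_def using graphon_measurable_usq[OF f] by measurable

lemma rate_density_integrable:
  assumes p: "0 < p" "p < 1" and f: "f \<in> graphons"
  shows "integrable usq (\<lambda>z. rate_density p (f z))"
proof -
  obtain B where B: "0 < B" "\<And>u. u \<in> {0..1} \<Longrightarrow> \<bar>rate_density p u\<bar> \<le> B" using rate_density_bound[OF p] by metis
  show ?thesis
    by (rule usq_integrableI[where B = B])
       (rule rate_density_measurable[OF p f], rule B(2), rule graphon_in_01[OF f])
qed

lemma rate_eq:
  assumes p: "0 < p" "p < 1" and f: "f \<in> graphons"
  shows "rate p f = (LINT z|usq. rate_density p (f z))"
proof -
  let ?F = "\<lambda>z. indicator unit_square z *\<^sub>R rate_density p (f z)"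
  have i: "integrable (lborel \<Otimes>\<^sub>M lborel) ?F"
    using rate_density_integrable[OF p f] by (subst (asm) integrable_restrict_space) (auto simp: unit_square_sets lborel_prod)
  have "rate p f = (LINT x|lborel. LINT y|lborel. ?F (x, y))"
    unfolding rate_def set_lebesgue_integral_def
    by (subst integral_scaleR_right[symmetric]) (auto intro!: Bochner_Integration.integral_cong simp: indicator_def)
  also have "\<dots> = (LINT z|lborel. ?F z)"
    using lborel_pair.integral_fst'[OF i] by (simp add: lborel_prod)
  also have "\<dots> = (LINT z|usq. rate_density p (f z))"
    by (subst integral_restrict_space) (auto simp: unit_square_sets)
  finally show ?thesis .
qed

lemma rate_l1_continuous:
  assumes p: "0 < p" "p < 1" and \<eta>: "0 < \<eta>"
  obtains C where "0 < C" "\<And>f g. f \<in> graphons \<Longrightarrow> g \<in> graphons \<Longrightarrow> rate p f \<le> rate p g + \<eta> + C * l1_dist f g"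
proof -
  obtain C where C: "0 < C" "\<And>u v. u \<in> {0..1} \<Longrightarrow> v \<in> {0..1} \<Longrightarrow>
     \<bar>rate_density p u - rate_density p v\<bar> \<le> \<eta> + C * \<bar>u - v\<bar>" using rate_density_modulus[OF p \<eta>] by metis
  show ?thesis
  proof (rule that[OF C(1)])
    fix f g assume f: "f \<in> graphons" and g: "g \<in> graphons"
    have i: "integrable usq (\<lambda>z. \<bar>f z - g z\<bar>)" using integrable_graphon[OF f] integrable_graphon[OF g] by auto
    note ri = rate_density_integrable[OF p f] rate_density_integrable[OF p g]
    have "rate p f \<le> (LINT z|usq. rate_density p (g z) + (\<eta> + C * \<bar>f z - g z\<bar>))"
      unfolding rate_eq[OF p f]
    proof (rule integral_mono)
      fix z assume "z \<in> space usq"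
      then have "z \<in> unit_square" by (simp add: space_usq)
      then show "rate_density p (f z) \<le> rate_density p (g z) + (\<eta> + C * \<bar>f z - g z\<bar>)"
        using C(2)[of "f z" "g z"] graphon_in_01[OF f, of z] graphon_in_01[OF g, of z] by linarith
    qed (use ri i in auto)
    also have "\<dots> = rate p g + (\<eta> + C * l1_dist f g)"
      using ri i usq.prob_space by (simp add: rate_eq[OF p g] l1_dist_def)
    finally show "rate p f \<le> rate p g + \<eta> + C * l1_dist f g" by simp
  qed
qed

section \<open>Tilting product Bernoulli measures\<close>

text \<open>For x in {0, 1} this is the logarithm of the ratio of the Bernoulli weights with
  parameters u and p. The affine extension to real x allows graphon values in place of edge
  indicators.\<close>

definition loglik :: "real \<Rightarrow> real \<Rightarrow> real \<Rightarrow> real" where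
  "loglik p u x = x * ln (u / p) + (1 - x) * ln ((1 - u) / (1 - p))"

lemma rate_density_eq_loglik: "rate_density p u = loglik p u u / 2"
  by (simp add: rate_density_def loglik_def)

lemma finite_support_Pi_bool:
  "finite I \<Longrightarrow> finite (set_pmf (Pi_pmf I d (q :: 'a \<Rightarrow> bool pmf)))"
  by (rule finite_subset[OF set_Pi_pmf_subset']) (auto intro!: finite_PiE_dflt)

text \<open>The Chernoff bound: the indicator of the event is at most the exponential of the sum
  minus s, whose expectation factorizes by independence.\<close>

lemma Pi_pmf_exponential_Markov:
  fixes q :: "'a \<Rightarrow> bool pmf"
  assumes I: "finite I"
  shows "measure_pmf.prob (Pi_pmf I d q) {\<omega>. s \<le> (\<Sum>e\<in>I. f e (\<omega> e))}
    \<le> exp (- s) * (\<Prod>e\<in>I. measure_pmf.expectation (q e) (\<lambda>x. exp (f e x)))"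
proof -
  let ?P = "measure_pmf (Pi_pmf I d q)" and ?A = "{\<omega>. s \<le> (\<Sum>e\<in>I. f e (\<omega> e))}"
  have int: "integrable ?P g" for g :: "_ \<Rightarrow> real"
    by (rule integrable_measure_pmf_finite[OF finite_support_Pi_bool[OF I]])
  have "measure ?P ?A = (LINT \<omega>|?P. indicator ?A \<omega>)" by simp
  also have "\<dots> \<le> (LINT \<omega>|?P. exp (- s) * (\<Prod>e\<in>I. exp (f e (\<omega> e))))"
    by (rule integral_mono) (auto simp: int indicator_def exp_sum[OF I, symmetric] mult_exp_exp prod_nonneg)
  also have "\<dots> = exp (- s) * (LINT \<omega>|?P. (\<Prod>e\<in>I. exp (f e (\<omega> e))))" by simp
  also have "(LINT \<omega>|?P. (\<Prod>e\<in>I. exp (f e (\<omega> e))))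
      = (\<Prod>e\<in>I. measure_pmf.expectation (q e) (\<lambda>x. exp (f e x)))"
    by (rule expectation_prod_Pi_pmf[OF I]) (auto intro: integrable_measure_pmf_finite)
  finally show ?thesis .
qed

lemma bernoulli_loglik:
  assumes "0 < p" "p < 1" "0 < u" "u < 1"
  shows "pmf (bernoulli_pmf u) x = pmf (bernoulli_pmf p) x * exp (loglik p u (of_bool x))"
  using assms by (cases x) (auto simp: loglik_def)

lemma loglik_tail:
  assumes I: "finite I" and p: "0 < p" "p < 1" and u: "\<And>e. e \<in> I \<Longrightarrow> 0 < u e \<and> u e < 1"
  shows "measure_pmf.prob (Pi_pmf I d (\<lambda>_. bernoulli_pmf p))
    {\<omega>. s \<le> (\<Sum>e\<in>I. loglik p (u e) (of_bool (\<omega> e)))} \<le> exp (- s)"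
proof -
  have "measure_pmf.expectation (bernoulli_pmf p) (\<lambda>x. exp (loglik p (u e) (of_bool x))) = 1"
    if "e \<in> I" for e
    using p u[OF that] by (simp add: loglik_def)
  then show ?thesis
    using Pi_pmf_exponential_Markov[OF I, where f = "\<lambda>e x. loglik p (u e) (of_bool x)" and s = s and d = d
        and q = "\<lambda>_. bernoulli_pmf p"] by simp
qed

text \<open>Hoeffding's lemma for one Bernoulli variable. The library inequality is for nonnegative
  h; exchanging the two outcomes turns u into 1 - u and h into - h.\<close>

lemma bernoulli_mgf_le:
  assumes "0 \<le> u" "u \<le> 1"
  shows "measure_pmf.expectation (bernoulli_pmf u) (\<lambda>x. exp (h * (of_bool x - u))) \<le> exp (h\<^sup>2 / 8)"
proof -
  have aux: "w * exp (h * (1 - w)) + (1 - w) * exp (- h * w) \<le> exp (h\<^sup>2 / 8)"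
    if w: "0 \<le> w" "w \<le> 1" and h: "0 \<le> h" for w h :: real
  proof -
    have pos: "0 < 1 + w * (exp h - 1)"
      using w h by (intro add_pos_nonneg) auto
    have "- h * w + ln (1 + w * (exp h - 1)) \<le> h\<^sup>2 / 8"
      using Hoeffdings_lemma_aux[OF h w(1)] .
    then have "exp (- h * w + ln (1 + w * (exp h - 1))) \<le> exp (h\<^sup>2 / 8)" by simp
    also have "exp (- h * w + ln (1 + w * (exp h - 1))) = exp (- h * w) * (1 + w * (exp h - 1))"
      using pos by (simp only: exp_add exp_ln)
    also have "\<dots> = w * (exp (- h * w) * exp h) + (1 - w) * exp (- h * w)"
      by (simp add: algebra_simps)
    also have "exp (- h * w) * exp h = exp (h * (1 - w))"
      by (simp add: mult_exp_exp algebra_simps)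
    finally show ?thesis .
  qed
  have e: "measure_pmf.expectation (bernoulli_pmf u) (\<lambda>x. exp (h * (of_bool x - u)))
      = u * exp (h * (1 - u)) + (1 - u) * exp (- h * u)"
    using assms by (simp add: mult.commute)
  show ?thesis
  proof (cases "0 \<le> h")
    case True
    then show ?thesis unfolding e using aux[of u h] assms by simp
  next
    case False
    then show ?thesis unfolding e using aux[of "1 - u" "- h"] assms by (simp add: algebra_simps)
  qed
qed

text \<open>An upper bound N takes the place of the number of variables, so that the estimate can be
  used with N = n^2 for the edges of a graph.\<close>

lemma bernoulli_linear_tail:
  fixes c :: "'a \<Rightarrow> real"
  assumes I: "finite I" and u: "\<And>e. e \<in> I \<Longrightarrow> 0 \<le> u e \<and> u e \<le> 1"
    and c: "\<And>e. e \<in> I \<Longrightarrow> \<bar>c e\<bar> \<le> K" and N: "real (card I) \<le> N" and K: "0 < K" and \<epsilon>: "0 < \<epsilon>"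
  shows "measure_pmf.prob (Pi_pmf I d (\<lambda>e. bernoulli_pmf (u e)))
    {\<omega>. \<epsilon> * N \<le> (\<Sum>e\<in>I. c e * (of_bool (\<omega> e) - u e))} \<le> exp (- (2 * \<epsilon>\<^sup>2 / K\<^sup>2) * N)"
proof -
  \<comment> \<open>Minimizer of the exponent - t * \<epsilon> * N + N * t^2 * K^2 / 8; the minimum
    is - 2 * \<epsilon>^2 * N / K^2.\<close>
  let ?t = "4 * \<epsilon> / K\<^sup>2"
  have t: "0 < ?t" using K \<epsilon> by simp
  have eq: "{\<omega>. \<epsilon> * N \<le> (\<Sum>e\<in>I. c e * (of_bool (\<omega> e) - u e))}
      = {\<omega>. ?t * (\<epsilon> * N) \<le> (\<Sum>e\<in>I. ?t * c e * (of_bool (\<omega> e) - u e))}"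
  proof -
    have "(\<Sum>e\<in>I. ?t * c e * (of_bool (\<omega> e) - u e)) = ?t * (\<Sum>e\<in>I. c e * (of_bool (\<omega> e) - u e))" for \<omega>
      by (simp add: sum_distrib_left mult.assoc)
    then show ?thesis using t by (simp only: mult_le_cancel_left_pos)
  qed
  have "measure_pmf.prob (Pi_pmf I d (\<lambda>e. bernoulli_pmf (u e)))
      {\<omega>. \<epsilon> * N \<le> (\<Sum>e\<in>I. c e * (of_bool (\<omega> e) - u e))}
     \<le> exp (- (?t * (\<epsilon> * N))) * (\<Prod>e\<in>I. measure_pmf.expectation (bernoulli_pmf (u e)) (\<lambda>x. exp (?t * c e * (of_bool x - u e))))"
    unfolding eq by (rule Pi_pmf_exponential_Markov[OF I])
  also have "\<dots> \<le> exp (- (?t * (\<epsilon> * N))) * (\<Prod>e\<in>I. exp (?t\<^sup>2 * K\<^sup>2 / 8))"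
  proof (intro mult_left_mono prod_mono conjI)
    fix e assume e: "e \<in> I"
    show "0 \<le> measure_pmf.expectation (bernoulli_pmf (u e)) (\<lambda>x. exp (?t * c e * (of_bool x - u e)))"
      by (rule integral_nonneg_AE) simp
    have "(c e)\<^sup>2 \<le> K\<^sup>2" using c[OF e] K by (simp add: abs_le_square_iff[symmetric])
    then have "(?t * c e)\<^sup>2 \<le> ?t\<^sup>2 * K\<^sup>2" unfolding power_mult_distrib by (intro mult_left_mono) auto
    then show "measure_pmf.expectation (bernoulli_pmf (u e)) (\<lambda>x. exp (?t * c e * (of_bool x - u e)))
        \<le> exp (?t\<^sup>2 * K\<^sup>2 / 8)"
      using u[OF e] by (intro order.trans[OF bernoulli_mgf_le]) auto
  qed auto
  also have "\<dots> = exp (- (?t * (\<epsilon> * N)) + real (card I) * (?t\<^sup>2 * K\<^sup>2 / 8))"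
    by (simp add: mult_exp_exp exp_of_nat_mult[symmetric])
  also have "\<dots> \<le> exp (- (?t * (\<epsilon> * N)) + N * (?t\<^sup>2 * K\<^sup>2 / 8))"
    using N by (simp add: mult_right_mono)
  also have "- (?t * (\<epsilon> * N)) + N * (?t\<^sup>2 * K\<^sup>2 / 8) = - (2 * \<epsilon>\<^sup>2 / K\<^sup>2) * N"
    using K by (simp add: field_simps power2_eq_square)
  finally show ?thesis .
qed

text \<open>Where the log-likelihood ratio is at most t, every outcome has under the original law at
  least exp (- t) times its tilted weight.\<close>

lemma loglik_change_of_measure:
  assumes I: "finite I" and p: "0 < p" "p < 1" and u: "\<And>e. e \<in> I \<Longrightarrow> 0 < u e \<and> u e < 1"
  shows "exp (- t) * measure_pmf.prob (Pi_pmf I d (\<lambda>e. bernoulli_pmf (u e)))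
      (B \<inter> {\<omega>. (\<Sum>e\<in>I. loglik p (u e) (of_bool (\<omega> e))) \<le> t})
    \<le> measure_pmf.prob (Pi_pmf I d (\<lambda>_. bernoulli_pmf p)) B"
proof -
  \<comment> \<open>The functions with the default value outside \<open>I\<close> form a finite set
    that carries the tilted law, so the probabilities are finite sums and can be compared weight by
    weight.\<close>
  let ?F = "PiE_dflt I d (\<lambda>_. UNIV :: bool set)"
  let ?D = "{\<omega>. (\<Sum>e\<in>I. loglik p (u e) (of_bool (\<omega> e))) \<le> t}"
  let ?Q = "Pi_pmf I d (\<lambda>e. bernoulli_pmf (u e))" and ?P = "Pi_pmf I d (\<lambda>_. bernoulli_pmf p)"
  have F: "finite ?F" using I by (intro finite_PiE_dflt) auto
  have supp: "set_pmf ?Q \<subseteq> ?F"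
    by (rule order.trans[OF set_Pi_pmf_subset'[OF I]]) (auto simp: PiE_dflt_def)
  have "measure_pmf.prob ?Q (B \<inter> ?D) = measure_pmf.prob ?Q (B \<inter> ?D \<inter> ?F)"
    by (rule measure_pmf.finite_measure_eq_AE) (use supp in \<open>auto simp: AE_measure_pmf_iff\<close>)
  also have "\<dots> = (\<Sum>\<omega>\<in>B \<inter> ?D \<inter> ?F. pmf ?Q \<omega>)"
    using F by (intro measure_measure_pmf_finite) auto
  finally have "exp (- t) * measure_pmf.prob ?Q (B \<inter> ?D) = (\<Sum>\<omega>\<in>B \<inter> ?D \<inter> ?F. exp (- t) * pmf ?Q \<omega>)"
    by (simp add: sum_distrib_left)
  also have "\<dots> \<le> (\<Sum>\<omega>\<in>B \<inter> ?D \<inter> ?F. pmf ?P \<omega>)"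
  proof (rule sum_mono)
    fix \<omega> assume w: "\<omega> \<in> B \<inter> ?D \<inter> ?F"
    then have d: "\<And>x. x \<notin> I \<Longrightarrow> \<omega> x = d" by (auto simp: PiE_dflt_def)
    have "pmf ?Q \<omega> = (\<Prod>e\<in>I. pmf (bernoulli_pmf p) (\<omega> e) * exp (loglik p (u e) (of_bool (\<omega> e))))"
      using d u bernoulli_loglik[OF p] by (subst pmf_Pi[OF I]) (auto intro!: prod.cong)
    also have "\<dots> = pmf ?P \<omega> * exp (\<Sum>e\<in>I. loglik p (u e) (of_bool (\<omega> e)))"
      using d by (subst pmf_Pi[OF I]) (auto simp: prod.distrib exp_sum[OF I])
    also have "\<dots> \<le> pmf ?P \<omega> * exp t" using w by (intro mult_left_mono) auto
    finally have "exp (- t) * pmf ?Q \<omega> \<le> exp (- t) * (pmf ?P \<omega> * exp t)" by (intro mult_left_mono) auto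
    then show "exp (- t) * pmf ?Q \<omega> \<le> pmf ?P \<omega>" by (simp add: exp_minus field_simps)
  qed
  also have "\<dots> = measure_pmf.prob ?P (B \<inter> ?D \<inter> ?F)"
    using F by (intro measure_measure_pmf_finite[symmetric]) auto
  also have "\<dots> \<le> measure_pmf.prob ?P B" by (rule measure_pmf.finite_measure_mono) auto
  finally show ?thesis .
qed

section \<open>Edges of the complete graph and sums over ordered pairs\<close>

lemma finite_potential_edges: "finite (potential_edges n)"
  by (rule finite_subset[of _ "Pow {1..n}"]) (auto simp: potential_edges_def)

lemma potential_edges_eq: "potential_edges n = (\<lambda>(i, j). {i, j}) ` {(i, j). i \<in> {1..n} \<and> j \<in> {1..n} \<and> i < j}"
proof (intro set_eqI iffI)
  fix e assume "e \<in> potential_edges n"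
  then obtain i j where e: "e = {i, j}" "i \<noteq> j" "e \<subseteq> {1..n}"
    by (auto simp: potential_edges_def card_2_iff)
  have "e = (\<lambda>(i, j). {i, j}) (min i j, max i j)" using e(1) by (auto simp: min_def max_def)
  moreover have "(min i j, max i j) \<in> {(i, j). i \<in> {1..n} \<and> j \<in> {1..n} \<and> i < j}"
    using e by (auto simp: min_def max_def)
  ultimately show "e \<in> (\<lambda>(i, j). {i, j}) ` {(i, j). i \<in> {1..n} \<and> j \<in> {1..n} \<and> i < j}"
    by (rule image_eqI)
qed (auto simp: potential_edges_def)

text \<open>An edge, written by its minimum and maximum, accounts for two ordered pairs. This
  converts integrals over cells into sums of independent edge variables.\<close>

lemma sum_offdiag_eq_sum_edges:
  fixes c :: "nat \<Rightarrow> nat \<Rightarrow> real"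
  shows "(\<Sum>i=1..n. \<Sum>j\<in>{1..n} - {i}. c i j) = (\<Sum>e\<in>potential_edges n. c (Min e) (Max e) + c (Max e) (Min e))"
proof -
  let ?U = "{(i, j). i \<in> {1..n} \<and> j \<in> {1..n} \<and> i < j}" and ?V = "{(i, j). i \<in> {1..n} \<and> j \<in> {1..n} \<and> j < i}"
  have fin: "finite ?U" "finite ?V"
    by (rule finite_subset[of _ "{1..n} \<times> {1..n}"]; auto)+
  have "(\<Sum>i=1..n. \<Sum>j\<in>{1..n} - {i}. c i j) = (\<Sum>(i, j)\<in>?U \<union> ?V. c i j)"
    by (subst sum.Sigma) (auto intro!: sum.cong)
  also have "\<dots> = (\<Sum>(i, j)\<in>?U. c i j) + (\<Sum>(i, j)\<in>?V. c i j)"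
    by (rule sum.union_disjoint) (use fin in auto)
  also have "(\<Sum>(i, j)\<in>?V. c i j) = (\<Sum>(i, j)\<in>?U. c j i)"
    by (rule sum.reindex_bij_witness[of _ prod.swap prod.swap]) auto
  also have "(\<Sum>(i, j)\<in>?U. c i j) + (\<Sum>(i, j)\<in>?U. c j i)
      = (\<Sum>z\<in>?U. c (Min {fst z, snd z}) (Max {fst z, snd z}) + c (Max {fst z, snd z}) (Min {fst z, snd z}))"
    unfolding sum.distrib[symmetric] by (rule sum.cong) (auto simp: min_def max_def)
  also have "\<dots> = (\<Sum>e\<in>potential_edges n. c (Min e) (Max e) + c (Max e) (Min e))"
  proof -
    have inj: "inj_on (\<lambda>(i, j). {i, j}) ?U" by (rule inj_onI) (auto simp: doubleton_eq_iff)
    show ?thesis unfolding potential_edges_eq by (subst sum.reindex[OF inj]) (auto intro!: sum.cong)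
  qed
  finally show ?thesis .
qed

lemma card_potential_edges_le: "real (card (potential_edges n)) \<le> (real n)\<^sup>2"
proof -
  have "real (card (potential_edges n)) \<le> (\<Sum>e\<in>potential_edges n. 1 + 1)" by simp
  also have "\<dots> = (\<Sum>i=1..n. \<Sum>j\<in>{1..n} - {i}. 1)" by (rule sum_offdiag_eq_sum_edges[symmetric])
  also have "\<dots> \<le> (\<Sum>i=1..n. \<Sum>j=1..n. 1)" by (intro sum_mono sum_mono2) auto
  finally show ?thesis by (simp add: power2_eq_square)
qed

lemma Min_Max_edge:
  assumes "e \<in> potential_edges n"
  shows "{Min e, Max e} = e" "{Max e, Min e} = e" "Min e \<in> {1..n}" "Max e \<in> {1..n}" "Min e \<noteq> Max e"
  using assms unfolding potential_edges_eq by (auto simp: min_def max_def)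

section \<open>The local lower bound\<close>

definition slope :: "real \<Rightarrow> real \<Rightarrow> real" where
  "slope p u = ln (u / p) - ln ((1 - u) / (1 - p))"

lemma loglik_affine: "loglik p u x = loglik p u y + slope p u * (x - y)"
  by (simp add: loglik_def slope_def algebra_simps)

text \<open>A crude common bound for \<open>slope\<close> and \<open>loglik\<close> when u lies in
  [\<theta>, 1 - \<theta>]. It grows only logarithmically as \<theta> tends to 0, so its product
  with \<theta> still tends to 0.\<close>

definition slope_bound :: "real \<Rightarrow> real \<Rightarrow> real" where
  "slope_bound p \<theta> = - 2 * ln \<theta> - ln p - ln (1 - p)"

lemma slope_bound:
  assumes p: "0 < p" "p < 1" and \<theta>: "0 < \<theta>" "\<theta> < 1" and u: "\<theta> \<le> u" "u \<le> 1 - \<theta>"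
  shows "0 < slope_bound p \<theta>" "\<bar>slope p u\<bar> \<le> slope_bound p \<theta>"
    "x \<in> {0..1} \<Longrightarrow> \<bar>loglik p u x\<bar> \<le> slope_bound p \<theta>"
proof -
  have n: "ln \<theta> < 0" "ln p < 0" "ln (1 - p) < 0" using p \<theta> by auto
  then show "0 < slope_bound p \<theta>" unfolding slope_bound_def by linarith
  have lu: "ln \<theta> \<le> ln u" "ln u \<le> 0" "ln \<theta> \<le> ln (1 - u)" "ln (1 - u) \<le> 0"
    using u \<theta> by auto
  have u0: "0 < u" "u < 1" using u \<theta> by auto
  have e: "ln (u / p) = ln u - ln p" using u0 p by (simp add: ln_div)
  have e': "ln ((1 - u) / (1 - p)) = ln (1 - u) - ln (1 - p)" using u0 p by (simp add: ln_div)
  show "\<bar>slope p u\<bar> \<le> slope_bound p \<theta>"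
    using n lu unfolding slope_def slope_bound_def e e' by linarith
  assume x: "x \<in> {0..1}"
  have "\<bar>x * a + (1 - x) * b\<bar> \<le> x * c + (1 - x) * c" if "\<bar>a\<bar> \<le> c" "\<bar>b\<bar> \<le> c" for a b c :: real
    using x that by (intro order.trans[OF abs_triangle_ineq] add_mono) (auto simp: abs_mult intro!: mult_left_mono)
  from this[of "ln (u / p)" "slope_bound p \<theta>" "ln ((1 - u) / (1 - p))"]
  have "\<bar>loglik p u x\<bar> \<le> x * slope_bound p \<theta> + (1 - x) * slope_bound p \<theta>"
    unfolding loglik_def using n lu unfolding e e' slope_bound_def by linarith
  then show "\<bar>loglik p u x\<bar> \<le> slope_bound p \<theta>" by (simp add: algebra_simps)
qed

text \<open>Gibbs' inequality a ln (a / b) \<ge> a - b is applied to both outcomes; the two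
  right-hand sides cancel.\<close>

lemma rate_density_nonneg:
  assumes p: "0 < p" "p < 1" and u: "u \<in> {0..1}"
  shows "0 \<le> rate_density p u"
proof -
  have gibbs: "a - b \<le> a * ln (a / b)" if "0 \<le> a" "0 < b" for a b :: real
  proof (cases "a = 0")
    case False
    then have a: "0 < a" using that by simp
    have "ln (b / a) \<le> b / a - 1" using a that by (intro ln_le_minus_one) auto
    then have "a * ln (b / a) \<le> a * (b / a - 1)" using a by (intro mult_left_mono) auto
    moreover have "ln (a / b) = - ln (b / a)" using a that by (simp add: ln_div)
    ultimately show ?thesis using a by (simp add: algebra_simps)
  qed (use that in simp)
  have "u - p \<le> u * ln (u / p)" using p u by (intro gibbs) auto
  moreover have "(1 - u) - (1 - p) \<le> (1 - u) * ln ((1 - u) / (1 - p))" using p u by (intro gibbs) auto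
  ultimately show ?thesis unfolding rate_density_def mult.assoc by linarith
qed

text \<open>The values of a step approximation are contracted towards 1/2 by w \<mapsto> (1 -
  2\<theta>) w + \<theta>, which moves each value by \<theta> |2w - 1| \<le> \<theta>.\<close>

lemma graphon_interior_approx:
  assumes f: "f \<in> graphons" and \<delta>: "0 < \<delta>" and \<theta>: "0 < \<theta>" "\<theta> < 1/2"
  shows "\<forall>\<^sub>F n in sequentially. \<exists>v. sym01 n v \<and> (\<forall>i\<le>n. \<forall>j\<le>n. \<theta> \<le> v i j \<and> v i j \<le> 1 - \<theta>) \<and>
    l1_dist f (step_graphon n v) < \<delta> + \<theta>"
  using graphon_step_approx[OF f \<delta>]
proof (rule eventually_mono)
  fix n assume "\<exists>v. sym01 n v \<and> l1_dist f (step_graphon n v) < \<delta>"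
  then obtain w where w: "sym01 n w" "l1_dist f (step_graphon n w) < \<delta>" by blast
  let ?v = "\<lambda>i j. (1 - 2 * \<theta>) * w i j + \<theta>"
  have b: "\<theta> \<le> ?v i j \<and> ?v i j \<le> 1 - \<theta>" if "i \<le> n" "j \<le> n" for i j
  proof -
    have "(1 - 2 * \<theta>) * w i j \<le> (1 - 2 * \<theta>) * 1" "0 \<le> (1 - 2 * \<theta>) * w i j"
      using \<theta> sym01D[OF w(1) that] by (auto intro!: mult_left_mono)
    then show ?thesis by auto
  qed
  have s: "sym01 n ?v" unfolding sym01_def
  proof (intro allI impI)
    fix i j assume ij: "i \<le> n" "j \<le> n"
    show "0 \<le> ?v i j \<and> ?v i j \<le> 1 \<and> ?v i j = ?v j i"
      using b[OF ij] \<theta> sym01D(3)[OF w(1) ij] by auto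
  qed
  have "l1_dist (step_graphon n w) (step_graphon n ?v) \<le> (LINT z|usq. \<theta>)"
    unfolding l1_dist_def
  proof (rule integral_mono)
    show "integrable usq (\<lambda>z. \<bar>step_graphon n w z - step_graphon n ?v z\<bar>)"
      using integrable_graphon step_graphon_in_graphons w(1) s by auto
    fix z assume "z \<in> space usq"
    then obtain x y where z: "z = (x, y)" "x \<in> {0..1}" "y \<in> {0..1}" by (auto simp: space_usq)
    note b = sym01D[OF w(1) cell_le[OF z(2)] cell_le[OF z(3)]]
    let ?w = "w (cell n x) (cell n y)"
    have "\<bar>?w - ((1 - 2 * \<theta>) * ?w + \<theta>)\<bar> = \<theta> * \<bar>2 * ?w - 1\<bar>"
      using \<theta> by (simp add: abs_mult_pos' algebra_simps)
    also have "\<dots> \<le> \<theta> * 1" using \<theta> b by (intro mult_left_mono) auto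
    finally show "\<bar>step_graphon n w z - step_graphon n ?v z\<bar> \<le> \<theta>"
      by (simp add: z(1) step_graphon_apply[OF z(2,3)])
  qed simp
  also have "\<dots> = \<theta>" using usq.prob_space by simp
  finally have "l1_dist f (step_graphon n ?v) < \<delta> + \<theta>"
    using l1_dist_triangle[OF f step_graphon_in_graphons[OF w(1)] step_graphon_in_graphons[OF s]] w(2) by linarith
  then show "\<exists>v. sym01 n v \<and> (\<forall>i\<le>n. \<forall>j\<le>n. \<theta> \<le> v i j \<and> v i j \<le> 1 - \<theta>) \<and> l1_dist f (step_graphon n v) < \<delta> + \<theta>"
    using s b by blast
qed

text \<open>Up to the diagonal, the discrepancy on a rectangle is a linear combination of edge
  variables. The coefficients are 0, 1 or 2, with 2 when both orientations of the edge lie in the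
  rectangle. On the diagonal only - v remains, because a simple graph has no loops.\<close>

lemma sum_rect_diff_edges:
  fixes v :: "nat \<Rightarrow> nat \<Rightarrow> real"
  assumes E: "E \<subseteq> potential_edges n" and v: "sym01 n v" and A: "A \<subseteq> {1..n}" and B: "B \<subseteq> {1..n}"
  shows "(\<Sum>i\<in>A. \<Sum>j\<in>B. of_bool ({i, j} \<in> E) - v i j) =
     (\<Sum>e\<in>potential_edges n. (of_bool (Min e \<in> A \<and> Max e \<in> B) + of_bool (Max e \<in> A \<and> Min e \<in> B)) *
        (of_bool (e \<in> E) - v (Min e) (Max e))) - (\<Sum>i\<in>A \<inter> B. v i i)"
proof -
  let ?w = "\<lambda>i j. of_bool ({i, j} \<in> E) - v i j"
  let ?c = "\<lambda>i j. of_bool (i \<in> A \<and> j \<in> B) * ?w i j"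
  have "(\<Sum>i\<in>A. \<Sum>j\<in>B. ?w i j) = (\<Sum>i\<in>A. \<Sum>j=1..n. ?c i j)"
    using B by (intro sum.cong refl sum.mono_neutral_cong_left) auto
  also have "\<dots> = (\<Sum>i=1..n. \<Sum>j=1..n. ?c i j)"
    using A by (intro sum.mono_neutral_left) (auto intro!: sum.neutral)
  also have "\<dots> = (\<Sum>i=1..n. ?c i i + (\<Sum>j\<in>{1..n} - {i}. ?c i j))"
    by (intro sum.cong refl sum.remove) auto
  also have "\<dots> = (\<Sum>i=1..n. ?c i i) + (\<Sum>i=1..n. \<Sum>j\<in>{1..n} - {i}. ?c i j)"
    by (rule sum.distrib)
  also have "(\<Sum>i=1..n. ?c i i) = (\<Sum>i=1..n. if i \<in> A \<inter> B then - v i i else 0)"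
  proof (intro sum.cong refl)
    fix i
    have "{i} \<notin> E" using E by (auto simp: potential_edges_def)
    then show "?c i i = (if i \<in> A \<inter> B then - v i i else 0)" by simp
  qed
  also have "\<dots> = - (\<Sum>i\<in>A \<inter> B. v i i)"
  proof -
    have "{1..n} \<inter> (A \<inter> B) = A \<inter> B" using A by auto
    moreover have "(\<Sum>i=1..n. if i \<in> A \<inter> B then - v i i else 0) = (\<Sum>i\<in>{1..n} \<inter> (A \<inter> B). - v i i)"
      by (rule sum.inter_restrict[symmetric]) simp
    ultimately show ?thesis by (simp only: sum_negf)
  qed
  also have "(\<Sum>i=1..n. \<Sum>j\<in>{1..n} - {i}. ?c i j)
      = (\<Sum>e\<in>potential_edges n. ?c (Min e) (Max e) + ?c (Max e) (Min e))"
    by (rule sum_offdiag_eq_sum_edges)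
  also have "\<dots> = (\<Sum>e\<in>potential_edges n. (of_bool (Min e \<in> A \<and> Max e \<in> B) + of_bool (Max e \<in> A \<and> Min e \<in> B)) *
        (of_bool (e \<in> E) - v (Min e) (Max e)))"
  proof (intro sum.cong refl)
    fix e assume e: "e \<in> potential_edges n"
    note m = Min_Max_edge[OF e]
    have "v (Max e) (Min e) = v (Min e) (Max e)" using m(3,4) by (intro sym01D(3)[OF v]) auto
    then show "?c (Min e) (Max e) + ?c (Max e) (Min e) = (of_bool (Min e \<in> A \<and> Max e \<in> B) + of_bool (Max e \<in> A \<and> Min e \<in> B)) *
        (of_bool (e \<in> E) - v (Min e) (Max e))"
      by (simp only: m(1,2) distrib_right)
  qed
  finally show ?thesis by simp
qed

lemma rate_step_eq:
  assumes p: "0 < p" "p < 1" and v: "sym01 n v" and n: "0 < n"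
  shows "(real n)\<^sup>2 * rate p (step_graphon n v) = (\<Sum>i=1..n. \<Sum>j=1..n. rate_density p (v i j))"
  unfolding rate_eq[OF p step_graphon_in_graphons[OF v]]
  by (subst step_integral[OF n, where w = "\<lambda>i j. rate_density p (v i j)"])
    (use n in \<open>auto simp: step_graphon_apply\<close>)

text \<open>The left side is the mean of the log-likelihood ratio under the tilted law. Two cells
  per edge cancel the factor 1/2 of the rate density, and the diagonal cells, present only on the
  right, contribute nonnegative terms.\<close>

lemma sum_edge_loglik_le_rate:
  assumes p: "0 < p" "p < 1" and v: "sym01 n v" and n: "0 < n"
  shows "(\<Sum>e\<in>potential_edges n. loglik p (v (Min e) (Max e)) (v (Min e) (Max e))) \<le> (real n)\<^sup>2 * rate p (step_graphon n v)"
proof -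
  have "(\<Sum>e\<in>potential_edges n. loglik p (v (Min e) (Max e)) (v (Min e) (Max e)))
      = (\<Sum>e\<in>potential_edges n. rate_density p (v (Min e) (Max e)) + rate_density p (v (Max e) (Min e)))"
  proof (intro sum.cong refl)
    fix e assume e: "e \<in> potential_edges n"
    note m = Min_Max_edge[OF e]
    have "v (Max e) (Min e) = v (Min e) (Max e)" using m(3,4) by (intro sym01D(3)[OF v]) auto
    then show "loglik p (v (Min e) (Max e)) (v (Min e) (Max e)) = rate_density p (v (Min e) (Max e)) + rate_density p (v (Max e) (Min e))"
      by (simp add: rate_density_eq_loglik)
  qed
  also have "\<dots> = (\<Sum>i=1..n. \<Sum>j\<in>{1..n} - {i}. rate_density p (v i j))"
    by (rule sum_offdiag_eq_sum_edges[symmetric])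
  also have "\<dots> \<le> (\<Sum>i=1..n. \<Sum>j=1..n. rate_density p (v i j))"
    by (intro sum_mono sum_mono2 rate_density_nonneg[OF p]) (use sym01D[OF v] in auto)
  also have "\<dots> = (real n)\<^sup>2 * rate p (step_graphon n v)" by (rule rate_step_eq[OF p v n, symmetric])
  finally show ?thesis .
qed

definition edges_of :: "nat \<Rightarrow> (nat set \<Rightarrow> bool) \<Rightarrow> nat set set" where
  "edges_of n \<omega> = {e \<in> potential_edges n. \<omega> e}"

lemma prob_random_graph:
  "measure_pmf.prob (random_graph n p) {E. P E} =
    measure_pmf.prob (Pi_pmf (potential_edges n) False (\<lambda>_. bernoulli_pmf p)) {\<omega>. P (edges_of n \<omega>)}"
  by (simp add: random_graph_def edges_of_def vimage_def)

text \<open>The prefactor counts the pairs of vertex sets and the two signs. Of the threshold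
  2\<epsilon>, one half covers the diagonal, which contributes at most n \<le> \<epsilon> n^2, and
  the other half is left for the random edge sum, whose coefficients are bounded by 2.\<close>

lemma cut_deviation_tail:
  fixes v :: "nat \<Rightarrow> nat \<Rightarrow> real"
  assumes v: "sym01 n v" and n: "0 < n" and \<epsilon>: "0 < \<epsilon>" "1 \<le> \<epsilon> * real n"
  shows "measure_pmf.prob (Pi_pmf (potential_edges n) False (\<lambda>e. bernoulli_pmf (v (Min e) (Max e))))
    {\<omega>. 2 * \<epsilon> < cut_dist (step_graphon n v) (graph_graphon n (edges_of n \<omega>))}
    \<le> 2 * 4 ^ n * exp (- (\<epsilon>\<^sup>2 / 2) * (real n)\<^sup>2)"
proof -
  let ?u = "\<lambda>e. v (Min e) (Max e)"
  let ?Q = "Pi_pmf (potential_edges n) False (\<lambda>e. bernoulli_pmf (?u e))"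
  let ?c = "\<lambda>A B e. of_bool (Min e \<in> A \<and> Max e \<in> B) + of_bool (Max e \<in> A \<and> Min e \<in> B) :: real"
  let ?I = "Pow {1..n} \<times> Pow {1..n} \<times> {-1, 1::real}"
  let ?ev = "\<lambda>(A, B, s). {\<omega>. \<epsilon> * (real n)\<^sup>2 \<le> (\<Sum>e\<in>potential_edges n. s * ?c A B e * (of_bool (\<omega> e) - ?u e))}"
  have sub: "{\<omega>. 2 * \<epsilon> < cut_dist (step_graphon n v) (graph_graphon n (edges_of n \<omega>))} \<subseteq> (\<Union>i\<in>?I. ?ev i)"
  proof
    fix \<omega> assume "\<omega> \<in> {\<omega>. 2 * \<epsilon> < cut_dist (step_graphon n v) (graph_graphon n (edges_of n \<omega>))}"
    then have "\<not> cut_dist (graph_graphon n (edges_of n \<omega>)) (step_graphon n v) \<le> 2 * \<epsilon>"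
      by (simp add: cut_dist_commute)
    then have "\<not> (\<forall>A B. A \<subseteq> {1..n} \<longrightarrow> B \<subseteq> {1..n} \<longrightarrow>
      \<bar>\<Sum>i\<in>A. \<Sum>j\<in>B. of_bool ({i, j} \<in> edges_of n \<omega>) - v i j\<bar> \<le> 2 * \<epsilon> * (real n)\<^sup>2)"
    proof (rule contrapos_nn)
      assume "\<forall>A B. A \<subseteq> {1..n} \<longrightarrow> B \<subseteq> {1..n} \<longrightarrow>
        \<bar>\<Sum>i\<in>A. \<Sum>j\<in>B. of_bool ({i, j} \<in> edges_of n \<omega>) - v i j\<bar> \<le> 2 * \<epsilon> * (real n)\<^sup>2"
      then show "cut_dist (graph_graphon n (edges_of n \<omega>)) (step_graphon n v) \<le> 2 * \<epsilon>"
        unfolding graph_graphon_eq_step by (intro cut_dist_step_le[OF n]) simp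
    qed
    then obtain A B where AB: "A \<subseteq> {1..n}" "B \<subseteq> {1..n}"
      "2 * \<epsilon> * (real n)\<^sup>2 < \<bar>\<Sum>i\<in>A. \<Sum>j\<in>B. of_bool ({i, j} \<in> edges_of n \<omega>) - v i j\<bar>"
      unfolding not_all not_imp not_le by blast
    let ?X = "\<Sum>e\<in>potential_edges n. ?c A B e * (of_bool (\<omega> e) - ?u e)"
    have "(\<Sum>i\<in>A. \<Sum>j\<in>B. of_bool ({i, j} \<in> edges_of n \<omega>) - v i j) =
       (\<Sum>e\<in>potential_edges n. ?c A B e * (of_bool (e \<in> edges_of n \<omega>) - ?u e)) - (\<Sum>i\<in>A \<inter> B. v i i)"
      by (rule sum_rect_diff_edges[OF _ v AB(1,2)]) (auto simp: edges_of_def)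
    also have "(\<Sum>e\<in>potential_edges n. ?c A B e * (of_bool (e \<in> edges_of n \<omega>) - ?u e)) = ?X"
      by (intro sum.cong refl) (simp add: edges_of_def)
    finally have eq: "(\<Sum>i\<in>A. \<Sum>j\<in>B. of_bool ({i, j} \<in> edges_of n \<omega>) - v i j) = ?X - (\<Sum>i\<in>A \<inter> B. v i i)" .
    have "\<bar>\<Sum>i\<in>A \<inter> B. v i i\<bar> \<le> (\<Sum>i\<in>A \<inter> B. 1)"
      using sym01D(1,2)[OF v] AB by (intro order.trans[OF sum_abs] sum_mono) (auto simp: abs_le_iff subset_iff intro: order.trans[of _ 0])
    also have "\<dots> \<le> real n" using card_mono[of "{1..n}" "A \<inter> B"] AB by auto
    also have "\<dots> \<le> \<epsilon> * (real n)\<^sup>2" using mult_right_mono[OF \<epsilon>(2), of "real n"] by (simp add: power2_eq_square mult.assoc)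
    finally have "\<bar>\<Sum>i\<in>A \<inter> B. v i i\<bar> \<le> \<epsilon> * (real n)\<^sup>2" .
    then have "\<epsilon> * (real n)\<^sup>2 \<le> \<bar>?X\<bar>" using AB(3) unfolding eq by linarith
    then have "\<epsilon> * (real n)\<^sup>2 \<le> ?X \<or> \<epsilon> * (real n)\<^sup>2 \<le> - ?X" by linarith
    moreover have scale: "(\<Sum>e\<in>potential_edges n. s * ?c A B e * (of_bool (\<omega> e) - ?u e)) = s * ?X" for s
      by (simp only: sum_distrib_left mult.assoc)
    ultimately have "\<omega> \<in> ?ev (A, B, 1) \<or> \<omega> \<in> ?ev (A, B, -1)"
      unfolding mem_Collect_eq prod.case scale by simp
    then show "\<omega> \<in> (\<Union>i\<in>?I. ?ev i)" using AB by blast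
  qed
  have "measure_pmf.prob ?Q {\<omega>. 2 * \<epsilon> < cut_dist (step_graphon n v) (graph_graphon n (edges_of n \<omega>))}
      \<le> measure_pmf.prob ?Q (\<Union>i\<in>?I. ?ev i)" by (rule measure_pmf.finite_measure_mono[OF sub]) simp
  also have "\<dots> \<le> (\<Sum>i\<in>?I. measure_pmf.prob ?Q (?ev i))"
    by (rule measure_pmf.finite_measure_subadditive_finite) auto
  also have "\<dots> \<le> (\<Sum>i\<in>?I. exp (- (2 * \<epsilon>\<^sup>2 / 2\<^sup>2) * (real n)\<^sup>2))"
  proof (rule sum_mono)
    fix i assume "i \<in> ?I"
    then obtain A B s where i: "i = (A, B, s)" "s = -1 \<or> s = 1" by auto
    have u: "0 \<le> ?u e \<and> ?u e \<le> 1" if "e \<in> potential_edges n" for e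
      using Min_Max_edge(3,4)[OF that] sym01D(1,2)[OF v] by auto
    have c: "\<bar>s * ?c A B e\<bar> \<le> 2" for e using i(2) by auto
    show "measure_pmf.prob ?Q (?ev i) \<le> exp (- (2 * \<epsilon>\<^sup>2 / 2\<^sup>2) * (real n)\<^sup>2)"
      unfolding i prod.case
      by (rule bernoulli_linear_tail[OF finite_potential_edges u c card_potential_edges_le _ \<epsilon>(1)]) auto
  qed
  also have "\<dots> = 2 * 4 ^ n * exp (- (\<epsilon>\<^sup>2 / 2) * (real n)\<^sup>2)"
    by (simp add: card_cartesian_product card_Pow power_mult_distrib[symmetric])
  finally show ?thesis .
qed

lemma local_lower_bound:
  assumes p: "0 < p" "p < 1" and h: "h \<in> graphons" and \<eta>: "0 < \<eta>" and \<epsilon>: "0 < \<epsilon>"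
  shows "\<forall>\<^sub>F n in sequentially. exp (- (real n)\<^sup>2 * (rate p h + \<eta>))
    \<le> measure_pmf.prob (random_graph n p) {E. cut_dist h (graph_graphon n E) < \<epsilon>}"
proof -
  obtain C where C: "0 < C" "\<And>f g. f \<in> graphons \<Longrightarrow> g \<in> graphons \<Longrightarrow> rate p f \<le> rate p g + \<eta> / 4 + C * l1_dist f g"
    using rate_l1_continuous[OF p, of "\<eta> / 4"] \<eta> by auto
  \<comment> \<open>The L1 error will be below 2\<theta>. It must be at most \<epsilon> / 2 for the
    cut distance, and C times it at most \<eta> / 4 for the rate.\<close>
  define \<theta> where "\<theta> = min (1/4) (min (\<epsilon> / 4) (\<eta> / (8 * C)))"
  have \<theta>: "0 < \<theta>" "\<theta> < 1/2" "2 * \<theta> \<le> \<epsilon> / 2" using \<epsilon> \<eta> C(1) by (auto simp: \<theta>_def)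
  have C\<theta>: "C * (2 * \<theta>) \<le> \<eta> / 4"
  proof -
    have "C * \<theta> \<le> C * (\<eta> / (8 * C))" using C(1) by (intro mult_left_mono) (auto simp: \<theta>_def)
    then show ?thesis using C(1) by simp
  qed
  let ?K = "slope_bound p \<theta>"
  have K: "0 < ?K" using slope_bound(1)[OF p \<theta>(1), of \<theta>] \<theta>(2) by simp
  define a where "a = 2 * (\<eta> / 8)\<^sup>2 / ?K\<^sup>2"
  have a: "0 < a" using K \<eta> by (simp add: a_def)
  have e0: "0 < (\<epsilon> / 8)\<^sup>2 / 2" and e8: "0 < \<epsilon> / 8" using \<epsilon> by auto
  have ev1: "\<forall>\<^sub>F n in sequentially. exp (- a * (real n)\<^sup>2) < 1/4" using a by real_asymp
  have ev2: "\<forall>\<^sub>F n in sequentially. 2 * 4 ^ n * exp (- b * (real n)\<^sup>2) < 1/4" if "0 < b" for b :: real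
    using that by real_asymp
  have ev3: "\<forall>\<^sub>F n in sequentially. 1 \<le> b * real n" if "0 < b" for b :: real using that by real_asymp
  have ev4: "\<forall>\<^sub>F n in sequentially. exp (- (\<eta> / 8) * (real n)\<^sup>2) < 1/2" using \<eta> by real_asymp
  \<comment> \<open>The step approximation uses the grid of the n vertices itself, so its values
    serve directly as edge probabilities.\<close>
  show ?thesis
    using graphon_interior_approx[OF h \<theta>(1) \<theta>(1,2)] ev1 ev2[OF e0] ev3[OF e8] ev4 eventually_gt_at_top[of 0]
  proof eventually_elim
    case (elim n)
    then obtain v where v: "sym01 n v" "\<And>i j. i \<le> n \<Longrightarrow> j \<le> n \<Longrightarrow> \<theta> \<le> v i j \<and> v i j \<le> 1 - \<theta>"
      "l1_dist h (step_graphon n v) < \<theta> + \<theta>" by blast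
    have n: "0 < n" using elim by simp
    let ?I = "potential_edges n"
    let ?u = "\<lambda>e. v (Min e) (Max e)"
    let ?Q = "Pi_pmf ?I False (\<lambda>e. bernoulli_pmf (?u e))" and ?P = "Pi_pmf ?I False (\<lambda>_. bernoulli_pmf p)"
    let ?g = "step_graphon n v"
    note g = step_graphon_in_graphons[OF v(1)]
    have u: "\<theta> \<le> ?u e" "?u e \<le> 1 - \<theta>" if "e \<in> ?I" for e
      using Min_Max_edge(3,4)[OF that] v(2) by auto
    have u01: "0 < ?u e \<and> ?u e < 1" if "e \<in> ?I" for e using u[OF that] \<theta> by auto
    let ?t = "(real n)\<^sup>2 * (rate p ?g + \<eta> / 8)"
    let ?B = "{\<omega>. cut_dist h (graph_graphon n (edges_of n \<omega>)) < \<epsilon>}"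
    let ?D = "{\<omega>. (\<Sum>e\<in>?I. loglik p (?u e) (of_bool (\<omega> e))) \<le> ?t}"
    have "measure_pmf.prob ?Q (UNIV - ?B) \<le> measure_pmf.prob ?Q {\<omega>. 2 * (\<epsilon> / 8) < cut_dist ?g (graph_graphon n (edges_of n \<omega>))}"
    proof (rule measure_pmf.finite_measure_mono)
      show "UNIV - ?B \<subseteq> {\<omega>. 2 * (\<epsilon> / 8) < cut_dist ?g (graph_graphon n (edges_of n \<omega>))}"
      proof
        fix \<omega> assume "\<omega> \<in> UNIV - ?B"
        then have "\<epsilon> \<le> cut_dist h (graph_graphon n (edges_of n \<omega>))" by (simp add: not_less)
        also have "\<dots> \<le> cut_dist h ?g + cut_dist ?g (graph_graphon n (edges_of n \<omega>))"
          by (intro cut_dist_triangle h g graph_graphon_in_graphons)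
        also have "cut_dist h ?g \<le> l1_dist h ?g" by (rule cut_dist_le_l1_dist[OF h g])
        finally show "\<omega> \<in> {\<omega>. 2 * (\<epsilon> / 8) < cut_dist ?g (graph_graphon n (edges_of n \<omega>))}"
          using v(3) \<theta>(3) \<epsilon> by simp
      qed
    qed simp
    also have "\<dots> \<le> 2 * 4 ^ n * exp (- ((\<epsilon> / 8)\<^sup>2 / 2) * (real n)\<^sup>2)"
      by (rule cut_deviation_tail[OF v(1) n]) (use \<epsilon> elim in auto)
    finally have QB: "measure_pmf.prob ?Q (UNIV - ?B) \<le> 1/4" using elim by linarith
    have "measure_pmf.prob ?Q (UNIV - ?D)
        \<le> measure_pmf.prob ?Q {\<omega>. \<eta> / 8 * (real n)\<^sup>2 \<le> (\<Sum>e\<in>?I. slope p (?u e) * (of_bool (\<omega> e) - ?u e))}"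
    proof (rule measure_pmf.finite_measure_mono)
      show "UNIV - ?D \<subseteq> {\<omega>. \<eta> / 8 * (real n)\<^sup>2 \<le> (\<Sum>e\<in>?I. slope p (?u e) * (of_bool (\<omega> e) - ?u e))}"
      proof
        fix \<omega> assume "\<omega> \<in> UNIV - ?D"
        then have "?t < (\<Sum>e\<in>?I. loglik p (?u e) (of_bool (\<omega> e)))" by (simp add: not_le)
        also have "\<dots> = (\<Sum>e\<in>?I. loglik p (?u e) (?u e) + slope p (?u e) * (of_bool (\<omega> e) - ?u e))"
          by (intro sum.cong refl loglik_affine)
        also have "\<dots> = (\<Sum>e\<in>?I. loglik p (?u e) (?u e)) + (\<Sum>e\<in>?I. slope p (?u e) * (of_bool (\<omega> e) - ?u e))"
          by (rule sum.distrib)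
        finally show "\<omega> \<in> {\<omega>. \<eta> / 8 * (real n)\<^sup>2 \<le> (\<Sum>e\<in>?I. slope p (?u e) * (of_bool (\<omega> e) - ?u e))}"
          using sum_edge_loglik_le_rate[OF p v(1) n] unfolding mem_Collect_eq by (simp add: distrib_left mult.commute)
      qed
    qed simp
    also have "\<dots> \<le> exp (- (2 * (\<eta> / 8)\<^sup>2 / ?K\<^sup>2) * (real n)\<^sup>2)"
      by (rule bernoulli_linear_tail[OF finite_potential_edges _ _ card_potential_edges_le K])
        (use u01 less_imp_le \<eta> slope_bound(2)[OF p \<theta>(1) _ u] \<theta>(2) in \<open>force+\<close>)
    finally have QD: "measure_pmf.prob ?Q (UNIV - ?D) \<le> 1/4" using elim unfolding a_def by linarith
    have "measure_pmf.prob ?Q (UNIV - ?B \<inter> ?D) \<le> measure_pmf.prob ?Q (UNIV - ?B) + measure_pmf.prob ?Q (UNIV - ?D)"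
      unfolding Diff_Int by (rule measure_Un_le) auto
    then have half: "1/2 \<le> measure_pmf.prob ?Q (?B \<inter> ?D)"
      using QB QD measure_pmf.prob_compl[of "?B \<inter> ?D" ?Q] by (simp add: Compl_eq_Diff_UNIV)
    have rg: "rate p ?g \<le> rate p h + \<eta> / 2"
    proof -
      have "rate p ?g \<le> rate p h + \<eta> / 4 + C * l1_dist ?g h" by (rule C(2)[OF g h])
      also have "C * l1_dist ?g h \<le> C * (2 * \<theta>)"
        using v(3) C(1) by (intro mult_left_mono) (auto simp: l1_dist_commute)
      finally show ?thesis using C\<theta> by linarith
    qed
    \<comment> \<open>The approximation of h costs \<eta> / 2 in the rate and the fluctuation of the
      likelihood \<eta> / 8; a further \<eta> / 8 absorbs the probability 1/2 of the good
      event.\<close>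
    have "exp (- (real n)\<^sup>2 * (rate p h + \<eta>)) \<le> exp (- ?t + - (\<eta> / 8) * (real n)\<^sup>2)"
    proof -
      have "(real n)\<^sup>2 * (rate p ?g + \<eta> / 8 + \<eta> / 8) \<le> (real n)\<^sup>2 * (rate p h + \<eta>)"
        using rg \<eta> by (intro mult_left_mono) auto
      then show ?thesis by (simp add: algebra_simps)
    qed
    also have "\<dots> = exp (- ?t) * exp (- (\<eta> / 8) * (real n)\<^sup>2)" by (rule exp_add)
    also have "\<dots> \<le> exp (- ?t) * measure_pmf.prob ?Q (?B \<inter> ?D)"
      using half elim by (intro mult_left_mono) auto
    also have "\<dots> \<le> measure_pmf.prob ?P ?B"
      by (rule loglik_change_of_measure[OF finite_potential_edges p u01])
    finally show ?case by (simp only: prob_random_graph)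
  qed
qed

section \<open>The local upper bound\<close>

text \<open>
  The double sum omits the diagonal, so it is affine in each row of \<open>X\<close> and is maximized over products
  of simplices at a vertex.
\<close>

lemma multiaffine_rounding:
  fixes X :: "nat \<Rightarrow> 'k \<Rightarrow> real" and c :: "nat \<Rightarrow> nat \<Rightarrow> 'k \<Rightarrow> 'k \<Rightarrow> real"
  assumes I: "finite I" and K: "finite K"
    and X: "\<And>i k. i \<in> I \<Longrightarrow> k \<in> K \<Longrightarrow> 0 \<le> X i k" "\<And>i. i \<in> I \<Longrightarrow> (\<Sum>k\<in>K. X i k) = 1"
  obtains \<phi> where "\<phi> \<in> I \<rightarrow>\<^sub>E K"
    "(\<Sum>i\<in>I. \<Sum>j\<in>I - {i}. \<Sum>k\<in>K. \<Sum>l\<in>K. X i k * X j l * c i j k l)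
      \<le> (\<Sum>i\<in>I. \<Sum>j\<in>I - {i}. c i j (\<phi> i) (\<phi> j))"
proof -
  define T where "T Y i j = (\<Sum>k\<in>K. \<Sum>l\<in>K. Y i k * Y j l * c i j k l)" for Y i j
  define \<Phi> where "\<Phi> Y = (\<Sum>i\<in>I. \<Sum>j\<in>I - {i}. T Y i j)" for Y
  define W where "W Y \<longleftrightarrow> (\<forall>i\<in>I. (\<forall>k\<in>K. 0 \<le> Y i k) \<and> (\<Sum>k\<in>K. Y i k) = 1)" for Y :: "nat \<Rightarrow> 'k \<Rightarrow> real"
  define e where "e k = (\<lambda>k'. if k' = k then 1 else 0 :: real)" for k :: 'k
  have e_sum: "(\<Sum>k'\<in>K. e k k' * f k') = f k" if "k \<in> K" for k f
  proof -
    have "(\<Sum>k'\<in>K. e k k' * f k') = (\<Sum>k'\<in>K. if k' = k then f k' else 0)"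
      by (intro sum.cong) (auto simp: e_def)
    then show ?thesis using that K by simp
  qed
  \<comment> \<open>For i \<noteq> j the row s occurs at most once in the product, so the term is
    linear in it. In the third case the row is absent, and the identity holds because the row sums
    to 1.\<close>
  have T_split: "T Y i j = (\<Sum>k\<in>K. Y s k * T (Y(s := e k)) i j)"
    if Y: "W Y" and s: "s \<in> I" and ij: "i \<noteq> j" for Y s i j
  proof -
    consider "i = s" "j \<noteq> s" | "j = s" "i \<noteq> s" | "i \<noteq> s" "j \<noteq> s" using ij by blast
    then show ?thesis
    proof cases
      case 1
      have "T (Y(s := e k)) i j = (\<Sum>l\<in>K. Y j l * c i j k l)" if "k \<in> K" for k
        using 1 e_sum[OF that, of "\<lambda>k'. \<Sum>l\<in>K. Y j l * c i j k' l"]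
        by (simp add: T_def sum_distrib_left mult.assoc)
      then show ?thesis using 1 by (simp add: T_def sum_distrib_left mult.assoc)
    next
      case 2
      have "T (Y(s := e l)) i j = (\<Sum>k\<in>K. Y i k * c i j k l)" if "l \<in> K" for l
        using 2 e_sum[OF that, of "\<lambda>l'. \<Sum>k\<in>K. Y i k * c i j k l'"]
        unfolding T_def by (subst sum.swap) (simp add: sum_distrib_left mult_ac)
      then have "(\<Sum>l\<in>K. Y s l * T (Y(s := e l)) i j) = (\<Sum>l\<in>K. \<Sum>k\<in>K. Y i k * Y j l * c i j k l)"
        using 2 by (simp add: sum_distrib_left mult_ac)
      also have "\<dots> = T Y i j" unfolding T_def by (rule sum.swap)
      finally show ?thesis by simp
    next
      case 3
      then have "T (Y(s := e k)) i j = T Y i j" for k by (simp add: T_def)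
      then show ?thesis using Y s by (simp add: W_def sum_distrib_right[symmetric])
    qed
  qed
  \<comment> \<open>The value at Y is the convex combination, with weights \<open>Y s k\<close>, of
    the values after replacing row s by a unit vector; hence one of these is at least as
    large.\<close>
  have step: "\<exists>k\<in>K. \<Phi> Y \<le> \<Phi> (Y(s := e k))" if Y: "W Y" and s: "s \<in> I" for Y s
  proof (rule ccontr)
    assume "\<not> ?thesis"
    then have less: "\<Phi> (Y(s := e k)) < \<Phi> Y" if "k \<in> K" for k using that by (auto simp: not_le)
    have "\<Phi> Y = (\<Sum>i\<in>I. \<Sum>j\<in>I - {i}. \<Sum>k\<in>K. Y s k * T (Y(s := e k)) i j)"
      unfolding \<Phi>_def by (intro sum.cong refl T_split[OF Y s]) auto
    also have "\<dots> = (\<Sum>i\<in>I. \<Sum>k\<in>K. \<Sum>j\<in>I - {i}. Y s k * T (Y(s := e k)) i j)"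
      by (intro sum.cong refl sum.swap)
    also have "\<dots> = (\<Sum>k\<in>K. Y s k * \<Phi> (Y(s := e k)))"
      unfolding \<Phi>_def by (subst sum.swap) (simp add: sum_distrib_left)
    also have "\<dots> < (\<Sum>k\<in>K. Y s k * \<Phi> Y)"
    proof (rule sum_strict_mono_ex1[OF K])
      show "\<forall>k\<in>K. Y s k * \<Phi> (Y(s := e k)) \<le> Y s k * \<Phi> Y"
        using Y s less by (auto simp: W_def less_imp_le intro!: mult_left_mono)
      have "\<exists>k\<in>K. 0 < Y s k"
      proof (rule ccontr)
        assume "\<not> ?thesis"
        then have "(\<Sum>k\<in>K. Y s k) \<le> 0" by (intro sum_nonpos) (auto simp: not_less)
        then show False using Y s by (simp add: W_def)
      qed
      then show "\<exists>k\<in>K. Y s k * \<Phi> (Y(s := e k)) < Y s k * \<Phi> Y"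
        using mult_strict_left_mono[OF less] by blast
    qed
    also have "\<dots> = \<Phi> Y" using Y s by (simp add: W_def sum_distrib_right[symmetric])
    finally show False by simp
  qed
  have We: "W (Y(s := e k))" if "W Y" "k \<in> K" for Y s k
    using that K by (auto simp: W_def e_def)
  have WX: "W X" using X by (auto simp: W_def)
  have "\<exists>Y \<phi>. W Y \<and> (\<forall>i\<in>J. \<phi> i \<in> K \<and> Y i = e (\<phi> i)) \<and> \<Phi> X \<le> \<Phi> Y" if "finite J" "J \<subseteq> I" for J
    using that
  proof (induction J rule: finite_induct)
    case empty
    show ?case using WX by (intro exI[of _ X] exI[of _ undefined]) auto
  next
    case (insert s J)
    then obtain Y \<phi> where Y: "W Y" "\<forall>i\<in>J. \<phi> i \<in> K \<and> Y i = e (\<phi> i)" "\<Phi> X \<le> \<Phi> Y" by auto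
    obtain k where k: "k \<in> K" "\<Phi> Y \<le> \<Phi> (Y(s := e k))" using step[OF Y(1)] insert.prems by auto
    have "W (Y(s := e k))" "\<Phi> X \<le> \<Phi> (Y(s := e k))" using We Y k by auto
    moreover have "\<forall>i\<in>insert s J. (\<phi>(s := k)) i \<in> K \<and> (Y(s := e k)) i = e ((\<phi>(s := k)) i)"
      using Y(2) k(1) by simp
    ultimately show ?case by blast
  qed
  from this[OF I order.refl] obtain Y \<phi> where Y: "\<forall>i\<in>I. \<phi> i \<in> K \<and> Y i = e (\<phi> i)" "\<Phi> X \<le> \<Phi> Y" by blast
  have "T Y i j = c i j (\<phi> i) (\<phi> j)" if "i \<in> I" "j \<in> I" for i j
  proof -
    have "T Y i j = (\<Sum>k\<in>K. e (\<phi> i) k * (\<Sum>l\<in>K. e (\<phi> j) l * c i j k l))"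
      using Y(1) that by (simp add: T_def sum_distrib_left mult.assoc)
    then show ?thesis using Y(1) that by (simp add: e_sum)
  qed
  then have \<Phi>Y: "\<Phi> Y = (\<Sum>i\<in>I. \<Sum>j\<in>I - {i}. c i j (\<phi> i) (\<phi> j))"
    unfolding \<Phi>_def by (intro sum.cong refl) auto
  then have "\<Phi> Y = (\<Sum>i\<in>I. \<Sum>j\<in>I - {i}. c i j (restrict \<phi> I i) (restrict \<phi> I j))"
  proof -
    have "(\<Sum>i\<in>I. \<Sum>j\<in>I - {i}. c i j (\<phi> i) (\<phi> j)) = (\<Sum>i\<in>I. \<Sum>j\<in>I - {i}. c i j (restrict \<phi> I i) (restrict \<phi> I j))"
      by (intro sum.cong refl) auto
    then show ?thesis using \<Phi>Y by simp
  qed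
  then show ?thesis using that[of "restrict \<phi> I"] Y by (auto simp: \<Phi>_def T_def)
qed

section \<open>Step functions integrated against graphons and rearranged graphs\<close>

lemma measure_mp_preimage:
  assumes s: "\<sigma> \<in> mp_bijections" and A: "A \<in> sets unit_interval_measure"
  shows "{x \<in> {0..1}. \<sigma> x \<in> A} \<in> sets unit_interval_measure"
    "measure lborel {x \<in> {0..1}. \<sigma> x \<in> A} = measure lborel A"
proof -
  note D = mp_bijectionsD[OF s]
  have eq: "{x \<in> {0..1}. \<sigma> x \<in> A} = \<sigma> -` A \<inter> space unit_interval_measure" by auto
  show m: "{x \<in> {0..1}. \<sigma> x \<in> A} \<in> sets unit_interval_measure"
    unfolding eq using D(2) A by (rule measurable_sets)
  have "measure unit_interval_measure A = measure (distr unit_interval_measure unit_interval_measure \<sigma>) A"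
    using D(4) by simp
  also have "\<dots> = measure unit_interval_measure {x \<in> {0..1}. \<sigma> x \<in> A}"
    unfolding eq using D(2) A by (rule measure_distr)
  finally show "measure lborel {x \<in> {0..1}. \<sigma> x \<in> A} = measure lborel A"
    using A m by (simp add: measure_restrict_space sets_unit_interval_measure)
qed

text \<open>The test function is a combination of (M + 1)^2 indicators of rectangles, and the
  integral of h - F over each rectangle is bounded by the cut distance.\<close>

lemma step_test_difference:
  assumes h: "h \<in> graphons" and F: "F \<in> graphons" and a: "\<And>k l. k \<le> M \<Longrightarrow> l \<le> M \<Longrightarrow> \<bar>a k l\<bar> \<le> K" and K: "0 \<le> K"
  shows "\<bar>LINT z|usq. a (cell M (fst z)) (cell M (snd z)) * (h z - F z)\<bar> \<le> (real M + 1)\<^sup>2 * K * cut_dist h F"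
proof -
  let ?R = "\<lambda>k l. cell_set M k \<times> cell_set M l"
  let ?d = "\<lambda>k l. LINT z:?R k l|lborel. h z - F z"
  have ci: "set_integrable lborel (?R k l) (\<lambda>z. h z - F z)" for k l
    using graphon_integrable[OF h cell_set_sets cell_set_sets] graphon_integrable[OF F cell_set_sets cell_set_sets] by auto
  have "indicator unit_square z *\<^sub>R (a (cell M (fst z)) (cell M (snd z)) * (h z - F z))
      = (\<Sum>k\<le>M. \<Sum>l\<le>M. a k l * (indicator (?R k l) z *\<^sub>R (h z - F z)))" for z
  proof (cases "z \<in> unit_square")
    case True
    then obtain x y where z: "z = (x, y)" "x \<in> {0..1}" "y \<in> {0..1}" by auto
    have "(\<Sum>k\<le>M. \<Sum>l\<le>M. a k l * (indicator (?R k l) z *\<^sub>R (h z - F z)))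
        = (\<Sum>k\<le>M. \<Sum>l\<le>M. if cell M x = k then if cell M y = l then a k l * (h z - F z) else 0 else 0)"
      using z by (intro sum.cong) (auto simp: indicator_def cell_set_def)
    also have "\<dots> = (\<Sum>k\<le>M. if cell M x = k then (\<Sum>l\<le>M. if cell M y = l then a k l * (h z - F z) else 0) else 0)"
      by (rule sum.cong) auto
    also have "\<dots> = a (cell M x) (cell M y) * (h z - F z)"
      using cell_le[OF z(2)] cell_le[OF z(3)] by simp
    finally show ?thesis using True z by simp
  next
    case False
    then have "z \<notin> ?R k l" for k l by (auto simp: cell_set_def)
    then show ?thesis using False by simp
  qed
  then have "(LINT z|usq. a (cell M (fst z)) (cell M (snd z)) * (h z - F z))
      = (LINT z|lborel. (\<Sum>k\<le>M. \<Sum>l\<le>M. a k l * (indicator (?R k l) z *\<^sub>R (h z - F z))))"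
    by (subst integral_restrict_space) (auto simp: unit_square_sets)
  also have "\<dots> = (\<Sum>k\<le>M. \<Sum>l\<le>M. a k l * ?d k l)"
    using ci unfolding set_integrable_def set_lebesgue_integral_def
    by (subst Bochner_Integration.integral_sum Bochner_Integration.integrable_sum; (intro Bochner_Integration.integrable_sum integrable_mult_right)?; simp)+
  finally have eq: "(LINT z|usq. a (cell M (fst z)) (cell M (snd z)) * (h z - F z)) = (\<Sum>k\<le>M. \<Sum>l\<le>M. a k l * ?d k l)" .
  have "\<bar>\<Sum>k\<le>M. \<Sum>l\<le>M. a k l * ?d k l\<bar> \<le> (\<Sum>k\<le>M. \<bar>\<Sum>l\<le>M. a k l * ?d k l\<bar>)" by (rule sum_abs)
  also have "\<dots> \<le> (\<Sum>k\<le>M. \<Sum>l\<le>M. \<bar>a k l * ?d k l\<bar>)" by (intro sum_mono sum_abs)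
  also have "\<dots> \<le> (\<Sum>k\<le>M. \<Sum>l\<le>M. K * cut_dist h F)"
    unfolding abs_mult by (intro sum_mono mult_mono a cut_dist_upper h F cell_set_sets K) auto
  also have "\<dots> = (real M + 1)\<^sup>2 * K * cut_dist h F" by (simp add: power2_eq_square algebra_simps)
  finally show ?thesis using eq by simp
qed

text \<open>The integral sees \<sigma> only through the shares \<open>X i k\<close> of vertex i in
  step k. Each vertex has total share 1 because \<sigma> preserves measure and a cell has length
  1/n.\<close>

lemma rearranged_step_integral:
  fixes M n :: nat
  assumes s: "\<sigma> \<in> mp_bijections" and n: "0 < n"
  defines "X \<equiv> \<lambda>i k. real n * measure lborel {x \<in> {0..1}. cell M x = k \<and> cell n (\<sigma> x) = i}"
  shows "(real n)\<^sup>2 * (LINT z|usq. w (cell M (fst z)) (cell M (snd z)) (cell n (\<sigma> (fst z))) (cell n (\<sigma> (snd z))))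
      = (\<Sum>i=1..n. \<Sum>j=1..n. \<Sum>k\<le>M. \<Sum>l\<le>M. X i k * X j l * w k l i j)"
    and "0 \<le> X i k" and "i \<in> {1..n} \<Longrightarrow> (\<Sum>k\<le>M. X i k) = 1"
proof -
  let ?m = "\<lambda>k i. measure lborel {x \<in> {0..1}. cell M x = k \<and> cell n (\<sigma> x) = i}"
  note D = mp_bijectionsD[OF s]
  have pre: "{x \<in> {0..1}. cell n (\<sigma> x) = i} = {x \<in> {0..1}. \<sigma> x \<in> cell_set n i}" for i
    using D(5) by (auto simp: cell_set_def)
  have preS: "{x \<in> {0..1}. cell n (\<sigma> x) = i} \<in> sets unit_interval_measure" for i
    unfolding pre by (rule measure_mp_preimage(1)[OF s cell_set_sets])
  have cS: "{x \<in> {0..1}. cell M x = k \<and> cell n (\<sigma> x) = i} \<in> sets borel" for k i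
  proof -
    have "{x \<in> {0..1}. cell M x = k \<and> cell n (\<sigma> x) = i} = {x \<in> {x \<in> {0..1}. cell n (\<sigma> x) = i}. cell M x = k}" by auto
    then show ?thesis using Collect_cell_sets[OF preS[of i], of M k] by (simp add: sets_unit_interval_measure)
  qed
  have fin: "emeasure lborel A \<noteq> \<infinity>" if "A \<subseteq> {0..1::real}" for A
    using emeasure_mono[OF that, of lborel] by (auto simp: top_unique)
  have sumk: "(\<Sum>k\<le>M. ?m k i) = measure lborel (cell_set n i)" for i
  proof -
    have "(\<Sum>k\<le>M. ?m k i) = measure lborel (\<Union>k\<in>{..M}. {x \<in> {0..1}. cell M x = k \<and> cell n (\<sigma> x) = i})"
    proof (rule measure_finite_Union[symmetric])
      show "emeasure lborel {x \<in> {0..1}. cell M x = k \<and> cell n (\<sigma> x) = i} \<noteq> \<infinity>" for k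
        by (rule fin) auto
    qed (use cS in \<open>auto simp: disjoint_family_on_def\<close>)
    also have "(\<Union>k\<in>{..M}. {x \<in> {0..1}. cell M x = k \<and> cell n (\<sigma> x) = i}) = {x \<in> {0..1}. cell n (\<sigma> x) = i}"
      using cell_le by auto
    also have "measure lborel \<dots> = measure lborel (cell_set n i)"
      unfolding pre by (rule measure_mp_preimage(2)[OF s cell_set_sets])
    finally show ?thesis .
  qed
  show "0 \<le> X i k" by (simp add: X_def)
  show "(\<Sum>k\<le>M. X i k) = 1" if "i \<in> {1..n}"
    using sumk[of i] measure_cell_set[OF that] n by (simp add: X_def sum_distrib_left[symmetric])
  have m0: "?m k 0 = 0" if "k \<le> M" for k
  proof -
    have "(\<Sum>k\<le>M. ?m k 0) = 0" using sumk[of 0] measure_cell_set_0[OF n] by simp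
    then show ?thesis using that by (simp add: sum_nonneg_eq_0_iff)
  qed
  let ?\<alpha> = "\<lambda>x. (cell M x, cell n (\<sigma> x))"
  let ?w = "\<lambda>(k, i) (l, j). w k l i j"
  let ?f = "\<lambda>z. w (cell M (fst z)) (cell M (snd z)) (cell n (\<sigma> (fst z))) (cell n (\<sigma> (snd z)))"
  have "(LINT z|usq. ?f z) = (LINT z:{0..1} \<times> {0..1}|lborel. ?f z)"
    by (simp add: set_lebesgue_integral_def integral_restrict_space unit_square_sets)
  also have "\<dots> = (\<Sum>a\<in>{..M} \<times> {..n}. \<Sum>b\<in>{..M} \<times> {..n}.
       ?w a b * (measure lborel {x \<in> {0..1}. ?\<alpha> x = a} * measure lborel {y \<in> {0..1}. ?\<alpha> y = b}))"
  proof (rule integral_cells(2))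
    show "?\<alpha> x \<in> {..M} \<times> {..n}" if "x \<in> {0..1}" for x
      using cell_le[OF that] cell_le[OF D(5)[OF that]] by simp
    then show "?\<alpha> x \<in> {..M} \<times> {..n}" if "x \<in> {0..1}" for x using that by simp
    show "{x \<in> {0..1}. ?\<alpha> x = a} \<in> sets borel" for a
      using cS[of "fst a" "snd a"] by (simp add: prod_eq_iff)
    then show "{x \<in> {0..1}. ?\<alpha> x = a} \<in> sets borel" for a .
  qed auto
  also have "\<dots> = (\<Sum>k\<le>M. \<Sum>i\<le>n. \<Sum>l\<le>M. \<Sum>j\<le>n. w k l i j * (?m k i * ?m l j))"
  proof -
    have cart: "(\<Sum>a\<in>{..M} \<times> {..n}. F a) = (\<Sum>k\<le>M. \<Sum>i\<le>n. F (k, i))" for F :: "nat \<times> nat \<Rightarrow> real"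
      by (simp add: sum.cartesian_product)
    show ?thesis by (simp only: cart prod.case prod.inject)
  qed
  also have "\<dots> = (\<Sum>k\<le>M. \<Sum>i=1..n. \<Sum>l\<le>M. \<Sum>j=1..n. w k l i j * (?m k i * ?m l j))"
  proof (rule sum.cong[OF refl])
    fix k assume k: "k \<in> {..M}"
    have "(\<Sum>i\<le>n. \<Sum>l\<le>M. \<Sum>j\<le>n. w k l i j * (?m k i * ?m l j))
        = (\<Sum>i\<le>n. \<Sum>l\<le>M. \<Sum>j=1..n. w k l i j * (?m k i * ?m l j))"
      by (rule sum.cong[OF refl], rule sum.cong[OF refl], rule sum_drop_0) (use m0 in simp)
    also have "\<dots> = (\<Sum>i=1..n. \<Sum>l\<le>M. \<Sum>j=1..n. w k l i j * (?m k i * ?m l j))"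
      by (rule sum_drop_0) (use k m0 in simp)
    finally show "(\<Sum>i\<le>n. \<Sum>l\<le>M. \<Sum>j\<le>n. w k l i j * (?m k i * ?m l j))
        = (\<Sum>i=1..n. \<Sum>l\<le>M. \<Sum>j=1..n. w k l i j * (?m k i * ?m l j))" .
  qed
  also have "\<dots> = (\<Sum>i=1..n. \<Sum>k\<le>M. \<Sum>j=1..n. \<Sum>l\<le>M. w k l i j * (?m k i * ?m l j))"
  proof -
    have "(\<Sum>k\<le>M. \<Sum>i=1..n. \<Sum>l\<le>M. \<Sum>j=1..n. w k l i j * (?m k i * ?m l j))
        = (\<Sum>i=1..n. \<Sum>k\<le>M. \<Sum>l\<le>M. \<Sum>j=1..n. w k l i j * (?m k i * ?m l j))"
      by (rule sum.swap)
    also have "\<dots> = (\<Sum>i=1..n. \<Sum>k\<le>M. \<Sum>j=1..n. \<Sum>l\<le>M. w k l i j * (?m k i * ?m l j))"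
      by (rule sum.cong[OF refl], rule sum.cong[OF refl], rule sum.swap)
    finally show ?thesis .
  qed
  also have "\<dots> = (\<Sum>i=1..n. \<Sum>j=1..n. \<Sum>k\<le>M. \<Sum>l\<le>M. w k l i j * (?m k i * ?m l j))"
    by (rule sum.cong[OF refl], rule sum.swap)
  finally have "(LINT z|usq. ?f z) = \<dots>" .
  then show "(real n)\<^sup>2 * (LINT z|usq. ?f z) = (\<Sum>i=1..n. \<Sum>j=1..n. \<Sum>k\<le>M. \<Sum>l\<le>M. X i k * X j l * w k l i j)"
    by (simp add: X_def sum_distrib_left power2_eq_square mult_ac)
qed

lemma loglik_step_integrable:
  assumes p: "0 < p" "p < 1" and f: "f \<in> graphons" and \<theta>: "0 < \<theta>" "\<theta> < 1"
    and v: "sym01 M v" "\<And>i j. i \<le> M \<Longrightarrow> j \<le> M \<Longrightarrow> \<theta> \<le> v i j \<and> v i j \<le> 1 - \<theta>"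
  shows "z \<in> unit_square \<Longrightarrow> \<theta> \<le> step_graphon M v z \<and> step_graphon M v z \<le> 1 - \<theta>"
    and "integrable usq (\<lambda>z. loglik p (step_graphon M v z) (f z))"
proof -
  have gz: "\<theta> \<le> step_graphon M v z \<and> step_graphon M v z \<le> 1 - \<theta>" if "z \<in> unit_square" for z
    using that v(2)[OF cell_le cell_le] by (auto simp: step_graphon_apply)
  then show "z \<in> unit_square \<Longrightarrow> \<theta> \<le> step_graphon M v z \<and> step_graphon M v z \<le> 1 - \<theta>" .
  show "integrable usq (\<lambda>z. loglik p (step_graphon M v z) (f z))"
  proof (rule usq_integrableI[where B = "slope_bound p \<theta>"])
    show "(\<lambda>z. loglik p (step_graphon M v z) (f z)) \<in> borel_measurable usq"
      using graphon_measurable_usq[OF step_graphon_in_graphons[OF v(1)]] graphon_measurable_usq[OF f]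
      unfolding loglik_def by measurable
  qed (use slope_bound(3)[OF p \<theta>] gz graphon_in_01[OF f] in blast)
qed

text \<open>This removes \<sigma>: afterwards only finitely many assignments have to be considered.
  The loss with factor \<epsilon> pays for exchanging h and the rearranged graph in an integral that
  is affine in them, and the loss of order n pays for the diagonal. The factor 2 counts the
  orientations of an edge.\<close>

lemma graph_in_orbit_assignment:
  assumes p: "0 < p" "p < 1" and h: "h \<in> graphons" and \<theta>: "0 < \<theta>" "\<theta> < 1"
    and v: "sym01 M v" "\<And>i j. i \<le> M \<Longrightarrow> j \<le> M \<Longrightarrow> \<theta> \<le> v i j \<and> v i j \<le> 1 - \<theta>"
    and n: "0 < n" and E: "E \<subseteq> potential_edges n"
    and \<epsilon>: "orbit_dist h (graph_graphon n E) < \<epsilon>"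
  shows "\<exists>\<phi>\<in>{1..n} \<rightarrow>\<^sub>E {..M}.
    (real n)\<^sup>2 * ((LINT z|usq. loglik p (step_graphon M v z) (h z)) - (real M + 1)\<^sup>2 * slope_bound p \<theta> * \<epsilon>) - real n * slope_bound p \<theta>
     \<le> 2 * (\<Sum>e\<in>potential_edges n. loglik p (v (\<phi> (Min e)) (\<phi> (Max e))) (of_bool (e \<in> E)))"
proof -
  let ?K = "slope_bound p \<theta>" and ?g = "step_graphon M v" and ?G = "\<lambda>i j. of_bool ({i, j} \<in> E) :: real"
  obtain \<sigma> where s: "\<sigma> \<in> mp_bijections" "cut_dist h (rearrange (graph_graphon n E) \<sigma>) < \<epsilon>"
    using orbit_dist_lessE[OF \<epsilon>] .
  let ?F = "rearrange (graph_graphon n E) \<sigma>"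
  have F: "?F \<in> graphons" by (rule rearrange_graphon[OF graph_graphon_in_graphons s(1)])
  note sb = slope_bound[OF p \<theta>]
  have K: "0 < ?K" using sb(1)[of "v 0 0"] v(2)[of 0 0] by simp
  let ?X = "\<lambda>i k. real n * measure lborel {x \<in> {0..1}. cell M x = k \<and> cell n (\<sigma> x) = i}"
  let ?w = "\<lambda>k l i j. loglik p (v k l) (?G i j)"
  have Fz: "?F (x, y) = ?G (cell n (\<sigma> x)) (cell n (\<sigma> y))" if "x \<in> {0..1}" "y \<in> {0..1}" for x y
    using that mp_bijectionsD(5)[OF s(1)] by (simp add: rearrange_def graph_graphon_eq_step step_graphon_apply)
  note il = loglik_step_integrable(2)[OF p _ \<theta> v]
  have "(LINT z|usq. loglik p (?g z) (h z)) - (LINT z|usq. loglik p (?g z) (?F z))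
      = (LINT z|usq. loglik p (?g z) (h z) - loglik p (?g z) (?F z))"
    by (rule Bochner_Integration.integral_diff[OF il[OF h] il[OF F], symmetric])
  also have "\<dots> = (LINT z|usq. slope p (v (cell M (fst z)) (cell M (snd z))) * (h z - ?F z))"
  proof (intro Bochner_Integration.integral_cong refl)
    fix z assume "z \<in> space usq"
    then have "?g z = v (cell M (fst z)) (cell M (snd z))" by (auto simp: space_usq step_graphon_apply)
    then show "loglik p (?g z) (h z) - loglik p (?g z) (?F z) = slope p (v (cell M (fst z)) (cell M (snd z))) * (h z - ?F z)"
      using loglik_affine[of p "?g z" "h z" "?F z"] by simp
  qed
  also have "\<dots> \<le> (real M + 1)\<^sup>2 * ?K * cut_dist h ?F"
    using step_test_difference[OF h F, of M "\<lambda>k l. slope p (v k l)" ?K] sb(2) v(2) K by force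
  also have "\<dots> \<le> (real M + 1)\<^sup>2 * ?K * \<epsilon>" using s(2) K by (intro mult_left_mono) auto
  finally have 1: "(LINT z|usq. loglik p (?g z) (h z)) - (real M + 1)\<^sup>2 * ?K * \<epsilon> \<le> (LINT z|usq. loglik p (?g z) (?F z))"
    by simp
  have "(LINT z|usq. loglik p (?g z) (?F z))
      = (LINT z|usq. ?w (cell M (fst z)) (cell M (snd z)) (cell n (\<sigma> (fst z))) (cell n (\<sigma> (snd z))))"
    by (intro Bochner_Integration.integral_cong refl) (auto simp: space_usq Fz step_graphon_apply)
  then have 2: "(real n)\<^sup>2 * (LINT z|usq. loglik p (?g z) (?F z))
      = (\<Sum>i=1..n. \<Sum>j=1..n. \<Sum>k\<le>M. \<Sum>l\<le>M. ?X i k * ?X j l * ?w k l i j)"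
    using rearranged_step_integral(1)[OF s(1) n, of ?w M] by simp
  let ?T = "\<lambda>i j. \<Sum>k\<le>M. \<Sum>l\<le>M. ?X i k * ?X j l * ?w k l i j"
  note X = rearranged_step_integral(2)[OF s(1) n, where M = M] rearranged_step_integral(3)[OF s(1) n, where M = M]
  have "(\<Sum>i=1..n. \<Sum>j=1..n. ?T i j) = (\<Sum>i=1..n. ?T i i + (\<Sum>j\<in>{1..n} - {i}. ?T i j))"
    by (intro sum.cong refl sum.remove) auto
  also have "\<dots> = (\<Sum>i=1..n. ?T i i) + (\<Sum>i=1..n. \<Sum>j\<in>{1..n} - {i}. ?T i j)" by (rule sum.distrib)
  \<comment> \<open>Each diagonal term is a weighted average of log-likelihoods, since the shares of
    a vertex sum to 1, so it is at most \<open>slope_bound\<close>.\<close>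
  also have "(\<Sum>i=1..n. ?T i i) \<le> (\<Sum>i=1..n. ?K)"
  proof (rule sum_mono)
    fix i assume i: "i \<in> {1..n}"
    have "?T i i \<le> (\<Sum>k\<le>M. \<Sum>l\<le>M. ?X i k * ?X i l * ?K)"
    proof (intro sum_mono mult_left_mono)
      fix k l assume "k \<in> {..M}" "l \<in> {..M}"
      then have "\<bar>?w k l i i\<bar> \<le> ?K" using v(2)[of k l] by (intro sb(3)) auto
      then show "?w k l i i \<le> ?K" by linarith
    qed (use X(1) in simp)
    also have "\<dots> = (\<Sum>k\<le>M. ?X i k) * (\<Sum>l\<le>M. ?X i l) * ?K"
      unfolding sum_product by (simp only: sum_distrib_right)
    also have "\<dots> = ?K" by (simp only: X(2)[OF i] mult_1)
    finally show "?T i i \<le> ?K" .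
  qed
  finally have 3: "(\<Sum>i=1..n. \<Sum>j=1..n. ?T i j) - real n * ?K \<le> (\<Sum>i=1..n. \<Sum>j\<in>{1..n} - {i}. ?T i j)"
    by simp
  obtain \<phi> where \<phi>: "\<phi> \<in> {1..n} \<rightarrow>\<^sub>E {..M}"
    "(\<Sum>i=1..n. \<Sum>j\<in>{1..n} - {i}. ?T i j) \<le> (\<Sum>i=1..n. \<Sum>j\<in>{1..n} - {i}. ?w (\<phi> i) (\<phi> j) i j)"
    by (rule multiaffine_rounding[where X = ?X and c = "\<lambda>i j k l. ?w k l i j" and I = "{1..n}" and K = "{..M}"])
      (use X in auto)
  have "(\<Sum>i=1..n. \<Sum>j\<in>{1..n} - {i}. ?w (\<phi> i) (\<phi> j) i j)
      = (\<Sum>e\<in>potential_edges n. ?w (\<phi> (Min e)) (\<phi> (Max e)) (Min e) (Max e) + ?w (\<phi> (Max e)) (\<phi> (Min e)) (Max e) (Min e))"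
    by (rule sum_offdiag_eq_sum_edges)
  also have "\<dots> = (\<Sum>e\<in>potential_edges n. 2 * loglik p (v (\<phi> (Min e)) (\<phi> (Max e))) (of_bool (e \<in> E)))"
  proof (intro sum.cong refl)
    fix e assume e: "e \<in> potential_edges n"
    note m = Min_Max_edge[OF e]
    have "v (\<phi> (Max e)) (\<phi> (Min e)) = v (\<phi> (Min e)) (\<phi> (Max e))"
      using \<phi>(1) m(3,4) by (intro sym01D(3)[OF v(1)]) (auto simp: PiE_def Pi_def)
    then show "?w (\<phi> (Min e)) (\<phi> (Max e)) (Min e) (Max e) + ?w (\<phi> (Max e)) (\<phi> (Min e)) (Max e) (Min e)
        = 2 * loglik p (v (\<phi> (Min e)) (\<phi> (Max e))) (of_bool (e \<in> E))"
      by (simp only: m(1,2))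
  qed
  also have "\<dots> = 2 * (\<Sum>e\<in>potential_edges n. loglik p (v (\<phi> (Min e)) (\<phi> (Max e))) (of_bool (e \<in> E)))"
    by (rule sum_distrib_left[symmetric])
  finally have 4: "(\<Sum>i=1..n. \<Sum>j\<in>{1..n} - {i}. ?w (\<phi> i) (\<phi> j) i j) = \<dots>" .
  have "(real n)\<^sup>2 * ((LINT z|usq. loglik p (?g z) (h z)) - (real M + 1)\<^sup>2 * ?K * \<epsilon>)
      \<le> (real n)\<^sup>2 * (LINT z|usq. loglik p (?g z) (?F z))"
    using 1 by (intro mult_left_mono) auto
  then show ?thesis using 2 3 4 \<phi> by (intro bexI[of _ \<phi>]) linarith+
qed

text \<open>At the point g itself the affine function has the value
  \<open>2 * rate_density p g\<close>; moving the argument from g to h costs at most the slope bound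
  times the distance.\<close>

lemma loglik_integral_ge:
  assumes p: "0 < p" "p < 1" and h: "h \<in> graphons" and \<theta>: "0 < \<theta>" "\<theta> < 1"
    and v: "sym01 M v" "\<And>i j. i \<le> M \<Longrightarrow> j \<le> M \<Longrightarrow> \<theta> \<le> v i j \<and> v i j \<le> 1 - \<theta>"
  shows "2 * rate p (step_graphon M v) - slope_bound p \<theta> * l1_dist h (step_graphon M v)
    \<le> (LINT z|usq. loglik p (step_graphon M v z) (h z))"
proof -
  let ?g = "step_graphon M v" and ?K = "slope_bound p \<theta>"
  note g = step_graphon_in_graphons[OF v(1)]
  note sb = slope_bound[OF p \<theta>]
  have K: "0 < ?K" using sb(1)[of "v 0 0"] v(2)[of 0 0] by simp
  note gz = loglik_step_integrable(1)[OF p h \<theta> v] and il = loglik_step_integrable(2)[OF p h \<theta> v]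
  have ir: "integrable usq (\<lambda>z. rate_density p (?g z))" by (rule rate_density_integrable[OF p g])
  have ia: "integrable usq (\<lambda>z. \<bar>h z - ?g z\<bar>)" using integrable_graphon[OF h] integrable_graphon[OF g] by auto
  have "2 * rate p ?g - ?K * l1_dist h ?g = (LINT z|usq. 2 * rate_density p (?g z) - ?K * \<bar>h z - ?g z\<bar>)"
    using ir ia by (simp add: rate_eq[OF p g] l1_dist_def)
  also have "\<dots> \<le> (LINT z|usq. loglik p (?g z) (h z))"
  proof (rule integral_mono)
    fix z assume "z \<in> space usq"
    then have z: "\<theta> \<le> ?g z" "?g z \<le> 1 - \<theta>" using gz by (auto simp: space_usq simp del: mem_Times_iff)
    have "\<bar>slope p (?g z) * (h z - ?g z)\<bar> \<le> ?K * \<bar>h z - ?g z\<bar>"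
      unfolding abs_mult by (intro mult_right_mono sb(2)[OF z]) auto
    then show "2 * rate_density p (?g z) - ?K * \<bar>h z - ?g z\<bar> \<le> loglik p (?g z) (h z)"
      using loglik_affine[of p "?g z" "h z" "?g z"] rate_density_eq_loglik[of p "?g z"] by linarith
  qed (use il ir ia in auto)
  finally show ?thesis .
qed

lemma local_upper_bound:
  assumes p: "0 < p" "p < 1" and h: "h \<in> graphons" and \<eta>: "0 < \<eta>"
  obtains \<epsilon> where "0 < \<epsilon>" "\<forall>\<^sub>F n in sequentially.
    measure_pmf.prob (random_graph n p) {E. orbit_dist h (graph_graphon n E) < \<epsilon>} \<le> exp (- (real n)\<^sup>2 * (rate p h - \<eta>))"
proof -
  obtain C where C: "0 < C" "\<And>f g. f \<in> graphons \<Longrightarrow> g \<in> graphons \<Longrightarrow> rate p f \<le> rate p g + \<eta> / 8 + C * l1_dist f g"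
    using rate_l1_continuous[OF p, of "\<eta> / 8"] \<eta> by auto
  \<comment> \<open>Keeping g away from 0 and 1 costs \<theta> in L1, and this error is multiplied
    by a slope bound of order - ln \<theta>. The product tends to 0, so a suitable \<theta>
    exists.\<close>
  have "((\<lambda>\<theta>. (C + (- 2 * ln \<theta> - a - b)) * \<theta>) \<longlongrightarrow> 0) (at_right 0)" for a b :: real by real_asymp
  from order_tendstoD(2)[OF this[of "ln p" "ln (1 - p)"], of "\<eta> / 8"]
  have "\<forall>\<^sub>F \<theta> in at_right 0. (C + slope_bound p \<theta>) * \<theta> < \<eta> / 8"
    using \<eta> by (simp add: slope_bound_def)
  moreover have "\<forall>\<^sub>F \<theta> in at_right (0 :: real). \<theta> \<in> {0 <..< 1/2}"
    by (rule eventually_at_right_real) simp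
  ultimately have "\<forall>\<^sub>F \<theta> in at_right 0. (C + slope_bound p \<theta>) * \<theta> < \<eta> / 8 \<and> \<theta> \<in> {0 <..< 1/2}"
    by (rule eventually_conj)
  then obtain \<theta> where \<theta>: "(C + slope_bound p \<theta>) * \<theta> < \<eta> / 8" "0 < \<theta>" "\<theta> < 1/2"
    using eventually_happens[of _ "at_right (0::real)"] by (auto simp: trivial_limit_at_right_real)
  have \<theta>1: "\<theta> < 1" using \<theta> by simp
  let ?K = "slope_bound p \<theta>"
  have K: "0 < ?K" using slope_bound(1)[OF p \<theta>(2) \<theta>1, of \<theta>] \<theta>(3) by simp
  \<comment> \<open>Chosen after \<theta>, because the accuracy of the step approximation must
    compensate for the slope bound at \<theta>.\<close>
  define \<delta> where "\<delta> = \<eta> / 8 / (C + ?K)"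
  have CK: "0 < C + ?K" using K C(1) by simp
  then have \<delta>: "0 < \<delta>" "(C + ?K) * \<delta> = \<eta> / 8"
    using \<eta> unfolding \<delta>_def by (simp, metis less_irrefl nonzero_mult_div_cancel_left times_divide_eq_right)
  obtain M v where v: "sym01 M v" "\<And>i j. i \<le> M \<Longrightarrow> j \<le> M \<Longrightarrow> \<theta> \<le> v i j \<and> v i j \<le> 1 - \<theta>"
      "l1_dist h (step_graphon M v) < \<delta> + \<theta>"
    using eventually_happens[OF graphon_interior_approx[OF h \<delta>(1) \<theta>(2,3)]] by auto
  let ?g = "step_graphon M v" and ?J = "LINT z|usq. loglik p (step_graphon M v z) (h z)"
  have J: "2 * rate p h - \<eta> \<le> ?J"
  proof -
    have "0 \<le> l1_dist h ?g" unfolding l1_dist_def by (rule integral_nonneg_AE) simp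
    then have "C * l1_dist h ?g + ?K / 2 * l1_dist h ?g \<le> (C + ?K) * l1_dist h ?g"
      using K by (simp add: algebra_simps)
    also have "\<dots> \<le> (C + ?K) * (\<delta> + \<theta>)" using v(3) K C(1) by (intro mult_left_mono) auto
    also have "\<dots> \<le> \<eta> / 8 + \<eta> / 8" using \<delta>(2) \<theta>(1) by (simp only: distrib_left)
    finally have "C * l1_dist h ?g + ?K / 2 * l1_dist h ?g \<le> \<eta> / 4" by simp
    then show ?thesis
      using C(2)[OF h step_graphon_in_graphons[OF v(1)]] loglik_integral_ge[OF p h \<theta>(2) \<theta>1 v(1,2)] \<eta> by simp
  qed
  \<comment> \<open>Chosen last, because the radius must compensate for the number of steps M, which
    depends on \<theta> and \<delta>. On the scale of twice the rate the losses so far are \<eta>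
    and \<eta> / 2.\<close>
  define \<epsilon> where "\<epsilon> = \<eta> / (2 * ((real M + 1)\<^sup>2 * ?K))"
  have \<epsilon>: "0 < \<epsilon>" "(real M + 1)\<^sup>2 * ?K * \<epsilon> = \<eta> / 2" using \<eta> K by (auto simp: \<epsilon>_def)
  show ?thesis
  proof (rule that[OF \<epsilon>(1)])
    \<comment> \<open>Exponent per vertex of the remaining costs: the choice of one of M + 1 steps,
      and half of the diagonal loss. The last \<eta> / 4 absorbs it for large n.\<close>
    define c where "c = ln (real M + 1) + ?K / 2"
    have "\<forall>\<^sub>F n in sequentially. c \<le> \<eta> / 4 * real n" using \<eta> by real_asymp
    then show "\<forall>\<^sub>F n in sequentially. measure_pmf.prob (random_graph n p) {E. orbit_dist h (graph_graphon n E) < \<epsilon>}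
        \<le> exp (- (real n)\<^sup>2 * (rate p h - \<eta>))"
      using eventually_gt_at_top[of 0]
    proof eventually_elim
      case (elim n)
      let ?P = "Pi_pmf (potential_edges n) False (\<lambda>_. bernoulli_pmf p)"
      let ?\<Phi> = "{1..n} \<rightarrow>\<^sub>E {..M}"
      let ?s = "(real n)\<^sup>2 * (rate p h - 3 / 4 * \<eta>) - real n * (?K / 2)"
      let ?ev = "\<lambda>\<phi>. {\<omega>. ?s \<le> (\<Sum>e\<in>potential_edges n. loglik p (v (\<phi> (Min e)) (\<phi> (Max e))) (of_bool (\<omega> e)))}"
      have fin: "finite ?\<Phi>" by (intro finite_PiE) auto
      have sub: "{\<omega>. orbit_dist h (graph_graphon n (edges_of n \<omega>)) < \<epsilon>} \<subseteq> (\<Union>\<phi>\<in>?\<Phi>. ?ev \<phi>)"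
      proof
        fix \<omega> assume "\<omega> \<in> {\<omega>. orbit_dist h (graph_graphon n (edges_of n \<omega>)) < \<epsilon>}"
        then have "orbit_dist h (graph_graphon n (edges_of n \<omega>)) < \<epsilon>" by simp
        from graph_in_orbit_assignment[OF p h \<theta>(2) \<theta>1 v(1,2) elim(2) _ this]
        obtain \<phi> where \<phi>: "\<phi> \<in> ?\<Phi>" "(real n)\<^sup>2 * (?J - (real M + 1)\<^sup>2 * ?K * \<epsilon>) - real n * ?K
           \<le> 2 * (\<Sum>e\<in>potential_edges n. loglik p (v (\<phi> (Min e)) (\<phi> (Max e))) (of_bool (e \<in> edges_of n \<omega>)))"
          by (auto simp: edges_of_def)
        have "2 * ?s = (real n)\<^sup>2 * (2 * rate p h - \<eta> - \<eta> / 2) - real n * ?K" by (simp add: algebra_simps)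
        also have "\<dots> \<le> (real n)\<^sup>2 * (?J - (real M + 1)\<^sup>2 * ?K * \<epsilon>) - real n * ?K"
          using J \<epsilon>(2) by (intro diff_right_mono mult_left_mono) auto
        also note \<phi>(2)
        also have "(\<Sum>e\<in>potential_edges n. loglik p (v (\<phi> (Min e)) (\<phi> (Max e))) (of_bool (e \<in> edges_of n \<omega>)))
            = (\<Sum>e\<in>potential_edges n. loglik p (v (\<phi> (Min e)) (\<phi> (Max e))) (of_bool (\<omega> e)))"
          by (intro sum.cong refl) (simp add: edges_of_def)
        finally have "\<omega> \<in> ?ev \<phi>" by simp
        then show "\<omega> \<in> (\<Union>\<phi>\<in>?\<Phi>. ?ev \<phi>)" using \<phi>(1) by blast
      qed
      have "measure_pmf.prob (random_graph n p) {E. orbit_dist h (graph_graphon n E) < \<epsilon>}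
          \<le> measure_pmf.prob ?P (\<Union>\<phi>\<in>?\<Phi>. ?ev \<phi>)"
        unfolding prob_random_graph by (rule measure_pmf.finite_measure_mono[OF sub]) simp
      also have "\<dots> \<le> (\<Sum>\<phi>\<in>?\<Phi>. measure_pmf.prob ?P (?ev \<phi>))"
        by (rule measure_pmf.finite_measure_subadditive_finite[OF fin]) auto
      also have "\<dots> \<le> (\<Sum>\<phi>\<in>?\<Phi>. exp (- ?s))"
      proof (intro sum_mono loglik_tail finite_potential_edges p)
        fix \<phi> e assume \<phi>: "\<phi> \<in> ?\<Phi>" and e: "e \<in> potential_edges n"
        have "\<phi> (Min e) \<le> M" "\<phi> (Max e) \<le> M"
          using \<phi> Min_Max_edge(3,4)[OF e] by (auto simp: PiE_def Pi_def)
        from v(2)[OF this] show "0 < v (\<phi> (Min e)) (\<phi> (Max e)) \<and> v (\<phi> (Min e)) (\<phi> (Max e)) < 1"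
          using \<theta> by auto
      qed
      also have "\<dots> = (real M + 1) ^ n * exp (- ?s)"
        by (simp add: card_PiE add.commute)
      also have "(real M + 1) ^ n = exp (real n * ln (real M + 1))"
        by (simp add: exp_of_nat_mult)
      also have "\<dots> * exp (- ?s) = exp (real n * c - (real n)\<^sup>2 * (rate p h - 3 / 4 * \<eta>))"
        by (simp add: mult_exp_exp c_def algebra_simps)
      also have "\<dots> \<le> exp (- (real n)\<^sup>2 * (rate p h - \<eta>))"
      proof -
        have "real n * c \<le> real n * (\<eta> / 4 * real n)" using elim by (intro mult_left_mono) auto
        then show ?thesis by (simp add: algebra_simps power2_eq_square)
      qed
      finally show ?case .
    qed
  qed
qed

section \<open>Completeness in the cut distance\<close>

lemma swap_measurable_usq: "(\<lambda>z. (snd z, fst z)) \<in> measurable usq usq"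
proof (rule measurable_restrict_space3)
  have "(\<lambda>z::real \<times> real. (snd z, fst z)) \<in> borel_measurable borel"
    by (intro borel_measurable_continuous_onI continuous_intros)
  then show "(\<lambda>z::real \<times> real. (snd z, fst z)) \<in> measurable lborel lborel" by simp
qed auto

lemma usq_sets_iff: "A \<in> sets usq \<longleftrightarrow> A \<in> sets borel \<and> A \<subseteq> unit_square"
  by (subst sets_restrict_space_iff) (auto simp: unit_square_sets)

text \<open>The cut distance controls rectangles only, so the indicator of \<open>A\<close> is
  replaced by a step function close in L1. The replacement error is uniform in m and k because
  differences of graphons are bounded by 1.\<close>

lemma cut_Cauchy_integral_Cauchy:
  assumes f: "\<And>m. f m \<in> graphons" and A: "A \<in> sets usq"
    and cauchy: "\<And>e. 0 < e \<Longrightarrow> \<exists>N. \<forall>m\<ge>N. \<forall>k\<ge>N. cut_dist (f m) (f k) < e"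
  shows "Cauchy (\<lambda>m. LINT z|usq. indicator A z * f m z)"
proof (rule metric_CauchyI)
  fix e :: real assume e: "0 < e"
  have Am: "(indicator A :: _ \<Rightarrow> real) \<in> borel_measurable usq" using A by simp
  have "\<forall>\<^sub>F n in sequentially. \<exists>v. (\<forall>i j. 0 \<le> v i j \<and> v i j \<le> (1::real)) \<and>
     (LINT z|usq. \<bar>indicator A z - v (cell n (fst z)) (cell n (snd z))\<bar>) < e / 2"
    by (rule step_approx[OF Am]) (use e in \<open>auto simp: indicator_def\<close>)
  from eventually_happens'[OF sequentially_bot this]
  obtain n v where v: "\<And>i j. 0 \<le> v i j \<and> v i j \<le> (1::real)"
     "(LINT z|usq. \<bar>indicator A z - v (cell n (fst z)) (cell n (snd z))\<bar>) < e / 2"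
    by blast
  let ?V = "\<lambda>z. v (cell n (fst z)) (cell n (snd z))"
  have Vm: "?V \<in> borel_measurable usq"
    using step_measurable_borel[of v n] by (intro measurable_restrict_space1) simp
  \<comment> \<open>The test function consists of (n + 1)^2 rectangles, which together may
    contribute at most e / 2.\<close>
  let ?c = "e / (2 * (real n + 1)\<^sup>2)"
  obtain N where N: "\<And>m k. m \<ge> N \<Longrightarrow> k \<ge> N \<Longrightarrow> cut_dist (f m) (f k) < ?c"
    using cauchy[of ?c] e by auto
  show "\<exists>N. \<forall>m\<ge>N. \<forall>k\<ge>N. dist (LINT z|usq. indicator A z * f m z) (LINT z|usq. indicator A z * f k z) < e"
  proof (intro exI allI impI)
    fix m k assume mk: "m \<ge> N" "k \<ge> N"
    note fm = graphon_measurable_usq[OF f, of m] graphon_measurable_usq[OF f, of k]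
    have d: "\<bar>f m z - f k z\<bar> \<le> 1" if "z \<in> unit_square" for z
      using graphon_bounds[OF f that, of m] graphon_bounds[OF f that, of k] by (simp add: abs_le_iff)
    have AV: "\<bar>indicator A z - ?V z\<bar> \<le> 1" for z
      using v(1)[of "cell n (fst z)" "cell n (snd z)"] by (auto simp: indicator_def abs_le_iff)
    have ia: "integrable usq (\<lambda>z. \<bar>indicator A z - ?V z\<bar>)"
    proof (rule usq_integrableI[where B = 1])
      show "(\<lambda>z. \<bar>indicator A z - ?V z\<bar>) \<in> borel_measurable usq" using Am Vm by measurable
    qed (use AV in simp)
    have ib: "integrable usq (\<lambda>z. (indicator A z - ?V z) * (f m z - f k z))"
    proof (rule usq_integrableI[where B = 1])
      fix z assume "z \<in> unit_square"
      then show "\<bar>(indicator A z - ?V z) * (f m z - f k z)\<bar> \<le> 1"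
        using mult_mono[OF AV d, of z z] by (simp add: abs_mult)
    qed (use Am Vm fm in measurable)
    have ic: "integrable usq (\<lambda>z. ?V z * (f m z - f k z))"
    proof (rule usq_integrableI[where B = 1])
      fix z assume "z \<in> unit_square"
      then show "\<bar>?V z * (f m z - f k z)\<bar> \<le> 1"
        using mult_mono[of "\<bar>?V z\<bar>" 1, OF _ d] v(1)[of "cell n (fst z)" "cell n (snd z)"] by (simp add: abs_mult)
    qed (use Vm fm in measurable)
    have id: "integrable usq (\<lambda>z. indicator A z * f m z)" for m
    proof (rule usq_integrableI[where B = 1])
      fix z assume "z \<in> unit_square"
      then show "\<bar>indicator A z * f m z\<bar> \<le> 1" using graphon_bounds[OF f, of z m] by (auto simp: indicator_def)
    qed (use Am graphon_measurable_usq[OF f, of m] in measurable)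
    have "(LINT z|usq. indicator A z * f m z) - (LINT z|usq. indicator A z * f k z)
        = (LINT z|usq. indicator A z * f m z - indicator A z * f k z)"
      by (rule Bochner_Integration.integral_diff[symmetric]) (rule id)+
    also have "\<dots> = (LINT z|usq. (indicator A z - ?V z) * (f m z - f k z) + ?V z * (f m z - f k z))"
      by (simp add: algebra_simps)
    also have "\<dots> = (LINT z|usq. (indicator A z - ?V z) * (f m z - f k z)) + (LINT z|usq. ?V z * (f m z - f k z))"
      by (rule Bochner_Integration.integral_add[OF ib ic])
    finally have eq: "(LINT z|usq. indicator A z * f m z) - (LINT z|usq. indicator A z * f k z) = \<dots>" .
    have "\<bar>LINT z|usq. (indicator A z - ?V z) * (f m z - f k z)\<bar> \<le> (LINT z|usq. \<bar>(indicator A z - ?V z) * (f m z - f k z)\<bar>)"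
      by (rule integral_abs_bound)
    also have "\<dots> \<le> (LINT z|usq. \<bar>indicator A z - ?V z\<bar>)"
    proof (rule integral_mono[OF integrable_abs[OF ib] ia])
      fix z assume "z \<in> space usq"
      then show "\<bar>(indicator A z - ?V z) * (f m z - f k z)\<bar> \<le> \<bar>indicator A z - ?V z\<bar>"
        using mult_left_mono[OF d, of z "\<bar>indicator A z - ?V z\<bar>"] by (simp add: abs_mult space_usq)
    qed
    also note v(2)
    finally have 1: "\<bar>LINT z|usq. (indicator A z - ?V z) * (f m z - f k z)\<bar> < e / 2" .
    have "\<bar>LINT z|usq. ?V z * (f m z - f k z)\<bar> \<le> (real n + 1)\<^sup>2 * 1 * cut_dist (f m) (f k)"
      by (rule step_test_difference[OF f f]) (use v(1) in \<open>auto intro: order.trans[of _ 0]\<close>)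
    also have "\<dots> \<le> (real n + 1)\<^sup>2 * ?c" using N[OF mk] by (simp only: mult_1_right) (intro mult_left_mono, auto)
    also have "\<dots> = e / 2" by simp
    finally have 2: "\<bar>LINT z|usq. ?V z * (f m z - f k z)\<bar> \<le> e / 2" .
    show "dist (LINT z|usq. indicator A z * f m z) (LINT z|usq. indicator A z * f k z) < e"
      unfolding dist_real_def eq using 1 2 by linarith
  qed
qed

text \<open>
  The set functions \<open>A \<mapsto> \<integral>\<^sub>A f\<^sub>m\<close> converge to a measure dominated by Lebesgue measure; its density is the limit.
\<close>

lemma setwise_limit_density:
  fixes f :: "nat \<Rightarrow> real \<times> real \<Rightarrow> real"
  assumes f: "\<And>m. f m \<in> graphons"
    and cauchy: "\<And>A. A \<in> sets usq \<Longrightarrow> Cauchy (\<lambda>m. LINT z|usq. indicator A z * f m z)"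
  obtains g where "g \<in> borel_measurable usq" "\<And>z. 0 \<le> g z \<and> g z \<le> (1::real)"
    "\<And>A. A \<in> sets usq \<Longrightarrow> (\<lambda>m. LINT z|usq. indicator A z * f m z) \<longlonglongrightarrow> (LINT z|usq. indicator A z * g z)"
proof -
  define \<nu> where "\<nu> A = lim (\<lambda>m. LINT z|usq. indicator A z * f m z)" for A
  have lim: "(\<lambda>m. LINT z|usq. indicator A z * f m z) \<longlonglongrightarrow> \<nu> A" if "A \<in> sets usq" for A
    unfolding \<nu>_def using Cauchy_convergent[OF cauchy[OF that]] by (simp add: convergent_LIMSEQ_iff)
  have int: "integrable usq (\<lambda>z. indicator A z * f m z)" if "A \<in> sets usq" for A m
  proof (rule usq_integrableI[where B = 1])
    fix z assume "z \<in> unit_square"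
    then show "\<bar>indicator A z * f m z\<bar> \<le> 1" using graphon_bounds[OF f, of z m] by (auto simp: indicator_def)
  qed (use that graphon_measurable_usq[OF f, of m] in measurable)
  have \<nu>0: "0 \<le> \<nu> A" if A: "A \<in> sets usq" for A
  proof (rule LIMSEQ_le_const[OF lim[OF A]], intro exI allI impI)
    fix m show "0 \<le> (LINT z|usq. indicator A z * f m z)"
      using graphon_bounds(1)[OF f] by (intro Bochner_Integration.integral_nonneg) (auto simp: space_usq indicator_def simp del: mem_Times_iff)
  qed
  have \<nu>1: "\<nu> A \<le> measure usq A" if A: "A \<in> sets usq" for A
  proof (rule LIMSEQ_le_const2[OF lim[OF A]], intro exI allI impI)
    fix m
    have "(LINT z|usq. indicator A z * f m z) \<le> (LINT z|usq. indicator A z)"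
    proof (rule integral_mono[OF int[OF A]])
      fix z assume "z \<in> space usq"
      then show "indicator A z * f m z \<le> indicator A z"
        using graphon_bounds(2)[OF f, of z m] by (auto simp: indicator_def space_usq)
    qed (use A in \<open>auto simp: integrable_real_indicator usq.emeasure_eq_measure\<close>)
    then show "(LINT z|usq. indicator A z * f m z) \<le> measure usq A" using A by simp
  qed
  have \<nu>add: "\<nu> (A \<union> B) = \<nu> A + \<nu> B" if "A \<in> sets usq" "B \<in> sets usq" "A \<inter> B = {}" for A B
  proof (rule LIMSEQ_unique[OF lim])
    show "A \<union> B \<in> sets usq" using that by auto
    have "(LINT z|usq. indicator (A \<union> B) z * f m z) = (LINT z|usq. indicator A z * f m z) + (LINT z|usq. indicator B z * f m z)" for m
      using that by (subst Bochner_Integration.integral_add[symmetric, OF int int])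
        (auto intro!: Bochner_Integration.integral_cong simp: indicator_def)
    then show "(\<lambda>m. LINT z|usq. indicator (A \<union> B) z * f m z) \<longlonglongrightarrow> \<nu> A + \<nu> B"
      using tendsto_add[OF lim[OF that(1)] lim[OF that(2)]] by simp
  qed
  define N where "N = measure_of (space usq) (sets usq) (\<lambda>A. ennreal (\<nu> A))"
  have empty: "\<nu> {} = 0" using \<nu>0[of "{}"] \<nu>1[of "{}"] by simp
  have pos: "positive (sets usq) (\<lambda>A. ennreal (\<nu> A))" by (simp add: positive_def empty)
  have add: "additive (sets usq) (\<lambda>A. ennreal (\<nu> A))"
    by (auto simp: additive_def \<nu>add \<nu>0 ennreal_plus)
  \<comment> \<open>Additivity passes to the limit directly; continuity at the empty set follows
    because the limit is dominated by the measure on the square.\<close>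
  have ca: "countably_additive (sets usq) (\<lambda>A. ennreal (\<nu> A))"
  proof (rule sets.empty_continuous_imp_countably_additive[OF pos add])
    fix A :: "nat \<Rightarrow> _" assume A: "range A \<subseteq> sets usq" "decseq A" "(\<Inter>i. A i) = {}"
    have "(\<lambda>i. measure usq (A i)) \<longlonglongrightarrow> measure usq (\<Inter>i. A i)"
      by (rule usq.finite_Lim_measure_decseq[OF A(1,2)])
    then have "(\<lambda>i. measure usq (A i)) \<longlonglongrightarrow> 0" using A(3) by simp
    then have "(\<lambda>i. \<nu> (A i)) \<longlonglongrightarrow> 0"
      using A(1) by (intro tendsto_sandwich[OF _ _ tendsto_const, of 0 "\<lambda>i. \<nu> (A i)"]) (auto intro!: always_eventually \<nu>0 \<nu>1)
    then show "(\<lambda>i. ennreal (\<nu> (A i))) \<longlonglongrightarrow> 0" using tendsto_ennrealI by fastforce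
  qed auto
  have emN: "emeasure N A = ennreal (\<nu> A)" if "A \<in> sets usq" for A
    unfolding N_def using pos ca that by (intro emeasure_measure_of_sigma) (auto intro: sets.sigma_algebra_axioms)
  have setsN: "sets N = sets usq" unfolding N_def by (simp add: sets.sets_measure_of_eq)
  have spaceN: "space N = space usq" by (rule sets_eq_imp_space_eq[OF setsN])
  have "finite_measure N" by (rule finite_measureI) (simp add: spaceN emN)
  moreover have "absolutely_continuous usq N"
    unfolding absolutely_continuous_def
  proof
    fix A assume "A \<in> null_sets usq"
    then have A: "A \<in> sets usq" "measure usq A = 0" by (auto simp: measure_def)
    then have "\<nu> A = 0" using \<nu>0[OF A(1)] \<nu>1[OF A(1)] by simp
    then show "A \<in> null_sets N" using A emN by (auto simp: null_sets_def setsN)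
  qed
  ultimately obtain d where d: "d \<in> borel_measurable usq" "density usq d = N"
    using usq.Radon_Nikodym_finite_measure[OF _ setsN] by blast
  have emd: "(\<integral>\<^sup>+z. d z * indicator A z \<partial>usq) = ennreal (\<nu> A)" if "A \<in> sets usq" for A
    using emeasure_density[OF d(1) that] emN[OF that] d(2) by simp
  \<comment> \<open>On the set where the density exceeds 1 the limit measure would exceed the
    measure on the square unless that set is null.\<close>
  have AE1: "AE z in usq. d z \<le> 1"
  proof -
    let ?A = "{z \<in> space usq. 1 < d z}"
    have A: "?A \<in> sets usq" using d(1) by measurable
    have "(\<integral>\<^sup>+z. d z * indicator ?A z - indicator ?A z \<partial>usq)
        = (\<integral>\<^sup>+z. d z * indicator ?A z \<partial>usq) - (\<integral>\<^sup>+z. indicator ?A z \<partial>usq)"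
    proof (rule nn_integral_diff)
      show "(\<integral>\<^sup>+z. indicator ?A z \<partial>usq) \<noteq> \<infinity>"
        unfolding nn_integral_indicator[OF A] by (simp add: usq.emeasure_eq_measure)
    qed (use d(1) A in \<open>auto simp: indicator_def\<close>)
    also have "\<dots> = 0"
      using A \<nu>1[OF A] by (simp add: emd usq.emeasure_eq_measure diff_eq_0_ennreal ennreal_leI)
    finally have "AE z in usq. d z * indicator ?A z - indicator ?A z = 0"
      using d(1) A by (subst (asm) nn_integral_0_iff_AE) auto
    then show ?thesis
      using AE_space
    proof eventually_elim
      case (elim z)
      show ?case
      proof (rule ccontr)
        assume "\<not> d z \<le> 1"
        then have "1 < d z" by simp
        moreover have "z \<in> space usq" using elim by simp
        ultimately show False using elim diff_gr0_ennreal[of 1 "d z"] by simp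
      qed
    qed
  qed
  define g where "g z = enn2real (min 1 (d z))" for z
  have eg: "ennreal (g z) = min 1 (d z)" for z
    unfolding g_def by (rule ennreal_enn2real) (simp add: min_less_iff_disj)
  show ?thesis
  proof (rule that[of g])
    show gm: "g \<in> borel_measurable usq" unfolding g_def using d(1) by measurable
    show g01: "0 \<le> g z \<and> g z \<le> 1" for z
    proof -
      have "ennreal (g z) \<le> ennreal 1" unfolding eg by simp
      then show ?thesis by (simp add: g_def)
    qed
    fix A assume A: "A \<in> sets usq"
    have "ennreal (LINT z|usq. indicator A z * g z) = (\<integral>\<^sup>+z. ennreal (indicator A z * g z) \<partial>usq)"
    proof (rule nn_integral_eq_integral[symmetric])
      show "integrable usq (\<lambda>z. indicator A z * g z)"
        by (rule usq_integrableI[where B = 1]) (use A gm g01 in \<open>auto simp: indicator_def\<close>)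
    qed (use g01 in auto)
    also have "\<dots> = (\<integral>\<^sup>+z. d z * indicator A z \<partial>usq)"
    proof (rule nn_integral_cong_AE)
      show "AE z in usq. ennreal (indicator A z * g z) = d z * indicator A z"
        using AE1 by eventually_elim (auto simp: indicator_def eg min_def)
    qed
    also have "\<dots> = ennreal (\<nu> A)" by (rule emd[OF A])
    finally have "(LINT z|usq. indicator A z * g z) = \<nu> A"
      using \<nu>0[OF A] g01 by (subst (asm) ennreal_inj) (auto intro!: Bochner_Integration.integral_nonneg)
    then show "(\<lambda>m. LINT z|usq. indicator A z * f m z) \<longlonglongrightarrow> (LINT z|usq. indicator A z * g z)"
      using lim[OF A] by simp
  qed
qed

text \<open>The limit density need not be symmetric; its symmetrization has the same integrals over
  rectangles because the \<open>f m\<close> are symmetric. Setwise convergence alone is not uniform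
  in S and T: uniformity comes from the Cauchy bound, which survives k \<rightarrow> \<infinity>
  with m fixed.\<close>

lemma cut_dist_complete:
  assumes f: "\<And>m. f m \<in> graphons"
    and cauchy: "\<And>e. 0 < e \<Longrightarrow> \<exists>N. \<forall>m\<ge>N. \<forall>k\<ge>N. cut_dist (f m) (f k) < e"
  obtains g where "g \<in> graphons" "(\<lambda>m. cut_dist (f m) g) \<longlonglongrightarrow> 0"
proof -
  obtain g where gm: "g \<in> borel_measurable usq" and g01: "\<And>z. 0 \<le> g z \<and> g z \<le> (1::real)"
    and lim: "\<And>A. A \<in> sets usq \<Longrightarrow> (\<lambda>m. LINT z|usq. indicator A z * f m z) \<longlonglongrightarrow> (LINT z|usq. indicator A z * g z)"
    using setwise_limit_density[OF f cut_Cauchy_integral_Cauchy[OF f _ cauchy]] by blast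
  let ?s = "\<lambda>z. (g z + g (snd z, fst z)) / 2"
  define G where "G = restrict ?s unit_square"
  have gm': "(\<lambda>z. g (snd z, fst z)) \<in> borel_measurable usq" by (rule measurable_compose[OF swap_measurable_usq gm])
  have "?s \<in> borel_measurable usq" using gm gm' by measurable
  moreover have "G \<in> borel_measurable usq \<longleftrightarrow> ?s \<in> borel_measurable usq"
    by (rule measurable_cong) (auto simp: G_def space_usq)
  ultimately have Gm: "G \<in> borel_measurable (restrict_space borel unit_square)"
    using measurable_cong_sets[OF sets_restrict_space_cong[OF sets_lborel] refl] by auto
  have s01: "?s z \<in> {0..1}" for z
    using g01[of z] g01[of "(snd z, fst z)"] by simp
  have G: "G \<in> graphons"
    using Gm s01 unfolding graphons_def G_def by (auto simp: add.commute)
  have key: "(\<lambda>k. LINT z:S \<times> T|lborel. f m z - f k z) \<longlonglongrightarrow> (LINT z:S \<times> T|lborel. f m z - G z)"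
    if ST: "S \<in> sets unit_interval_measure" "T \<in> sets unit_interval_measure" for S T m
  proof -
    have A: "S \<times> T \<in> sets usq" "T \<times> S \<in> sets usq" using Times_sets_uim ST by (auto simp: usq_sets_iff simp del: Sigma_cong)
    have lint: "(LINT z:S \<times> T|lborel. F z) = (LINT z|usq. indicator (S \<times> T) z * F z)" for F :: "real \<times> real \<Rightarrow> real"
      by (rule set_integral_usq[OF Times_sets_uim[OF ST]])
    have sw: "(LINT z|usq. indicator (T \<times> S) z * F z) = (LINT z|usq. indicator (S \<times> T) z * F (snd z, fst z))"
      if "F \<in> borel_measurable usq" for F :: "real \<times> real \<Rightarrow> real"
    proof -
      have "(\<lambda>z. indicator (T \<times> S) z * F z) \<in> borel_measurable usq" using A(2) that by measurable
      from integral_usq_swap[OF this] show ?thesis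
        by (simp add: indicator_def mem_Times_iff conj_commute)
    qed
    have fsw: "(LINT z|usq. indicator (T \<times> S) z * f k z) = (LINT z|usq. indicator (S \<times> T) z * f k z)" for k
      unfolding sw[OF graphon_measurable_usq[OF f]]
      using f[of k] by (intro Bochner_Integration.integral_cong refl) (auto simp: graphons_def space_usq)
    have gi: "integrable usq (\<lambda>z. indicator (S \<times> T) z * g z)" "integrable usq (\<lambda>z. indicator (S \<times> T) z * g (snd z, fst z))"
      using g01 A(1) gm gm' by (auto intro!: usq_integrableI[where B = 1] simp: indicator_def)
    have "(LINT z|usq. indicator (S \<times> T) z * G z) = (LINT z|usq. (indicator (S \<times> T) z * g z + indicator (S \<times> T) z * g (snd z, fst z)) / 2)"
      by (intro Bochner_Integration.integral_cong refl) (auto simp: G_def space_usq algebra_simps)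
    also have "\<dots> = ((LINT z|usq. indicator (S \<times> T) z * g z) + (LINT z|usq. indicator (S \<times> T) z * g (snd z, fst z))) / 2"
      using gi by simp
    also have "(LINT z|usq. indicator (S \<times> T) z * g (snd z, fst z)) = (LINT z|usq. indicator (T \<times> S) z * g z)"
      by (rule sw[OF gm, symmetric])
    also have "\<dots> = (LINT z|usq. indicator (S \<times> T) z * g z)"
      using LIMSEQ_unique[OF lim[OF A(2), unfolded fsw] lim[OF A(1)]] .
    finally have Gg: "(LINT z|usq. indicator (S \<times> T) z * G z) = (LINT z|usq. indicator (S \<times> T) z * g z)" by simp
    have diff: "(LINT z:S \<times> T|lborel. f m z - F z) = (LINT z|usq. indicator (S \<times> T) z * f m z) - (LINT z|usq. indicator (S \<times> T) z * F z)"
      if F: "F \<in> graphons" for F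
      unfolding lint[symmetric]
      using graphon_integrable[OF f ST, of m] graphon_integrable[OF F ST] by simp
    show ?thesis
      unfolding diff[OF f] diff[OF G] Gg by (intro tendsto_intros lim A)
  qed
  have "(\<lambda>m. cut_dist (f m) G) \<longlonglongrightarrow> 0"
  proof (rule LIMSEQ_I)
    fix e :: real assume e: "0 < e"
    obtain N where N: "\<And>m k. m \<ge> N \<Longrightarrow> k \<ge> N \<Longrightarrow> cut_dist (f m) (f k) < e / 2"
      using cauchy[of "e / 2"] e by auto
    have "cut_dist (f m) G \<le> e / 2" if "m \<ge> N" for m
    proof (rule cut_dist_least)
      fix S T assume ST: "S \<in> sets unit_interval_measure" "T \<in> sets unit_interval_measure"
      show "\<bar>LINT z:S \<times> T|lborel. f m z - G z\<bar> \<le> e / 2"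
      proof (rule LIMSEQ_le_const2[OF tendsto_rabs[OF key[OF ST]]], intro exI allI impI)
        fix k assume "N \<le> k"
        then show "\<bar>LINT z:S \<times> T|lborel. f m z - f k z\<bar> \<le> e / 2"
          using cut_dist_upper[OF f f ST, of m k] N[OF that, of k] by linarith
      qed
    qed
    then show "\<exists>no. \<forall>m\<ge>no. norm (cut_dist (f m) G - 0) < e"
      using e cut_dist_nonneg[OF f G] by (intro exI[of _ N]) (force simp: abs_of_nonneg)
  qed
  then show ?thesis using that G by blast
qed

section \<open>Weak regularity and total boundedness\<close>

definition permute_cells :: "nat \<Rightarrow> (nat \<Rightarrow> nat) \<Rightarrow> real \<Rightarrow> real" where
  "permute_cells n \<pi> x = x + (if cell n x = 0 then 0 else (real (\<pi> (cell n x)) - real (cell n x)) / real n)"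

text \<open>The numbered cells are half-open intervals of equal length, so a translation carries one
  exactly onto another, and the point 0, which lies in none of them, stays fixed. No exceptional
  null set arises.\<close>

lemma permute_cells:
  assumes n: "0 < n" and \<pi>: "bij_betw \<pi> {1..n} {1..n}" and x: "x \<in> {0..1}"
  shows "cell n x \<noteq> 0 \<Longrightarrow> cell n (permute_cells n \<pi> x) = \<pi> (cell n x)"
    and "cell n x = 0 \<Longrightarrow> cell n (permute_cells n \<pi> x) = 0"
    and "permute_cells n \<pi> x \<in> {0..1}"
proof -
  have *: "cell n (permute_cells n \<pi> x) = \<pi> (cell n x) \<and> permute_cells n \<pi> x \<in> {0..1}" if c: "cell n x \<noteq> 0"
  proof -
    let ?i = "cell n x"
    have i: "?i \<in> {1..n}" using c cell_le[OF x] by auto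
    then have pi: "\<pi> ?i \<in> {1..n}" using \<pi> by (auto simp: bij_betw_def)
    have "x \<in> {(real ?i - 1) / real n <.. real ?i / real n}"
      using cell_eq_iff[OF n c, of x] by blast
    then have "permute_cells n \<pi> x \<in> {(real (\<pi> ?i) - 1) / real n <.. real (\<pi> ?i) / real n}"
      using c by (auto simp: permute_cells_def diff_divide_distrib)
    then have "permute_cells n \<pi> x \<in> cell_set n (\<pi> ?i)" by (simp add: cell_set_eq[OF pi])
    then show ?thesis by (simp add: cell_set_def)
  qed
  then show "cell n x \<noteq> 0 \<Longrightarrow> cell n (permute_cells n \<pi> x) = \<pi> (cell n x)" by blast
  show "cell n x = 0 \<Longrightarrow> cell n (permute_cells n \<pi> x) = 0" by (simp add: permute_cells_def)
  show "permute_cells n \<pi> x \<in> {0..1}"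
    by (cases "cell n x = 0") (use * x in \<open>auto simp: permute_cells_def\<close>)
qed

lemma permute_cells_inverse:
  assumes n: "0 < n" and \<pi>: "bij_betw \<pi> {1..n} {1..n}" and x: "x \<in> {0..1}"
    and \<rho>: "\<And>i. i \<in> {1..n} \<Longrightarrow> \<rho> (\<pi> i) = i"
  shows "permute_cells n \<rho> (permute_cells n \<pi> x) = x"
proof (cases "cell n x = 0")
  case False
  then have i: "cell n x \<in> {1..n}" using cell_le[OF x] by auto
  then have "\<pi> (cell n x) \<in> {1..n}" using \<pi> by (auto simp: bij_betw_def)
  then show ?thesis
    using permute_cells(1)[OF n \<pi> x False] \<rho>[OF i] False
    unfolding permute_cells_def[of n \<rho>] by (simp add: permute_cells_def diff_divide_distrib)
qed (simp add: permute_cells_def)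

lemma permute_cells_measurable:
  assumes n: "0 < n" and \<pi>: "bij_betw \<pi> {1..n} {1..n}"
  shows "permute_cells n \<pi> \<in> measurable unit_interval_measure unit_interval_measure"
proof (rule measurable_restrict_space3)
  have "(\<lambda>x. (\<lambda>i. if i = 0 then 0 else (real (\<pi> i) - real i) / real n) (cell n x)) \<in> borel_measurable borel"
    by (rule measurable_compose[OF cell_measurable]) simp
  then have "(\<lambda>x. x + (if cell n x = 0 then 0 else (real (\<pi> (cell n x)) - real (cell n x)) / real n)) \<in> borel_measurable borel"
    by (intro borel_measurable_add) auto
  then show "permute_cells n \<pi> \<in> measurable lborel lborel" by (simp add: permute_cells_def[abs_def])
qed (use permute_cells(3)[OF n \<pi>] in auto)

lemma emeasure_cells:
  assumes n: "0 < n" and B: "B \<in> sets unit_interval_measure"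
  shows "emeasure lborel B = (\<Sum>i=1..n. emeasure lborel (B \<inter> cell_set n i))"
proof -
  have S: "B \<inter> cell_set n i \<in> sets borel" for i
    using B cell_set_sets[of n i] by (auto simp: sets_unit_interval_measure)
  have "B = (\<Union>i\<in>{..n}. B \<inter> cell_set n i)"
  proof (intro equalityI subsetI)
    fix x assume x: "x \<in> B"
    then have "x \<in> {0..1}" using B by (auto simp: sets_unit_interval_measure)
    then have "x \<in> B \<inter> cell_set n (cell n x)" "cell n x \<in> {..n}" using x cell_le by (auto simp: cell_set_def)
    then show "x \<in> (\<Union>i\<in>{..n}. B \<inter> cell_set n i)" by blast
  qed auto
  then have "emeasure lborel B = emeasure lborel (\<Union>i\<in>{..n}. B \<inter> cell_set n i)" by simp
  also have "\<dots> = (\<Sum>i\<in>{..n}. emeasure lborel (B \<inter> cell_set n i))"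
    by (rule sum_emeasure[symmetric]) (use S in \<open>auto simp: disjoint_family_on_def cell_set_def\<close>)
  also have "\<dots> = (\<Sum>i=1..n. emeasure lborel (B \<inter> cell_set n i))"
  proof (rule sum.mono_neutral_right)
    show "\<forall>i\<in>{..n} - {1..n}. emeasure lborel (B \<inter> cell_set n i) = 0"
    proof
      fix i assume "i \<in> {..n} - {1..n}"
      then have "i = 0" by auto
      moreover have "B \<inter> cell_set n 0 \<subseteq> {0}" using cell_0_iff[OF n] by (auto simp: cell_set_def)
      ultimately show "emeasure lborel (B \<inter> cell_set n i) = 0"
        using emeasure_mono[of "B \<inter> cell_set n i" "{0}" lborel] by simp
    qed
  qed auto
  finally show ?thesis .
qed

text \<open>Measure is preserved cell by cell, where the map is a translation; summing over the
  cells and reindexing by \<pi> gives the whole interval. The inverse is the map of the inverse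
  permutation.\<close>

lemma permute_cells_mp:
  assumes n: "0 < n" and \<pi>: "bij_betw \<pi> {1..n} {1..n}"
  shows "permute_cells n \<pi> \<in> mp_bijections"
proof -
  let ?\<sigma> = "permute_cells n \<pi>"
  define \<rho> where "\<rho> = the_inv_into {1..n} \<pi>"
  have \<rho>: "bij_betw \<rho> {1..n} {1..n}" unfolding \<rho>_def by (rule bij_betw_the_inv_into[OF \<pi>])
  have inv1: "\<rho> (\<pi> i) = i" if "i \<in> {1..n}" for i
    unfolding \<rho>_def using \<pi> that by (simp add: the_inv_into_f_f bij_betw_def)
  have inv2: "\<pi> (\<rho> i) = i" if "i \<in> {1..n}" for i
    unfolding \<rho>_def using \<pi> that by (intro f_the_inv_into_f_bij_betw)
  let ?\<tau> = "permute_cells n \<rho>"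
  have id1: "?\<tau> (?\<sigma> x) = x" if "x \<in> {0..1}" for x by (rule permute_cells_inverse[OF n \<pi> that inv1])
  have id2: "?\<sigma> (?\<tau> x) = x" if "x \<in> {0..1}" for x by (rule permute_cells_inverse[OF n \<rho> that inv2])
  note r1 = permute_cells(3)[OF n \<pi>] and r2 = permute_cells(3)[OF n \<rho>]
  have bij: "bij_betw ?\<sigma> {0..1} {0..1}"
    by (rule bij_betw_byWitness[where f' = ?\<tau>]) (use id1 id2 r1 r2 in \<open>auto simp del: atLeastAtMost_iff\<close>)
  have ms: "?\<sigma> \<in> measurable unit_interval_measure unit_interval_measure" by (rule permute_cells_measurable[OF n \<pi>])
  have "the_inv_into {0..1} ?\<sigma> \<in> measurable unit_interval_measure unit_interval_measure \<longleftrightarrow>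
      ?\<tau> \<in> measurable unit_interval_measure unit_interval_measure"
  proof (rule measurable_cong)
    fix x assume "x \<in> space unit_interval_measure"
    then have "x \<in> {0..1}" by simp
    then show "the_inv_into {0..1} ?\<sigma> x = ?\<tau> x"
      using bij id2 r2 by (intro the_inv_into_f_eq) (auto simp: bij_betw_def simp del: atLeastAtMost_iff)
  qed
  then have mi: "the_inv_into {0..1} ?\<sigma> \<in> measurable unit_interval_measure unit_interval_measure"
    using permute_cells_measurable[OF n \<rho>] by simp
  have "distr unit_interval_measure unit_interval_measure ?\<sigma> = unit_interval_measure"
  proof (rule measure_eqI)
    fix A assume "A \<in> sets (distr unit_interval_measure unit_interval_measure ?\<sigma>)"
    then have A: "A \<in> sets unit_interval_measure" by simp
    let ?B = "?\<sigma> -` A \<inter> {0..1}"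
    have B: "?B \<in> sets unit_interval_measure" using measurable_sets[OF ms A] by simp
    have "emeasure (distr unit_interval_measure unit_interval_measure ?\<sigma>) A = emeasure lborel ?B"
      using B A by (subst emeasure_distr[OF ms A]) (simp add: emeasure_restrict_space)
    also have "\<dots> = (\<Sum>i=1..n. emeasure lborel (?B \<inter> cell_set n i))" by (rule emeasure_cells[OF n B])
    also have "\<dots> = (\<Sum>i=1..n. emeasure lborel (A \<inter> cell_set n (\<pi> i)))"
    proof (rule sum.cong[OF refl])
      fix i assume i: "i \<in> {1..n}"
      then have pi: "\<pi> i \<in> {1..n}" using \<pi> by (auto simp: bij_betw_def)
      let ?d = "(real (\<pi> i) - real i) / real n"
      have AC: "A \<inter> cell_set n (\<pi> i) \<in> sets borel"
        using A cell_set_sets by (auto simp: sets_unit_interval_measure)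
      have "?B \<inter> cell_set n i = (\<lambda>x. ?d + x) -` (A \<inter> cell_set n (\<pi> i))"
      proof (intro set_eqI iffI)
        fix x assume x: "x \<in> ?B \<inter> cell_set n i"
        then have "x \<in> {0..1}" "cell n x = i" by (auto simp: cell_set_def)
        moreover from this have "?\<sigma> x = ?d + x" using i by (simp add: permute_cells_def)
        ultimately show "x \<in> (\<lambda>x. ?d + x) -` (A \<inter> cell_set n (\<pi> i))"
          using x permute_cells(1,3)[OF n \<pi>, of x] i by (auto simp: cell_set_def)
      next
        fix x assume x: "x \<in> (\<lambda>x. ?d + x) -` (A \<inter> cell_set n (\<pi> i))"
        then have "?d + x \<in> {(real (\<pi> i) - 1) / real n <.. real (\<pi> i) / real n}" by (simp add: cell_set_eq[OF pi])
        then have "x \<in> {(real i - 1) / real n <.. real i / real n}" by (auto simp: diff_divide_distrib)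
        then have "x \<in> cell_set n i" by (simp add: cell_set_eq[OF i])
        moreover from this have "?\<sigma> x = ?d + x" using i by (simp add: permute_cells_def cell_set_def)
        ultimately show "x \<in> ?B \<inter> cell_set n i" using x by (auto simp: cell_set_def)
      qed
      also have "emeasure lborel \<dots> = emeasure (distr lborel borel (\<lambda>x. ?d + x)) (A \<inter> cell_set n (\<pi> i))"
        using AC by (subst emeasure_distr) auto
      finally show "emeasure lborel (?B \<inter> cell_set n i) = emeasure lborel (A \<inter> cell_set n (\<pi> i))"
        by (simp add: lborel_distr_plus)
    qed
    also have "\<dots> = (\<Sum>i=1..n. emeasure lborel (A \<inter> cell_set n i))"
      by (rule sum.reindex_bij_betw[OF \<pi>])
    also have "\<dots> = emeasure lborel A" by (rule emeasure_cells[OF n A, symmetric])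
    also have "\<dots> = emeasure unit_interval_measure A"
      using A by (simp add: emeasure_restrict_space sets_unit_interval_measure)
    finally show "emeasure (distr unit_interval_measure unit_interval_measure ?\<sigma>) A = emeasure unit_interval_measure A" .
  qed simp
  then show ?thesis using bij ms mi by (simp add: mp_bijections_def)
qed

lemma orbit_dist_le_cut_dist: "f \<in> graphons \<Longrightarrow> g \<in> graphons \<Longrightarrow> orbit_dist f g \<le> cut_dist f g"
  using orbit_dist_lower[of f g id] by (simp add: mp_bijections_id rearrange_id)

lemma orbit_dist_step_permute:
  assumes n: "0 < n" and \<pi>: "bij_betw \<pi> {1..n} {1..n}" and u: "sym01 n u" and v: "sym01 n v"
    and C: "\<And>A B. A \<subseteq> {1..n} \<Longrightarrow> B \<subseteq> {1..n} \<Longrightarrow> \<bar>\<Sum>i\<in>A. \<Sum>j\<in>B. u i j - v (\<pi> i) (\<pi> j)\<bar> \<le> C * (real n)\<^sup>2"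
  shows "orbit_dist (step_graphon n u) (step_graphon n v) \<le> C"
proof -
  let ?\<sigma> = "permute_cells n \<pi>"
  \<comment> \<open>The permutation acts on 1..n only, whereas cell 0 is fixed, so the value at 0 is
    set by hand.\<close>
  let ?\<pi> = "\<lambda>i. if i = 0 then 0 else \<pi> i"
  have "rearrange (step_graphon n v) ?\<sigma> = step_graphon n (\<lambda>i j. v (?\<pi> i) (?\<pi> j))"
  proof
    fix z
    have "cell n (?\<sigma> x) = ?\<pi> (cell n x)" if "x \<in> {0..1}" for x
      using permute_cells(1,2)[OF n \<pi> that] by simp
    then show "rearrange (step_graphon n v) ?\<sigma> z = step_graphon n (\<lambda>i j. v (?\<pi> i) (?\<pi> j)) z"
      using permute_cells(3)[OF n \<pi>]
      by (cases z) (auto simp: rearrange_def restrict_def step_graphon_def simp del: atLeastAtMost_iff)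
  qed
  moreover have "cut_dist (step_graphon n u) (step_graphon n (\<lambda>i j. v (?\<pi> i) (?\<pi> j))) \<le> C"
  proof (rule cut_dist_step_le[OF n])
    fix A B assume AB: "A \<subseteq> {1..n}" "B \<subseteq> {1..n}"
    have "(\<Sum>i\<in>A. \<Sum>j\<in>B. u i j - v (?\<pi> i) (?\<pi> j)) = (\<Sum>i\<in>A. \<Sum>j\<in>B. u i j - v (\<pi> i) (\<pi> j))"
      using AB by (intro sum.cong refl) auto
    then show "\<bar>\<Sum>i\<in>A. \<Sum>j\<in>B. u i j - v (?\<pi> i) (?\<pi> j)\<bar> \<le> C * (real n)\<^sup>2" using C[OF AB] by simp
  qed
  ultimately show ?thesis
    using orbit_dist_lower[OF step_graphon_in_graphons[OF u] step_graphon_in_graphons[OF v] permute_cells_mp[OF n \<pi>]]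
    by simp
qed

text \<open>Within each label, as many indices as the smaller of the two classes allows are matched
  injectively. The unmatched parts of domain and range have equal size and are paired arbitrarily,
  so at most m indices per label are mismatched.\<close>

lemma bij_matching_labels:
  fixes \<phi> \<psi> :: "'a \<Rightarrow> 'c"
  assumes I: "finite I" and C: "finite C" and \<phi>: "\<And>i. i \<in> I \<Longrightarrow> \<phi> i \<in> C"
    and close: "\<And>c. c \<in> C \<Longrightarrow> card {i \<in> I. \<phi> i = c} \<le> card {i \<in> I. \<psi> i = c} + m"
  obtains \<pi> where "bij_betw \<pi> I I" "card {i \<in> I. \<psi> (\<pi> i) \<noteq> \<phi> i} \<le> card C * m"
proof -
  let ?X = "\<lambda>c. {i \<in> I. \<phi> i = c}" and ?Y = "\<lambda>c. {i \<in> I. \<psi> i = c}"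
  define Q where "Q c X h \<longleftrightarrow> X \<subseteq> ?X c \<and> card X = min (card (?X c)) (card (?Y c)) \<and> h ` X \<subseteq> ?Y c \<and> inj_on h X"
    for c X and h :: "'a \<Rightarrow> 'a"
  have ex: "\<exists>X h. Q c X h" for c
  proof -
    have "min (card (?X c)) (card (?Y c)) \<le> card (?X c)" by simp
    then obtain X where X: "X \<subseteq> ?X c" "card X = min (card (?X c)) (card (?Y c))" "finite X"
      by (rule obtain_subset_with_card_n)
    obtain h where "h ` X \<subseteq> ?Y c" "inj_on h X"
      using card_le_inj[OF X(3), of "?Y c"] I X(2) by auto
    then show ?thesis using X unfolding Q_def by blast
  qed
  obtain X where "\<forall>c. \<exists>h. Q c (X c) h" using choice[of "\<lambda>c X. \<exists>h. Q c X h"] ex by blast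
  then obtain h where "\<forall>c. Q c (X c) (h c)" using choice[of "\<lambda>c h. Q c (X c) h"] by blast
  then have X: "\<And>c. X c \<subseteq> ?X c" "\<And>c. card (X c) = min (card (?X c)) (card (?Y c))"
    and h: "\<And>c. h c ` X c \<subseteq> ?Y c" "\<And>c. inj_on (h c) (X c)"
    unfolding Q_def by simp_all
  define D where "D = (\<Union>c\<in>C. X c)"
  define g where "g i = h (\<phi> i) i" for i
  have DI: "D \<subseteq> I" using X(1) by (auto simp: D_def)
  have D: "i \<in> X (\<phi> i)" if "i \<in> D" for i using that X(1) by (fastforce simp: D_def)
  have g: "g i \<in> I" "\<psi> (g i) = \<phi> i" if "i \<in> D" for i
    using h(1)[of "\<phi> i"] D[OF that] by (auto simp: g_def)
  have inj: "inj_on g D"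
  proof (rule inj_onI)
    fix i j assume ij: "i \<in> D" "j \<in> D" "g i = g j"
    then have "\<phi> i = \<phi> j" using g(2)[OF ij(1)] g(2)[OF ij(2)] by simp
    then show "i = j" using ij D[OF ij(1)] D[OF ij(2)] h(2)[of "\<phi> i"] by (auto simp: g_def inj_on_def)
  qed
  have gI: "g ` D \<subseteq> I" using g by auto
  have fD: "finite D" using DI I finite_subset by blast
  have "card (I - D) = card (I - g ` D)"
    using DI gI fD by (simp add: card_Diff_subset card_image[OF inj])
  then obtain k where k: "bij_betw k (I - D) (I - g ` D)"
    using I finite_same_card_bij[of "I - D" "I - g ` D"] by auto
  define \<pi> where "\<pi> i = (if i \<in> D then g i else k i)" for i
  have "bij_betw \<pi> (D \<union> (I - D)) (g ` D \<union> (I - g ` D))"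
    unfolding \<pi>_def by (rule bij_betw_disjoint_Un) (use inj k in \<open>auto simp: bij_betw_def\<close>)
  moreover have "D \<union> (I - D) = I" "g ` D \<union> (I - g ` D) = I" using DI gI by auto
  ultimately have bij: "bij_betw \<pi> I I" by simp
  have "{i \<in> I. \<psi> (\<pi> i) \<noteq> \<phi> i} \<subseteq> (\<Union>c\<in>C. ?X c - X c)"
  proof
    fix i assume "i \<in> {i \<in> I. \<psi> (\<pi> i) \<noteq> \<phi> i}"
    then have "i \<in> I" "i \<notin> D" using g(2) by (auto simp: \<pi>_def)
    then show "i \<in> (\<Union>c\<in>C. ?X c - X c)" using \<phi> by (auto simp: D_def)
  qed
  then have "card {i \<in> I. \<psi> (\<pi> i) \<noteq> \<phi> i} \<le> card (\<Union>c\<in>C. ?X c - X c)"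
    by (rule card_mono[rotated]) (use I C in auto)
  also have "\<dots> \<le> (\<Sum>c\<in>C. card (?X c - X c))" by (rule card_UN_le[OF C])
  also have "\<dots> \<le> (\<Sum>c\<in>C. m)"
  proof (rule sum_mono)
    fix c assume c: "c \<in> C"
    have "card (?X c - X c) = card (?X c) - card (X c)"
      using X(1)[of c] I by (intro card_Diff_subset) (auto intro: finite_subset)
    then show "card (?X c - X c) \<le> m" using close[OF c] X(2)[of c] by simp
  qed
  finally show ?thesis using that bij by simp
qed

text \<open>
  The step values after \<open>length ss\<close> increments are determined by the signs alone. The label of a vertex
  lists its memberships in the rectangle sides used so far, most recent first.
\<close>

primrec cut_code :: "real \<Rightarrow> bool list \<Rightarrow> bool list \<Rightarrow> bool list \<Rightarrow> real" where
  "cut_code \<epsilon> [] a b = 0"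
| "cut_code \<epsilon> (s # ss) a b = max 0 (min 1 (cut_code \<epsilon> ss (drop 2 a) (drop 2 b) +
     (if s then \<epsilon> else - \<epsilon>) * ((of_bool (a ! 0 \<and> b ! 1) + of_bool (b ! 0 \<and> a ! 1)) / 2)))"

lemma cut_code_bounds: "0 \<le> cut_code \<epsilon> ss a b" "cut_code \<epsilon> ss a b \<le> 1"
  by (cases ss; simp)+

lemma cut_code_sym: "cut_code \<epsilon> ss a b = cut_code \<epsilon> ss b a"
  by (induction ss arbitrary: a b) (auto simp: add.commute)

lemma sym01_cut_code: "sym01 n (\<lambda>i j. cut_code \<epsilon> ss (\<phi> i) (\<phi> j))"
  by (auto simp: sym01_def cut_code_bounds intro: cut_code_sym)

text \<open>
  Adding a multiple of the symmetrized indicator of a rectangle with large discrepancy decreases the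
  squared distance by a fixed amount. Truncating to \<open>[0, 1]\<close> can only decrease it further, so the
  approximant stays a graphon.
\<close>

lemma regularity_increment:
  fixes v w :: "nat \<Rightarrow> nat \<Rightarrow> real"
  assumes v: "sym01 n v" and w: "sym01 n w" and A: "A \<subseteq> {1..n}" and B: "B \<subseteq> {1..n}" and \<epsilon>: "0 < \<epsilon>"
    and bad: "\<epsilon> * (real n)\<^sup>2 < \<bar>\<Sum>i\<in>A. \<Sum>j\<in>B. v i j - w i j\<bar>"
  defines "u \<equiv> \<lambda>i j. (of_bool (i \<in> A \<and> j \<in> B) + of_bool (j \<in> A \<and> i \<in> B)) / 2 :: real"
    and "t \<equiv> if 0 < (\<Sum>i\<in>A. \<Sum>j\<in>B. v i j - w i j) then \<epsilon> else - \<epsilon>"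
  shows "(\<Sum>i=1..n. \<Sum>j=1..n. (v i j - max 0 (min 1 (w i j + t * u i j)))\<^sup>2)
    \<le> (\<Sum>i=1..n. \<Sum>j=1..n. (v i j - w i j)\<^sup>2) - \<epsilon>\<^sup>2 * (real n)\<^sup>2"
proof -
  let ?S = "\<Sum>i\<in>A. \<Sum>j\<in>B. v i j - w i j"
  let ?d = "\<lambda>i j. v i j - w i j"
  have half: "(\<Sum>i=1..n. \<Sum>j=1..n. ?d i j * of_bool (i \<in> A \<and> j \<in> B)) = ?S"
  proof -
    have "?S = (\<Sum>i\<in>A. \<Sum>j=1..n. ?d i j * of_bool (i \<in> A \<and> j \<in> B))"
      using B by (intro sum.cong refl sum.mono_neutral_cong_left) auto
    also have "\<dots> = (\<Sum>i=1..n. \<Sum>j=1..n. ?d i j * of_bool (i \<in> A \<and> j \<in> B))"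
      using A by (intro sum.mono_neutral_left) (auto intro!: sum.neutral)
    finally show ?thesis by simp
  qed
  have half': "(\<Sum>i=1..n. \<Sum>j=1..n. ?d i j * of_bool (j \<in> A \<and> i \<in> B)) = ?S"
  proof -
    have "(\<Sum>i=1..n. \<Sum>j=1..n. ?d i j * of_bool (j \<in> A \<and> i \<in> B))
        = (\<Sum>i=1..n. \<Sum>j=1..n. ?d j i * of_bool (j \<in> A \<and> i \<in> B))"
      using sym01D(3)[OF v] sym01D(3)[OF w] by (intro sum.cong refl) auto
    then show ?thesis using half by (subst (asm) sum.swap) simp
  qed
  have inner: "(\<Sum>i=1..n. \<Sum>j=1..n. ?d i j * u i j) = ?S"
  proof -
    have "(\<Sum>i=1..n. \<Sum>j=1..n. ?d i j * u i j)
        = (\<Sum>i=1..n. \<Sum>j=1..n. ?d i j * of_bool (i \<in> A \<and> j \<in> B) / 2 + ?d i j * of_bool (j \<in> A \<and> i \<in> B) / 2)"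
      by (simp only: u_def distrib_left add_divide_distrib times_divide_eq_right)
    also have "\<dots> = (\<Sum>i=1..n. \<Sum>j=1..n. ?d i j * of_bool (i \<in> A \<and> j \<in> B)) / 2
       + (\<Sum>i=1..n. \<Sum>j=1..n. ?d i j * of_bool (j \<in> A \<and> i \<in> B)) / 2"
      by (simp only: sum.distrib sum_divide_distrib)
    finally show ?thesis unfolding half half' by simp
  qed
  have "t * ?S = \<epsilon> * \<bar>?S\<bar>" by (auto simp: t_def abs_if)
  \<comment> \<open>The linear term gains at least 2 \<epsilon>^2 n^2, and the quadratic term costs
    at most \<epsilon>^2 n^2 since u lies in [0, 1].\<close>
  then have tS: "\<epsilon> * (\<epsilon> * (real n)\<^sup>2) \<le> t * ?S" using bad \<epsilon> by (simp add: mult_left_mono)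
  have tt: "t\<^sup>2 = \<epsilon>\<^sup>2" by (auto simp: t_def)
  have "(\<Sum>i=1..n. \<Sum>j=1..n. (v i j - max 0 (min 1 (w i j + t * u i j)))\<^sup>2)
      \<le> (\<Sum>i=1..n. \<Sum>j=1..n. (?d i j)\<^sup>2 - 2 * t * (?d i j * u i j) + \<epsilon>\<^sup>2)"
  proof (intro sum_mono)
    fix i j assume ij: "i \<in> {1..n}" "j \<in> {1..n}"
    then have b: "0 \<le> v i j" "v i j \<le> 1" using sym01D(1,2)[OF v] by auto
    have "\<bar>v i j - max 0 (min 1 x)\<bar> \<le> \<bar>v i j - x\<bar>" for x using b by (auto simp: max_def min_def)
    then have "(v i j - max 0 (min 1 (w i j + t * u i j)))\<^sup>2 \<le> (v i j - (w i j + t * u i j))\<^sup>2"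
      by (simp add: abs_le_square_iff)
    also have "\<dots> = (?d i j)\<^sup>2 - 2 * t * (?d i j * u i j) + \<epsilon>\<^sup>2 * (u i j)\<^sup>2"
      unfolding tt[symmetric] by (simp add: power2_eq_square algebra_simps)
    also have "\<epsilon>\<^sup>2 * (u i j)\<^sup>2 \<le> \<epsilon>\<^sup>2 * 1"
      by (intro mult_left_mono power_le_one) (auto simp: u_def)
    finally show "(v i j - max 0 (min 1 (w i j + t * u i j)))\<^sup>2 \<le> (?d i j)\<^sup>2 - 2 * t * (?d i j * u i j) + \<epsilon>\<^sup>2" by simp
  qed
  also have "\<dots> = (\<Sum>i=1..n. \<Sum>j=1..n. (?d i j)\<^sup>2) - 2 * t * (\<Sum>i=1..n. \<Sum>j=1..n. ?d i j * u i j) + (real n)\<^sup>2 * \<epsilon>\<^sup>2"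
    by (simp add: sum.distrib sum_subtractf sum_distrib_left power2_eq_square)
  also have "\<dots> \<le> (\<Sum>i=1..n. \<Sum>j=1..n. (?d i j)\<^sup>2) - \<epsilon>\<^sup>2 * (real n)\<^sup>2"
    using tS unfolding inner by (simp add: power2_eq_square algebra_simps)
  finally show ?thesis .
qed

text \<open>The squared error starts at no more than n^2 and loses \<epsilon>^2 n^2 whenever some
  rectangle is bad, so a good approximation appears within \<open>L\<close> rounds. Increments of
  the fixed height \<epsilon>, in place of the best one, are what make the description finite and
  independent of n.\<close>

lemma weak_regularity:
  assumes v: "sym01 n v" and n: "0 < n" and \<epsilon>: "0 < \<epsilon>" and L: "1 < real L * \<epsilon>\<^sup>2"
  obtains ss \<phi> where "length ss \<le> L" "\<And>i. length (\<phi> i) = 2 * length ss"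
    "\<And>A B. A \<subseteq> {1..n} \<Longrightarrow> B \<subseteq> {1..n} \<Longrightarrow>
      \<bar>\<Sum>i\<in>A. \<Sum>j\<in>B. v i j - cut_code \<epsilon> ss (\<phi> i) (\<phi> j)\<bar> \<le> \<epsilon> * (real n)\<^sup>2"
proof -
  define good where "good ss \<phi> \<longleftrightarrow> (\<forall>A B. A \<subseteq> {1..n} \<longrightarrow> B \<subseteq> {1..n} \<longrightarrow>
      \<bar>\<Sum>i\<in>A. \<Sum>j\<in>B. v i j - cut_code \<epsilon> ss (\<phi> i) (\<phi> j)\<bar> \<le> \<epsilon> * (real n)\<^sup>2)" for ss and \<phi> :: "nat \<Rightarrow> bool list"
  define err where "err ss \<phi> = (\<Sum>i=1..n. \<Sum>j=1..n. (v i j - cut_code \<epsilon> ss (\<phi> i) (\<phi> j))\<^sup>2)"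
    for ss and \<phi> :: "nat \<Rightarrow> bool list"
  have ind: "\<exists>ss \<phi>. length ss \<le> k \<and> (\<forall>i. length (\<phi> i) = 2 * length ss) \<and>
      (good ss \<phi> \<or> err ss \<phi> \<le> (real n)\<^sup>2 * (1 - real k * \<epsilon>\<^sup>2))" for k
  proof (induction k)
    case 0
    have "err [] (\<lambda>_. []) \<le> (\<Sum>i=1..n. \<Sum>j=1..n. 1)"
      unfolding err_def using sym01D(1,2)[OF v] by (intro sum_mono) (auto intro!: power_le_one)
    then show ?case by (intro exI[of _ "[]"] exI[of _ "\<lambda>_. []"]) (simp add: power2_eq_square)
  next
    case (Suc k)
    then obtain ss \<phi> where s: "length ss \<le> k" "\<forall>i. length (\<phi> i) = 2 * length ss"
      "good ss \<phi> \<or> err ss \<phi> \<le> (real n)\<^sup>2 * (1 - real k * \<epsilon>\<^sup>2)" by blast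
    show ?case
    proof (cases "good ss \<phi>")
      case True
      then show ?thesis using s by (intro exI[of _ ss] exI[of _ \<phi>]) auto
    next
      case False
      then have e: "err ss \<phi> \<le> (real n)\<^sup>2 * (1 - real k * \<epsilon>\<^sup>2)" using s by simp
      let ?w = "\<lambda>i j. cut_code \<epsilon> ss (\<phi> i) (\<phi> j)"
      obtain A B where AB: "A \<subseteq> {1..n}" "B \<subseteq> {1..n}" "\<epsilon> * (real n)\<^sup>2 < \<bar>\<Sum>i\<in>A. \<Sum>j\<in>B. v i j - ?w i j\<bar>"
        using False unfolding good_def not_all not_imp not_le by blast
      let ?s = "0 < (\<Sum>i\<in>A. \<Sum>j\<in>B. v i j - ?w i j)"
      let ?ss = "?s # ss" and ?\<phi> = "\<lambda>i. (i \<in> A) # (i \<in> B) # \<phi> i"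
      have "err ?ss ?\<phi> \<le> err ss \<phi> - \<epsilon>\<^sup>2 * (real n)\<^sup>2"
        using regularity_increment[OF v sym01_cut_code AB(1,2) \<epsilon> AB(3)] unfolding err_def by (simp add: numeral_2_eq_2)
      also have "\<dots> \<le> (real n)\<^sup>2 * (1 - real (Suc k) * \<epsilon>\<^sup>2)" using e by (simp add: algebra_simps)
      finally show ?thesis using s by (intro exI[of _ ?ss] exI[of _ ?\<phi>]) auto
    qed
  qed
  then obtain ss \<phi> where s: "length ss \<le> L" "\<forall>i. length (\<phi> i) = 2 * length ss"
      "good ss \<phi> \<or> err ss \<phi> \<le> (real n)\<^sup>2 * (1 - real L * \<epsilon>\<^sup>2)" by blast
  have "(real n)\<^sup>2 * (1 - real L * \<epsilon>\<^sup>2) < 0" using n L by (simp add: mult_less_0_iff)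
  moreover have "0 \<le> err ss \<phi>" unfolding err_def by (intro sum_nonneg) auto
  ultimately have "good ss \<phi>" using s(3) by linarith
  then show ?thesis using that[of ss \<phi>] s unfolding good_def by blast
qed

text \<open>After matching labels the two kernels differ only in rows and columns of mismatched
  vertices: at most 2 n times their number of entries, each changed by at most 1.\<close>

lemma orbit_dist_same_code:
  fixes \<phi> \<psi> :: "nat \<Rightarrow> bool list"
  assumes n: "0 < n" and C: "finite C" "\<And>i. \<phi> i \<in> C"
    and close: "\<And>c. c \<in> C \<Longrightarrow> card {i \<in> {1..n}. \<phi> i = c} \<le> card {i \<in> {1..n}. \<psi> i = c} + m"
  shows "orbit_dist (step_graphon n (\<lambda>i j. cut_code \<epsilon> ss (\<phi> i) (\<phi> j))) (step_graphon n (\<lambda>i j. cut_code \<epsilon> ss (\<psi> i) (\<psi> j)))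
    \<le> 2 * real (card C * m) / real n"
proof -
  obtain \<pi> where \<pi>: "bij_betw \<pi> {1..n} {1..n}" "card {i \<in> {1..n}. \<psi> (\<pi> i) \<noteq> \<phi> i} \<le> card C * m"
    by (rule bij_matching_labels[of "{1..n}" C \<phi> \<psi> m]) (use C close in auto)
  let ?D = "{i \<in> {1..n}. \<psi> (\<pi> i) \<noteq> \<phi> i}"
  show ?thesis
  proof (rule orbit_dist_step_permute[OF n \<pi>(1) sym01_cut_code sym01_cut_code])
    fix A B assume AB: "A \<subseteq> {1..n}" "B \<subseteq> {1..n}"
    let ?d = "\<lambda>i j. cut_code \<epsilon> ss (\<phi> i) (\<phi> j) - cut_code \<epsilon> ss (\<psi> (\<pi> i)) (\<psi> (\<pi> j))"
    have "\<bar>\<Sum>i\<in>A. \<Sum>j\<in>B. ?d i j\<bar> \<le> (\<Sum>i\<in>A. \<Sum>j\<in>B. \<bar>?d i j\<bar>)"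
      by (rule order.trans[OF sum_abs sum_mono[OF sum_abs]])
    also have "\<dots> \<le> (\<Sum>i\<in>A. \<Sum>j\<in>B. of_bool (i \<in> ?D) + of_bool (j \<in> ?D))"
    proof (intro sum_mono)
      fix i j assume "i \<in> A" "j \<in> B"
      then have ij: "i \<in> {1..n}" "j \<in> {1..n}" using AB by auto
      have "\<bar>?d i j\<bar> \<le> 1"
        using cut_code_bounds[of \<epsilon> ss "\<phi> i" "\<phi> j"] cut_code_bounds[of \<epsilon> ss "\<psi> (\<pi> i)" "\<psi> (\<pi> j)"] by linarith
      then show "\<bar>?d i j\<bar> \<le> of_bool (i \<in> ?D) + of_bool (j \<in> ?D)"
        using ij by (cases "i \<in> ?D"; cases "j \<in> ?D") auto
    qed
    also have "\<dots> \<le> (\<Sum>i=1..n. \<Sum>j=1..n. of_bool (i \<in> ?D) + of_bool (j \<in> ?D))"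
      using AB by (intro order.trans[OF sum_mono[OF sum_mono2] sum_mono2]) (auto intro!: sum_nonneg)
    also have "\<dots> = 2 * real n * real (card ?D)"
    proof -
      have "(\<Sum>i=1..n. of_bool (i \<in> ?D)) = real (card ?D)"
      proof -
        have "{1..n} \<inter> {i. i \<in> ?D} = ?D" by auto
        then show ?thesis by (simp only: sum_of_bool_eq finite_atLeastAtMost)
      qed
      then show ?thesis by (simp only: sum.distrib sum_constant card_atLeastAtMost sum_distrib_left[symmetric]) simp
    qed
    also have "\<dots> \<le> 2 * real n * real (card C * m)"
      using \<pi>(2) by (intro mult_left_mono) (auto simp del: of_nat_mult)
    also have "\<dots> = 2 * real (card C * m) / real n * (real n)\<^sup>2"
      using n by (simp add: power2_eq_square)
    finally show "\<bar>\<Sum>i\<in>A. \<Sum>j\<in>B. ?d i j\<bar> \<le> 2 * real (card C * m) / real n * (real n)\<^sup>2" .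
  qed
qed

text \<open>Label frequencies rounded down to multiples of 1/R; the result is at most
  \<open>R\<close> for every n, so profiles range over a finite set that is the same for all
  grids.\<close>

definition profile :: "nat \<Rightarrow> nat \<Rightarrow> (nat \<Rightarrow> bool list) \<Rightarrow> bool list \<Rightarrow> nat" where
  "profile R n \<phi> c = R * card {i \<in> {1..n}. \<phi> i = c} div n"

lemma profile_close:
  assumes n: "0 < n" and R: "0 < R" and eq: "profile R n \<phi> c = profile R n \<psi> c"
  shows "card {i \<in> {1..n}. \<phi> i = c} \<le> card {i \<in> {1..n}. \<psi> i = c} + n div R + 1"
proof -
  let ?a = "card {i \<in> {1..n}. \<phi> i = c}" and ?b = "card {i \<in> {1..n}. \<psi> i = c}"
  have "R * ?a < n + n * (R * ?a div n)" by (rule dividend_less_times_div[OF n])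
  also have "R * ?a div n = R * ?b div n" using eq by (simp add: profile_def)
  finally have "R * ?a < n + n * (R * ?b div n)" .
  moreover have "n * (R * ?b div n) \<le> R * ?b" by simp
  moreover have "n < R + R * (n div R)" by (rule dividend_less_times_div[OF R])
  ultimately have "R * ?a < R * ?b + R * (n div R) + R" by linarith
  then have "R * ?a < R * (?b + n div R + 1)" by (simp only: distrib_left mult_1_right)
  then show ?thesis using R by (simp only: mult_less_cancel1) simp
qed

text \<open>Total boundedness in pigeonhole form. The set \<open>K\<close> depends on \<epsilon>
  alone, while the code may depend on \<open>F\<close>: codes can be compared only on a common grid,
  and the grid must be fine enough for every member of \<open>F\<close>. Two approximations and the
  comparison of labels cost less than 2\<epsilon> each, which 7\<epsilon> covers.\<close>

lemma graphon_code:
  assumes \<epsilon>: "0 < \<epsilon>"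
  obtains K :: "(bool list \<times> (bool list \<Rightarrow> nat)) set" where "finite K"
    "\<And>F. finite F \<Longrightarrow> F \<subseteq> graphons \<Longrightarrow>
      \<exists>code. code ` F \<subseteq> K \<and> (\<forall>f\<in>F. \<forall>g\<in>F. code f = code g \<longrightarrow> orbit_dist f g < 7 * \<epsilon>)"
proof -
  have "\<forall>\<^sub>F L in sequentially. 1 < real L * \<epsilon>\<^sup>2" using \<epsilon> by real_asymp
  from eventually_happens'[OF sequentially_bot this] obtain L where L: "1 < real L * \<epsilon>\<^sup>2" by blast
  \<comment> \<open>Vertex labels carry two bits per round for at most \<open>L\<close>
    rounds.\<close>
  define C where "C = {c :: bool list. set c \<subseteq> UNIV \<and> length c \<le> 2 * L}"
  have C: "finite C" unfolding C_def by (rule finite_lists_length_le) simp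
  have small: "\<forall>\<^sub>F n in sequentially. 2 * real (card C) / real n < \<epsilon>"
    using order_tendstoD(2)[OF lim_const_over_n[of "2 * real (card C)"] \<epsilon>] by simp
  have "\<forall>\<^sub>F R in sequentially. 2 * real (card C) / real R < \<epsilon> \<and> 0 < R"
    by (rule eventually_conj[OF small eventually_gt_at_top])
  from eventually_happens'[OF sequentially_bot this] obtain R where R: "2 * real (card C) / real R < \<epsilon>" "0 < R" by blast
  \<comment> \<open>A code records the signs of the rounds and the rounded frequency of each label,
    not which vertex has which label.\<close>
  define K where "K = {ss :: bool list. set ss \<subseteq> UNIV \<and> length ss \<le> L} \<times> (C \<rightarrow>\<^sub>E {..R})"
  have "finite K" unfolding K_def
    by (intro finite_cartesian_product finite_lists_length_le finite_PiE C) auto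
  moreover have "\<exists>code. code ` F \<subseteq> K \<and> (\<forall>f\<in>F. \<forall>g\<in>F. code f = code g \<longrightarrow> orbit_dist f g < 7 * \<epsilon>)"
    if F: "finite F" "F \<subseteq> graphons" for F
  proof -
    have "\<forall>\<^sub>F n in sequentially. \<forall>f\<in>F. \<exists>v. sym01 n v \<and> l1_dist f (step_graphon n v) < \<epsilon>"
      using F graphon_step_approx[OF _ \<epsilon>] by (intro eventually_ball_finite) auto
    moreover have "\<forall>\<^sub>F n in sequentially. 0 < n \<and> 2 * real (card C) / real n < \<epsilon>"
      by (rule eventually_conj[OF eventually_gt_at_top small])
    ultimately have "\<forall>\<^sub>F n in sequentially. (\<forall>f\<in>F. \<exists>v. sym01 n v \<and> l1_dist f (step_graphon n v) < \<epsilon>) \<and>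
        0 < n \<and> 2 * real (card C) / real n < \<epsilon>" by (rule eventually_conj)
    from eventually_happens'[OF sequentially_bot this] obtain n where n: "0 < n" "2 * real (card C) / real n < \<epsilon>"
      and apx: "\<And>f. f \<in> F \<Longrightarrow> \<exists>v. sym01 n v \<and> l1_dist f (step_graphon n v) < \<epsilon>" by blast
    let ?W = "\<lambda>ss \<phi>. step_graphon n (\<lambda>i j. cut_code \<epsilon> ss (\<phi> i) (\<phi> j))"
    have ex: "\<exists>c. length (fst c) \<le> L \<and> (\<forall>i. snd c i \<in> C) \<and> cut_dist f (?W (fst c) (snd c)) < 2 * \<epsilon>" if f: "f \<in> F" for f
    proof -
      obtain v where v: "sym01 n v" "l1_dist f (step_graphon n v) < \<epsilon>" using apx[OF f] by blast
      obtain ss \<phi> where s: "length ss \<le> L" "\<And>i. length (\<phi> i) = 2 * length ss"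
        "\<And>A B. A \<subseteq> {1..n} \<Longrightarrow> B \<subseteq> {1..n} \<Longrightarrow> \<bar>\<Sum>i\<in>A. \<Sum>j\<in>B. v i j - cut_code \<epsilon> ss (\<phi> i) (\<phi> j)\<bar> \<le> \<epsilon> * (real n)\<^sup>2"
        by (rule weak_regularity[OF v(1) n(1) \<epsilon> L]) blast
      note G = step_graphon_in_graphons[OF v(1)] step_graphon_in_graphons[OF sym01_cut_code]
      have fG: "f \<in> graphons" using f F by blast
      have "cut_dist f (?W ss \<phi>) \<le> cut_dist f (step_graphon n v) + cut_dist (step_graphon n v) (?W ss \<phi>)"
        by (intro cut_dist_triangle fG G)
      also have "cut_dist f (step_graphon n v) \<le> l1_dist f (step_graphon n v)" by (rule cut_dist_le_l1_dist[OF fG G(1)])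
      also have "cut_dist (step_graphon n v) (?W ss \<phi>) \<le> \<epsilon>" by (rule cut_dist_step_le[OF n(1) s(3)])
      finally have "cut_dist f (?W ss \<phi>) < 2 * \<epsilon>" using v(2) by simp
      then show ?thesis using s(1,2) by (intro exI[of _ "(ss, \<phi>)"]) (auto simp: C_def)
    qed
    then obtain c where c: "\<And>f. f \<in> F \<Longrightarrow> length (fst (c f)) \<le> L" "\<And>f i. f \<in> F \<Longrightarrow> snd (c f) i \<in> C"
      "\<And>f. f \<in> F \<Longrightarrow> cut_dist f (?W (fst (c f)) (snd (c f))) < 2 * \<epsilon>" by metis
    define code where "code f = (fst (c f), restrict (profile R n (snd (c f))) C)" for f
    have "code ` F \<subseteq> K"
    proof
      fix k assume "k \<in> code ` F"
      then obtain f where f: "f \<in> F" "k = code f" by blast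
      have "profile R n (snd (c f)) x \<le> R" for x
      proof -
        have "card {i \<in> {1..n}. snd (c f) i = x} \<le> card {1..n}" by (rule card_mono) auto
        then have "R * card {i \<in> {1..n}. snd (c f) i = x} div n \<le> R * n div n" by (intro div_le_mono mult_left_mono) auto
        then show ?thesis using n by (simp add: profile_def)
      qed
      then show "k \<in> K" using f c(1) by (auto simp: code_def K_def)
    qed
    moreover have "orbit_dist f g < 7 * \<epsilon>" if f: "f \<in> F" and g: "g \<in> F" and eq: "code f = code g" for f g
    proof -
      let ?\<phi> = "snd (c f)" and ?\<psi> = "snd (c g)" and ?ss = "fst (c f)"
      have ss: "fst (c g) = ?ss" using eq by (simp add: code_def)
      have pr: "profile R n ?\<phi> x = profile R n ?\<psi> x" if "x \<in> C" for x
        using eq that unfolding code_def by (metis prod.inject restrict_apply')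
      have fG: "f \<in> graphons" "g \<in> graphons" using f g F by auto
      note W = step_graphon_in_graphons[OF sym01_cut_code]
      \<comment> \<open>Equal profiles leave a discrepancy of at most \<open>n div R + 1\<close> per
        label. Relative to n this is at most 1/R + 1/n, and \<open>R\<close> and \<open>n\<close>
        were chosen to make each contribution smaller than \<epsilon>.\<close>
      have "orbit_dist (?W ?ss ?\<phi>) (?W ?ss ?\<psi>) \<le> 2 * real (card C * (n div R + 1)) / real n"
        using profile_close[OF n(1) R(2) pr] c(2)[OF f] by (intro orbit_dist_same_code[OF n(1) C]) (auto simp: add.assoc)
      also have "\<dots> = 2 * real (card C) * (real (n div R) / real n) + 2 * real (card C) / real n"
        by (simp add: add_divide_distrib distrib_left)
      also have "\<dots> \<le> 2 * real (card C) * (1 / real R) + 2 * real (card C) / real n"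
      proof (intro add_right_mono mult_left_mono)
        have "real (n div R * R) \<le> real n" by (subst of_nat_le_iff) simp
        then show "real (n div R) / real n \<le> 1 / real R"
          using n(1) R(2) by (simp add: field_simps)
      qed auto
      also have "\<dots> < 2 * \<epsilon>" using R(1) n(2) by simp
      finally have 1: "orbit_dist (?W ?ss ?\<phi>) (?W ?ss ?\<psi>) < 2 * \<epsilon>" .
      have "orbit_dist f g \<le> orbit_dist f (?W ?ss ?\<phi>) + orbit_dist (?W ?ss ?\<phi>) g"
        by (intro orbit_dist_triangle fG W)
      also have "orbit_dist (?W ?ss ?\<phi>) g \<le> orbit_dist (?W ?ss ?\<phi>) (?W ?ss ?\<psi>) + orbit_dist (?W ?ss ?\<psi>) g"
        by (intro orbit_dist_triangle fG W)
      also have "orbit_dist f (?W ?ss ?\<phi>) \<le> cut_dist f (?W ?ss ?\<phi>)" by (intro orbit_dist_le_cut_dist fG W)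
      also have "orbit_dist (?W ?ss ?\<psi>) g \<le> cut_dist (?W ?ss ?\<psi>) g" by (intro orbit_dist_le_cut_dist fG W)
      finally show "orbit_dist f g < 7 * \<epsilon>"
        using 1 c(3)[OF f] c(3)[OF g] \<epsilon> unfolding ss cut_dist_commute[of "?W ?ss ?\<psi>" g] by linarith
    qed
    ultimately show ?thesis by (intro exI[of _ code] conjI ballI impI)
  qed
  ultimately show ?thesis by (rule that)
qed

section \<open>The large deviation principle\<close>

lemma tau_rearrange:
  assumes g: "g \<in> graphons" and s: "\<sigma> \<in> mp_bijections"
  shows "\<tau> (rearrange g \<sigma>) = \<tau> g"
proof -
  have r: "rearrange g \<sigma> \<in> graphons" by (rule rearrange_graphon[OF g s])
  have "orbit_dist (rearrange g \<sigma>) g \<le> cut_dist (rearrange g \<sigma>) (rearrange g \<sigma>)"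
    by (rule orbit_dist_lower[OF r g s])
  then have "orbit_dist (rearrange g \<sigma>) g = 0"
    using orbit_dist_nonneg[OF r g] by (simp add: cut_dist_self[OF r])
  then show ?thesis by (simp add: tau_eq_iff[OF r g])
qed

lemma delta_cut_tau_eq: "f \<in> graphons \<Longrightarrow> g \<in> graphons \<Longrightarrow> delta_cut (\<tau> f) (\<tau> g) = orbit_dist f g"
  by (simp add: delta_cut_tau orbit_dist_def)

lemma tau_in_classes: "g \<in> graphons \<Longrightarrow> \<tau> g \<in> graphon_classes"
  by (simp add: graphon_classes_def)

interpretation GS: Metric_space graphon_classes delta_cut
  by (rule Metric_space_delta_cut)

text \<open>Members of an \<epsilon>-separated finite set have distinct codes, so its size is at
  most that of \<open>K\<close>. A separated set of maximal size is an \<epsilon>-net, since any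
  uncovered class could be added to it.\<close>

lemma graphon_classes_totally_bounded: "GS.mtotally_bounded graphon_classes"
  unfolding GS.mtotally_bounded_def
proof (intro allI impI)
  fix \<epsilon> :: real assume \<epsilon>: "0 < \<epsilon>"
  then have "0 < \<epsilon> / 7" by simp
  then obtain K :: "(bool list \<times> (bool list \<Rightarrow> nat)) set" where K: "finite K"
    "\<And>F. finite F \<Longrightarrow> F \<subseteq> graphons \<Longrightarrow>
      \<exists>code. code ` F \<subseteq> K \<and> (\<forall>f\<in>F. \<forall>g\<in>F. code f = code g \<longrightarrow> orbit_dist f g < 7 * (\<epsilon> / 7))"
    by (rule graphon_code) blast
  define sep where "sep S \<longleftrightarrow> finite S \<and> S \<subseteq> graphon_classes \<and> (\<forall>A\<in>S. \<forall>B\<in>S. A \<noteq> B \<longrightarrow> \<epsilon> \<le> delta_cut A B)" for S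
  have bound: "card S \<le> card K" if S: "sep S" for S
  proof -
    have rep: "representative ` S \<subseteq> graphons" "finite (representative ` S)"
      using S representative(1) by (auto simp: sep_def)
    obtain code where code: "code ` representative ` S \<subseteq> K"
      "\<And>f g. f \<in> representative ` S \<Longrightarrow> g \<in> representative ` S \<Longrightarrow> code f = code g \<Longrightarrow> orbit_dist f g < \<epsilon>"
      using K(2)[OF rep(2,1)] by auto
    have "inj_on (\<lambda>A. code (representative A)) S"
    proof (rule inj_onI, rule ccontr)
      fix A B assume AB: "A \<in> S" "B \<in> S" "code (representative A) = code (representative B)" "A \<noteq> B"
      then have M: "A \<in> graphon_classes" "B \<in> graphon_classes" using S by (auto simp only: sep_def)
      have "delta_cut A B < \<epsilon>"
        unfolding delta_cut_eq[OF M] using AB by (intro code(2)) auto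
      moreover have "\<epsilon> \<le> delta_cut A B" using S AB(1,2,4) unfolding sep_def by blast
      ultimately show False by simp
    qed
    then show ?thesis using code(1) K(1) by (intro card_inj_on_le) auto
  qed
  have "sep {}" by (simp add: sep_def)
  then have "\<exists>S. sep S \<and> (\<forall>T. sep T \<longrightarrow> card T \<le> card S)"
    using bound by (intro ex_has_greatest_nat[where b = "card K + 1"]) (auto simp: less_Suc_eq_le)
  then obtain S where S: "sep S" "\<And>T. sep T \<Longrightarrow> card T \<le> card S" by blast
  have "graphon_classes \<subseteq> (\<Union>A\<in>S. GS.mball A \<epsilon>)"
  proof
    fix B assume B: "B \<in> graphon_classes"
    show "B \<in> (\<Union>A\<in>S. GS.mball A \<epsilon>)"
    proof (rule ccontr)
      assume n: "B \<notin> (\<Union>A\<in>S. GS.mball A \<epsilon>)"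
      then have far: "\<epsilon> \<le> delta_cut A B" if "A \<in> S" for A
        using that B S(1) by (auto simp: sep_def GS.in_mball not_less)
      have "B \<notin> S" using far[of B] \<epsilon> B by auto
      moreover have "sep (insert B S)" using S(1) B far by (auto simp: sep_def GS.commute)
      ultimately show False using S(2)[of "insert B S"] S(1) by (auto simp: sep_def)
    qed
  qed
  then show "\<exists>S. finite S \<and> S \<subseteq> graphon_classes \<and> graphon_classes \<subseteq> (\<Union>A\<in>S. GS.mball A \<epsilon>)"
    using S(1) by (auto simp: sep_def)
qed

text \<open>Classes are close only up to rearrangement. Along a rapidly converging subsequence, each
  representative is rearranged to be close to the previously chosen one; the resulting graphons form
  a Cauchy sequence in the cut distance itself.\<close>

lemma graphon_classes_complete: "GS.mcomplete"
proof -
  have "\<exists>A. limitin GS.mtopology X A sequentially" if X: "GS.MCauchy X" for X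
  proof -
    have XM: "X n \<in> graphon_classes" for n using X by (auto simp: GS.MCauchy_def)
    have "\<forall>k. \<exists>N. \<forall>m\<ge>N. \<forall>n\<ge>N. delta_cut (X m) (X n) < (1/2) ^ k"
      using X by (auto simp: GS.MCauchy_def)
    then obtain b where b: "\<And>k m n. b k \<le> m \<Longrightarrow> b k \<le> n \<Longrightarrow> delta_cut (X m) (X n) < (1/2) ^ k"
      by metis
    \<comment> \<open>The summand k makes r strictly increasing, and the partial sum makes
      \<open>r k\<close> at least every \<open>b i\<close> with i \<le> k.\<close>
    define r where "r k = k + (\<Sum>i\<le>k. b i)" for k
    have r: "strict_mono r" by (rule strict_mono_Suc_iff[THEN iffD2]) (simp add: r_def)
    have br: "b k \<le> r m" if "k \<le> m" for k m
    proof -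
      have "b k \<le> (\<Sum>i\<le>m. b i)" by (rule member_le_sum) (use that in auto)
      then show ?thesis by (simp add: r_def)
    qed
    have "\<exists>f. \<forall>k. (f k \<in> graphons \<and> \<tau> (f k) = X (r k)) \<and> cut_dist (f k) (f (Suc k)) < (1/2) ^ k"
    proof (rule dependent_nat_choice)
      show "\<exists>f. f \<in> graphons \<and> \<tau> f = X (r 0)" using representative[OF XM] by blast
      fix f k assume f: "f \<in> graphons \<and> \<tau> f = X (r k)"
      let ?g = "representative (X (r (Suc k)))"
      note g = representative[OF XM, of "r (Suc k)"]
      have "orbit_dist f ?g < (1/2) ^ k"
        using b[OF br br, of k k "Suc k"] f g delta_cut_tau_eq[of f ?g] by simp
      then obtain \<sigma> where s: "\<sigma> \<in> mp_bijections" "cut_dist f (rearrange ?g \<sigma>) < (1/2) ^ k"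
        by (rule orbit_dist_lessE)
      then show "\<exists>g. (g \<in> graphons \<and> \<tau> g = X (r (Suc k))) \<and> cut_dist f g < (1/2) ^ k"
        using g rearrange_graphon tau_rearrange by (intro exI[of _ "rearrange ?g \<sigma>"]) auto
    qed
    then obtain f where f: "\<And>k. f k \<in> graphons" "\<And>k. \<tau> (f k) = X (r k)" "\<And>k. cut_dist (f k) (f (Suc k)) < (1/2) ^ k"
      by blast
    have tail: "cut_dist (f k) (f (k + j)) \<le> 2 * (1/2) ^ k - 2 * (1/2) ^ (k + j)" for k j
    proof (induction j)
      case 0
      then show ?case by (simp add: cut_dist_self[OF f(1)])
    next
      case (Suc j)
      have "cut_dist (f k) (f (k + Suc j)) \<le> cut_dist (f k) (f (k + j)) + cut_dist (f (k + j)) (f (k + Suc j))"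
        by (intro cut_dist_triangle f)
      then show ?case using Suc f(3)[of "k + j"] by simp
    qed
    have "\<exists>N. \<forall>m\<ge>N. \<forall>k\<ge>N. cut_dist (f m) (f k) < e" if e: "0 < e" for e
    proof -
      obtain N where N: "(1/2) ^ N < e / 4" using real_arch_pow_inv[of "e / 4" "1/2"] e by auto
      have "cut_dist (f N) (f m) < e / 2" if "N \<le> m" for m
      proof -
        have "cut_dist (f N) (f m) \<le> 2 * (1/2) ^ N - 2 * (1/2) ^ m" using tail[of N "m - N"] that by simp
        moreover have "0 < (1/2 :: real) ^ m" by simp
        ultimately show ?thesis using N by linarith
      qed
      then have near: "cut_dist (f N) (f m) < e / 2" if "N \<le> m" for m using that by blast
      have "cut_dist (f m) (f k) < e" if "N \<le> m" "N \<le> k" for m k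
      proof -
        have "cut_dist (f m) (f k) \<le> cut_dist (f m) (f N) + cut_dist (f N) (f k)"
          by (intro cut_dist_triangle f)
        then show ?thesis using near[OF that(1)] near[OF that(2)] cut_dist_commute[of "f m" "f N"] by simp
      qed
      then show ?thesis by blast
    qed
    then obtain g where g: "g \<in> graphons" "(\<lambda>m. cut_dist (f m) g) \<longlonglongrightarrow> 0"
      using cut_dist_complete[of f] f(1) by blast
    have "(\<lambda>k. delta_cut (X (r k)) (\<tau> g)) \<longlonglongrightarrow> 0"
    proof (rule tendsto_sandwich[OF _ _ tendsto_const g(2)])
      show "\<forall>\<^sub>F k in sequentially. 0 \<le> delta_cut (X (r k)) (\<tau> g)" by simp
      show "\<forall>\<^sub>F k in sequentially. delta_cut (X (r k)) (\<tau> g) \<le> cut_dist (f k) g"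
        using orbit_dist_le_cut_dist[OF f(1) g(1)] by (simp add: f(2)[symmetric] delta_cut_tau_eq f(1) g(1))
    qed
    then have "limitin GS.mtopology (X \<circ> r) (\<tau> g) sequentially"
      using XM tau_in_classes[OF g(1)] by (simp add: GS.limitin_metric_dist_null)
    then show ?thesis using GS.MCauchy_convergent_subsequence[OF X r] by blast
  qed
  then show ?thesis by (simp add: GS.mcomplete_def)
qed

lemma compact_graphon_topology: "compact_space graphon_topology"
  using graphon_classes_complete graphon_classes_totally_bounded
  by (simp add: GS.compact_space_eq_mcomplete_mtotally_bounded)

section \<open>Transfer of the local bounds to the laws on graphon classes\<close>

lemma prob_graphon_law:
  "measure_pmf.prob (graphon_law n p) S = measure_pmf.prob (random_graph n p) {E. \<tau> (graph_graphon n E) \<in> S}"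
  by (simp add: graphon_law_def vimage_def)

lemma delta_cut_graph:
  assumes "A \<in> graphon_classes"
  shows "delta_cut A (\<tau> (graph_graphon n E)) = orbit_dist (representative A) (graph_graphon n E)"
  using delta_cut_tau_eq[OF representative(1)[OF assms] graph_graphon_in_graphons[of n E]]
  by (simp add: representative(2)[OF assms])

text \<open>Probability 0 is included; its logarithm is -\<infinity>, and the bound is then
  immediate.\<close>

lemma scaled_log_le:
  assumes "0 < n" "0 \<le> x" "x \<le> exp (- (real n)\<^sup>2 * c)"
  shows "ereal (1 / real n ^ 2) * log_ereal x \<le> ereal (- c)"
proof (cases "x = 0")
  case True
  then show ?thesis using assms by (simp add: log_ereal_def)
next
  case False
  then have "ln x \<le> ln (exp (- (real n)\<^sup>2 * c))" using assms by (subst ln_le_cancel_iff) auto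
  then have "ln x \<le> - (real n)\<^sup>2 * c" by simp
  then have "ln x / (real n)\<^sup>2 \<le> - c" using assms by (simp add: field_simps)
  then show ?thesis using False by (simp add: log_ereal_def)
qed

lemma scaled_log_ge:
  assumes "0 < n" "exp (- (real n)\<^sup>2 * c) \<le> x"
  shows "ereal (- c) \<le> ereal (1 / real n ^ 2) * log_ereal x"
proof -
  have x: "0 < x" by (rule less_le_trans[OF _ assms(2)]) simp
  have "- (real n)\<^sup>2 * c \<le> ln x" using assms(2) x by (simp add: ln_ge_iff)
  then have "- c \<le> ln x / (real n)\<^sup>2" using assms(1) by (simp add: field_simps)
  then show ?thesis using x by (simp add: log_ereal_def)
qed

text \<open>The infimum is reached class by class: the class distance is at most the cut distance of
  representatives, so a cut ball around the representative of \<open>A\<close> is mapped into the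
  ball around \<open>A\<close> inside \<open>U\<close>.\<close>

lemma graphon_law_lower:
  assumes p: "0 < p" "p < 1" and U: "openin graphon_topology U"
  shows "- (INF A\<in>U. ereal (class_rate p A))
    \<le> liminf (\<lambda>n. ereal (1 / real n ^ 2) * log_ereal (measure_pmf.prob (graphon_law n p) U))"
proof -
  let ?l = "liminf (\<lambda>n. ereal (1 / real n ^ 2) * log_ereal (measure_pmf.prob (graphon_law n p) U))"
  have "- ?l \<le> ereal (class_rate p A)" if A: "A \<in> U" for A
  proof -
    have AM: "A \<in> graphon_classes" and "\<exists>\<epsilon>>0. GS.mball A \<epsilon> \<subseteq> U"
      using U A unfolding GS.openin_mtopology by blast+
    then obtain \<epsilon> where \<epsilon>: "0 < \<epsilon>" "GS.mball A \<epsilon> \<subseteq> U" by blast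
    let ?h = "representative A"
    note h = representative(1)[OF AM]
    have "ereal (- (class_rate p A + \<eta>)) \<le> ?l" if \<eta>: "0 < \<eta>" for \<eta>
    proof (rule Liminf_bounded)
      show "\<forall>\<^sub>F n in sequentially. ereal (- (class_rate p A + \<eta>))
          \<le> ereal (1 / real n ^ 2) * log_ereal (measure_pmf.prob (graphon_law n p) U)"
        using local_lower_bound[OF p h \<eta> \<epsilon>(1)] eventually_gt_at_top[of 0]
      proof eventually_elim
        case (elim n)
        have "measure_pmf.prob (random_graph n p) {E. cut_dist ?h (graph_graphon n E) < \<epsilon>}
            \<le> measure_pmf.prob (random_graph n p) {E. \<tau> (graph_graphon n E) \<in> U}"
        proof (rule measure_pmf.finite_measure_mono)
          show "{E. cut_dist ?h (graph_graphon n E) < \<epsilon>} \<subseteq> {E. \<tau> (graph_graphon n E) \<in> U}"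
          proof safe
            fix E assume "cut_dist ?h (graph_graphon n E) < \<epsilon>"
            then have "delta_cut A (\<tau> (graph_graphon n E)) < \<epsilon>"
              using orbit_dist_le_cut_dist[OF h graph_graphon_in_graphons[of n E]] by (simp add: delta_cut_graph[OF AM])
            then show "\<tau> (graph_graphon n E) \<in> U"
              using \<epsilon>(2) AM tau_in_classes[OF graph_graphon_in_graphons[of n E]] by (auto simp: GS.in_mball)
          qed
        qed simp
        with elim show ?case
          unfolding prob_graphon_law class_rate_def by (intro scaled_log_ge) auto
      qed
    qed
    then have "- ?l \<le> ereal (class_rate p A) + ereal \<eta>" if "0 < \<eta>" for \<eta>
      using that by (simp add: ereal_uminus_le_reorder)
    then show ?thesis by (rule ereal_le_epsilon2)
  qed
  then have "- ?l \<le> (INF A\<in>U. ereal (class_rate p A))" by (rule INF_greatest)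
  then show ?thesis by (simp add: ereal_uminus_le_reorder)
qed

lemma graphon_law_ball_upper:
  assumes p: "0 < p" "p < 1" and A: "A \<in> graphon_classes" and \<eta>: "0 < \<eta>"
  obtains \<epsilon> where "0 < \<epsilon>" "\<forall>\<^sub>F n in sequentially.
    measure_pmf.prob (graphon_law n p) (GS.mball A \<epsilon>) \<le> exp (- (real n)\<^sup>2 * (class_rate p A - \<eta>))"
proof -
  obtain \<epsilon> where \<epsilon>: "0 < \<epsilon>" "\<forall>\<^sub>F n in sequentially.
    measure_pmf.prob (random_graph n p) {E. orbit_dist (representative A) (graph_graphon n E) < \<epsilon>}
      \<le> exp (- (real n)\<^sup>2 * (rate p (representative A) - \<eta>))"
    using local_upper_bound[OF p representative(1)[OF A] \<eta>] by blast
  have "{E. \<tau> (graph_graphon n E) \<in> GS.mball A \<epsilon>} = {E. orbit_dist (representative A) (graph_graphon n E) < \<epsilon>}" for n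
    using A tau_in_classes[OF graph_graphon_in_graphons] by (auto simp: GS.in_mball delta_cut_graph[OF A])
  then show ?thesis using that[OF \<epsilon>(1)] \<epsilon>(2) by (simp only: prob_graphon_law class_rate_def)
qed

text \<open>Both the radius and the threshold for n in the ball estimate depend on the centre.
  Compactness leaves finitely many balls, hence one threshold and a bounded factor.\<close>

lemma graphon_law_upper:
  assumes p: "0 < p" "p < 1" and F: "closedin graphon_topology F"
  shows "limsup (\<lambda>n. ereal (1 / real n ^ 2) * log_ereal (measure_pmf.prob (graphon_law n p) F))
    \<le> - (INF A\<in>F. ereal (class_rate p A))"
proof (rule ereal_le_real)
  let ?q = "\<lambda>n. measure_pmf.prob (graphon_law n p) F"
  \<comment> \<open>Comparison with real upper bounds y covers the empty set too: the infimum is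
    then +\<infinity> and every real y qualifies.\<close>
  fix y :: real assume y: "- (INF A\<in>F. ereal (class_rate p A)) \<le> ereal y"
  have FM: "F \<subseteq> graphon_classes" using closedin_subset[OF F] by simp
  have rate: "- y \<le> class_rate p A" if "A \<in> F" for A
  proof -
    have "ereal (- y) \<le> (INF A\<in>F. ereal (class_rate p A))" using y by (simp add: ereal_uminus_le_reorder)
    also have "\<dots> \<le> ereal (class_rate p A)" by (rule INF_lower[OF that])
    finally show ?thesis by simp
  qed
  have "limsup (\<lambda>n. ereal (1 / real n ^ 2) * log_ereal (?q n)) \<le> ereal y + ereal \<eta>" if \<eta>: "0 < \<eta>" for \<eta>
  proof -
    let ?bound = "\<lambda>A e n. measure_pmf.prob (graphon_law n p) (GS.mball A e)
      \<le> exp (- (real n)\<^sup>2 * (class_rate p A - \<eta> / 2))"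
    have "\<forall>A\<in>F. \<exists>\<epsilon>. 0 < \<epsilon> \<and> (\<forall>\<^sub>F n in sequentially. ?bound A \<epsilon> n)"
    proof
      fix A assume A: "A \<in> F"
      obtain e where "0 < e" "\<forall>\<^sub>F n in sequentially. ?bound A e n"
        by (rule graphon_law_ball_upper[OF p subsetD[OF FM A] half_gt_zero[OF \<eta>]])
      then show "\<exists>\<epsilon>. 0 < \<epsilon> \<and> (\<forall>\<^sub>F n in sequentially. ?bound A \<epsilon> n)"
        by (intro exI[of _ e] conjI)
    qed
    from bchoice[OF this] obtain \<epsilon> where \<epsilon>': "\<forall>A\<in>F. 0 < \<epsilon> A \<and> (\<forall>\<^sub>F n in sequentially. ?bound A (\<epsilon> A) n)" ..
    have \<epsilon>: "\<And>A. A \<in> F \<Longrightarrow> 0 < \<epsilon> A" "\<And>A. A \<in> F \<Longrightarrow> \<forall>\<^sub>F n in sequentially. ?bound A (\<epsilon> A) n"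
      using \<epsilon>' by simp_all
    have "compactin graphon_topology F" by (rule closedin_compact_space[OF compact_graphon_topology F])
    moreover have "F \<subseteq> \<Union> ((\<lambda>A. GS.mball A (\<epsilon> A)) ` F)" using FM \<epsilon>(1) by force
    ultimately obtain \<F> where \<F>: "finite \<F>" "\<F> \<subseteq> (\<lambda>A. GS.mball A (\<epsilon> A)) ` F" "F \<subseteq> \<Union>\<F>"
      using compactinD[of graphon_topology F "(\<lambda>A. GS.mball A (\<epsilon> A)) ` F"] by auto
    then obtain S where S: "finite S" "S \<subseteq> F" "\<F> = (\<lambda>A. GS.mball A (\<epsilon> A)) ` S"
      using finite_subset_image[OF \<F>(1,2)] by blast
    have ev: "\<forall>\<^sub>F n in sequentially. \<forall>A\<in>S. ?bound A (\<epsilon> A) n"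
      using S(1,2) \<epsilon>(2) by (intro eventually_ball_finite) auto
    \<comment> \<open>Half of \<eta> is spent in the ball estimates and half on the number of balls;
      adding 1 keeps the logarithm meaningful when there are none.\<close>
    have "\<forall>\<^sub>F n in sequentially. ln (real (card S) + 1) \<le> \<eta> / 2 * (real n)\<^sup>2"
    proof -
      have "\<forall>\<^sub>F n in sequentially. c \<le> \<eta> / 2 * (real n)\<^sup>2" for c :: real using \<eta> by real_asymp
      then show ?thesis .
    qed
    then have "\<forall>\<^sub>F n in sequentially. ereal (1 / real n ^ 2) * log_ereal (?q n) \<le> ereal (y + \<eta>)"
      using ev eventually_gt_at_top[of 0]
    proof eventually_elim
      case (elim n)
      have "?q n \<le> measure_pmf.prob (graphon_law n p) (\<Union>A\<in>S. GS.mball A (\<epsilon> A))"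
        using \<F>(3) S(3) by (intro measure_pmf.finite_measure_mono) auto
      also have "\<dots> \<le> (\<Sum>A\<in>S. measure_pmf.prob (graphon_law n p) (GS.mball A (\<epsilon> A)))"
        by (rule measure_pmf.finite_measure_subadditive_finite[OF S(1)]) auto
      also have "\<dots> \<le> (\<Sum>A\<in>S. exp (- (real n)\<^sup>2 * (- y - \<eta> / 2)))"
      proof (rule sum_mono)
        fix A assume A: "A \<in> S"
        have "?bound A (\<epsilon> A) n"
          using elim(2) A by blast
        also have "\<dots> \<le> exp (- (real n)\<^sup>2 * (- y - \<eta> / 2))"
          using rate[of A] A S(2) by (auto intro!: mult_left_mono)
        finally show "measure_pmf.prob (graphon_law n p) (GS.mball A (\<epsilon> A)) \<le> \<dots>" .
      qed
      also have "\<dots> \<le> exp (ln (real (card S) + 1)) * exp (- (real n)\<^sup>2 * (- y - \<eta> / 2))" by simp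
      also have "\<dots> \<le> exp (\<eta> / 2 * (real n)\<^sup>2) * exp (- (real n)\<^sup>2 * (- y - \<eta> / 2))"
        by (intro mult_right_mono) (simp_all only: exp_le_cancel_iff elim(1) exp_ge_zero)
      also have "\<dots> = exp (- (real n)\<^sup>2 * (- (y + \<eta>)))"
        by (simp add: mult_exp_exp algebra_simps)
      finally have "ereal (1 / real n ^ 2) * log_ereal (?q n) \<le> ereal (- (- (y + \<eta>)))"
        by (rule scaled_log_le[OF elim(3) measure_nonneg])
      then show ?case by (simp only: minus_minus)
    qed
    then show ?thesis by (intro Limsup_bounded) simp
  qed
  then show "limsup (\<lambda>n. ereal (1 / real n ^ 2) * log_ereal (?q n)) \<le> ereal y"
    by (rule ereal_le_epsilon2)
qed

theorem theorem2p3: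
  fixes p :: real
  assumes "0 < p" and "p < 1"
  shows "(\<forall>F. closedin graphon_topology F \<longrightarrow>
            limsup (\<lambda>n. ereal (1 / real n ^ 2) * log_ereal (measure_pmf.prob (graphon_law n p) F))
              \<le> - (INF A\<in>F. ereal (class_rate p A))) \<and>
         (\<forall>U. openin graphon_topology U \<longrightarrow>
            liminf (\<lambda>n. ereal (1 / real n ^ 2) * log_ereal (measure_pmf.prob (graphon_law n p) U))
              \<ge> - (INF A\<in>U. ereal (class_rate p A)))"
  using graphon_law_upper[OF assms] graphon_law_lower[OF assms] by blast

end
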